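(* Let $\epsilon>0$. For every integer $q\ge1$, every integer $l$ with $(l,q)=1$, and all real numbers $A,B$ and $K,L>0$, \[ N_{A,B}(K,L) = \frac{\phi(q)KL}{q^2} + O\Bigl(\frac{K+L}{q^{1/2-\epsilon}} + q^{1/2+\epsilon}\Bigr), \] where the implied constant depends at most on $\epsilon$.
   Context: Here \[ N_{A,B}(K,L) := \#\{(a,b)\in\mathbb{Z}^2 : a^2b^3\equiv l \pmod q,\ A<a\le A+K,\ B<b\le B+L\}, \] $(l,q)$ is the greatest common divisor and $\phi$ is Euler's totient function. *)

theory Defs
  imports "HOL-Analysis.Analysis" "HOL-Number_Theory.Number_Theory"
begin

(* The modulus q and the residue l are explicit parameters. For real A, B, K, L the
   counted set is always finite, so card returns its true number of elements. *)
definition N_count :: "nat \<Rightarrow> int \<Rightarrow> real \<Rightarrow> real \<Rightarrow> real \<Rightarrow> real \<Rightarrow> nat" where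
  "N_count q l A B K L =
     card {(a :: int, b :: int).
       [a ^ 2 * b ^ 3 = l] (mod int q) \<and>
       A < of_int a \<and> of_int a \<le> A + K \<and>
       B < of_int b \<and> of_int b \<le> B + L}"

end

theory Submission
  imports Defs "Berlekamp_Zassenhaus.Finite_Field" "HOL-Algebra.Algebraic_Closure_Type"
begin

hide_const (open) Divisibility.prime UnivPoly.coeff UnivPoly.monom Coset.order
  Polynomials.degree Polynomials.lead_coeff Module.smult

text \<open>
  Detecting the congruences \<open>a = \<alpha>\<close>, \<open>b = \<beta>\<close> modulo \<open>q\<close> by additive characters expresses the count
  through the sums \<open>ES q l u v\<close> of \<open>e((u a + v b) / q)\<close> over the solutions of \<open>a\<^sup>2 b\<^sup>3 = l\<close> modulo \<open>q\<close>;
  the frequency \<open>(0, 0)\<close> gives the main term. These sums are multiplicative in \<open>q\<close> and bounded by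
  \<open>300\<^sup>\<omega> (q gcd(u, v, q))\<^sup>1\<^sup>/\<^sup>2\<close>, where \<open>\<omega>\<close> is the number of primes dividing \<open>q\<close>. For higher prime powers
  this is the method of stationary phase: the curve has the infinitesimal automorphism
  \<open>(a (1 + 3 x), b (1 - 2 x))\<close>, and averaging over it leaves only critical points.

  For a prime \<open>p\<close> the solutions are parametrised by \<open>t = a b\<close>, which gives the Weil sum of
  \<open>m t\<^sup>3 + n / t\<^sup>2\<close>. The associated L-function is a polynomial of degree at most \<open>5\<close>, so the sums over
  the extensions of the prime field are, up to sign, power sums of at most five complex numbers.
  A Stepanov argument in Bombieri's form, applied to \<open>y\<^sup>p - y = m x\<^sup>3 + n / x\<^sup>2\<close>, bounds these power
  sums by a constant times \<open>p\<^sup>r\<close> over the field with \<open>p\<^sup>2\<^sup>r\<close> elements, which forces each of the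
  numbers to have modulus at most \<open>p\<^sup>1\<^sup>/\<^sup>2\<close>.
\<close>


section \<open>Polynomials, additive characters and power sums\<close>

text \<open>The Stepanov constant depends on \<open>p\<close>, so no single field yields a useful
  estimate at primes; but it does not depend on \<open>r\<close>, and a bound for power sums that
  grows like \<open>p ^ r\<close> limits each of the numbers summed. The fields have square order
  because applying the \<open>p ^ r\<close>-power map twice is then the identity on \<open>x\<close>
  and a simple substitution on \<open>w\<close>: raising a function to that power exchanges high and
  low exponents. The method gives only upper bounds for the number of points with a prescribed
  trace, but these numbers add up to the size of the field, which makes up for the missing lower
  bounds. At prime powers the obstacle is the primes 2, 3 and 5, where the critical equation
  \<open>3 u t ^ 5 = 2 v l ^ 2\<close> degenerates; they cost bounded factors. All constants may be
  generous, since a constant to the power of the number of primes is absorbed by \<open>q\<close> to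
  the power \<open>\<epsilon>\<close>.\<close>

lemma linear_dependence_poly:
  fixes P :: "'i \<Rightarrow> 'k::field poly"
  assumes "finite I" "card I > N" "\<And>i k. i \<in> I \<Longrightarrow> k \<ge> N \<Longrightarrow> coeff (P i) k = 0"
  shows "\<exists>b. (\<exists>i\<in>I. b i \<noteq> 0) \<and> (\<Sum>i\<in>I. smult (b i) (P i)) = 0"
  using assms
proof (induction N arbitrary: I P)
  case 0
  then obtain i where "i \<in> I" by fastforce
  moreover have "P j = 0" if "j \<in> I" for j
    using 0(3)[OF that] by (intro poly_eqI) auto
  ultimately show ?case
    by (intro exI[of _ "\<lambda>_. 1"]) auto
next
  case (Suc N)
  show ?case
  proof (cases "\<forall>i\<in>I. coeff (P i) N = 0")
    case True
    have "coeff (P i) k = 0" if "i \<in> I" "k \<ge> N" for i k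
      using Suc.prems(3)[OF that(1), of k] True that by (cases "k = N") auto
    then show ?thesis using Suc.IH[of I P] Suc.prems by auto
  next
    case False
    then obtain i0 where i0: "i0 \<in> I" "coeff (P i0) N \<noteq> 0" by auto
    \<comment> \<open>Gaussian elimination with pivot \<open>P i0\<close>: every other polynomial
      loses its coefficient at \<open>N\<close>, and the family shrinks by one together with the
      number of coefficients.\<close>
    define \<rho> where "\<rho> i = coeff (P i) N / coeff (P i0) N" for i
    define J where "J = I - {i0}"
    have "card J > N" "finite J" using Suc.prems i0 by (auto simp: J_def)
    moreover have "coeff (P i - smult (\<rho> i) (P i0)) k = 0" if "i \<in> J" "k \<ge> N" for i k
      using Suc.prems(3)[of i k] Suc.prems(3)[OF i0(1), of k] that i0
      by (cases "k = N") (auto simp: \<rho>_def J_def)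
    ultimately obtain b where b: "\<exists>i\<in>J. b i \<noteq> 0"
      "(\<Sum>i\<in>J. smult (b i) (P i - smult (\<rho> i) (P i0))) = 0"
      using Suc.IH[of J "\<lambda>i. P i - smult (\<rho> i) (P i0)"] by blast
    define b' where "b' = b(i0 := - (\<Sum>i\<in>J. b i * \<rho> i))"
    have "(\<Sum>i\<in>I. smult (b' i) (P i)) = smult (b' i0) (P i0) + (\<Sum>i\<in>J. smult (b' i) (P i))"
      using Suc.prems i0 by (simp add: J_def sum.remove[of I i0])
    also have "(\<Sum>i\<in>J. smult (b' i) (P i)) = (\<Sum>i\<in>J. smult (b i) (P i))"
      by (intro sum.cong) (auto simp: b'_def J_def)
    also have "smult (b' i0) (P i0) = - (\<Sum>i\<in>J. smult (b i * \<rho> i) (P i0))"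
      by (simp add: b'_def smult_sum)
    also have "- (\<Sum>i\<in>J. smult (b i * \<rho> i) (P i0)) + (\<Sum>i\<in>J. smult (b i) (P i)) = 
      (\<Sum>i\<in>J. smult (b i) (P i - smult (\<rho> i) (P i0)))"
      by (simp add: smult_diff_right sum_subtractf)
    finally have "(\<Sum>i\<in>I. smult (b' i) (P i)) = 0" using b by simp
    moreover have "\<exists>i\<in>I. b' i \<noteq> 0" using b(1) by (auto simp: b'_def J_def)
    ultimately show ?thesis by blast
  qed
qed

text \<open>Among the terms with a nonzero scalar exactly one has the largest degree, and nothing
  can cancel its leading coefficient. In the Stepanov argument this shows that the auxiliary
  function is not zero.\<close>

lemma sum_smult_distinct_degree_neq_0:
  fixes P :: "'i \<Rightarrow> 'k::field poly"
  assumes "finite I" "\<And>i. i \<in> I \<Longrightarrow> P i \<noteq> 0" "inj_on (\<lambda>i. degree (P i)) I"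
    and "i \<in> I" "a i \<noteq> 0"
  shows "(\<Sum>i\<in>I. smult (a i) (P i)) \<noteq> 0"
proof -
  define J where "J = {i\<in>I. a i \<noteq> 0}"
  define D where "D = Max ((\<lambda>i. degree (P i)) ` J)"
  have J: "finite J" "J \<noteq> {}" using assms by (auto simp: J_def)
  then have "D \<in> (\<lambda>i. degree (P i)) ` J" unfolding D_def by (intro Max_in) auto
  then obtain j where j: "j \<in> J" "degree (P j) = D" by auto
  have "coeff (smult (a i) (P i)) D = 0" if "i \<in> I - {j}" for i
  proof (cases "a i = 0")
    case False
    then have "i \<in> J" using that by (auto simp: J_def)
    then have "degree (P i) \<le> D" unfolding D_def using J by auto
    moreover have "degree (P i) \<noteq> D" using inj_onD[OF assms(3), of i j] j that by (auto simp: J_def)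
    ultimately show ?thesis by (auto intro: coeff_eq_0)
  qed auto
  then have "(\<Sum>i\<in>I - {j}. coeff (smult (a i) (P i)) D) = 0"
    by (intro sum.neutral ballI)
  then have "coeff (\<Sum>i\<in>I. smult (a i) (P i)) D = coeff (smult (a j) (P j)) D"
    using j assms(1) unfolding coeff_sum 
    by (subst sum.remove[of I j]) (simp_all add: J_def)
  also have "\<dots> \<noteq> 0" using j assms(2)[of j] by (auto simp: J_def)
  finally show ?thesis by auto
qed

lemma coeff_pcompose_monom:
  fixes g :: "'k::comm_semiring_1 poly"
  assumes "d > 0"
  shows "coeff (pcompose g (monom 1 d)) k = (if d dvd k then coeff g (k div d) else 0)"
  using assms
proof (induction g arbitrary: k)
  case (pCons a g)
  show ?case
  proof (cases "k < d")
    case True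
    then show ?thesis using pCons(3)
      by (cases "k = 0") (auto simp: pcompose_pCons coeff_monom_mult coeff_pCons dest: dvd_imp_le split: nat.splits)
  next
    case False
    have *: "coeff (pcompose (pCons a g) (monom 1 d)) k = coeff (pcompose g (monom 1 d)) (k - d)"
      using False pCons(3) by (auto simp: pcompose_pCons coeff_monom_mult coeff_pCons split: nat.splits)
    have "d dvd k - d \<longleftrightarrow> d dvd k" using False by (simp add: dvd_minus_self)
    moreover have "k div d = Suc ((k - d) div d)" using False pCons(3) by (simp add: le_div_geq)
    ultimately show ?thesis unfolding * using pCons.IH[OF pCons(3), of "k - d"] by auto
  qed
qed auto

lemma degree_diff_eq_left:
  "degree q < degree g \<Longrightarrow> degree (g - q) = degree (g :: 'a::ab_group_add poly)"
  using degree_add_eq_left[of "-q" g] by simp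

section \<open>Additive characters modulo \<open>q\<close>\<close>

text \<open>All finite fields of characteristic \<open>p\<close> live inside one algebraically closed field: the field
  with \<open>p\<^sup>k\<close> elements is the set of fixed points of \<open>x \<mapsto> x ^ (p ^ k)\<close>.\<close>

definition char_mod :: "nat \<Rightarrow> int \<Rightarrow> complex" where
  "char_mod q k = cis (2 * pi * of_int k / of_nat q)"

lemma norm_char_mod [simp]: "norm (char_mod q k) = 1"
  by (simp add: char_mod_def)

lemma char_mod_0 [simp]: "char_mod q 0 = 1"
  by (simp add: char_mod_def)

lemma char_mod_add: "char_mod q (a + b) = char_mod q a * char_mod q b"
  by (simp add: char_mod_def cis_mult add_divide_distrib distrib_left)

lemma char_mod_mult_self: "q > 0 \<Longrightarrow> char_mod q (int q * k) = 1"
  using cis_multiple_2pi[of "of_int k"] by (simp add: char_mod_def mult.assoc)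

lemma char_mod_cong: "q > 0 \<Longrightarrow> [a = b] (mod int q) \<Longrightarrow> char_mod q a = char_mod q b"
  by (auto simp: cong_iff_lin char_mod_add char_mod_mult_self)

lemma char_mod_scale: "d > 0 \<Longrightarrow> char_mod (d * q) (int d * k) = char_mod q k"
  by (simp add: char_mod_def mult.assoc)

lemma char_mod_power: "char_mod q k ^ i = char_mod q (int i * k)"
  by (simp add: char_mod_def Complex.DeMoivre mult.left_commute)

lemma char_mod_eq_1_iff: "q > 0 \<Longrightarrow> char_mod q k = 1 \<longleftrightarrow> int q dvd k"
proof
  assume q: "q > 0" and 1: "char_mod q k = 1"
  from 1 have "cos (2 * pi * of_int k / of_nat q) = 1"
    by (simp add: char_mod_def complex_eq_iff)
  then obtain i :: int where "2 * pi * of_int k / of_nat q = of_int i * 2 * pi"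
    by (auto simp: cos_one_2pi_int)
  then have "of_int k = (of_int (int q * i) :: real)" using q by (simp add: field_simps)
  then have "k = int q * i" by (simp only: of_int_eq_iff)
  then show "int q dvd k" by simp
next
  assume "q > 0" "int q dvd k"
  then show "char_mod q k = 1" by (auto simp: char_mod_mult_self)
qed

lemma sum_char_mod:
  assumes "q > 0"
  shows "(\<Sum>k<q. char_mod q (h * int k)) = (if int q dvd h then of_nat q else 0)"
proof -
  have e: "(\<Sum>k<q. char_mod q (h * int k)) = (\<Sum>k<q. char_mod q h ^ k)"
    by (simp add: char_mod_power mult.commute)
  show ?thesis
  proof (cases "int q dvd h")
    case True
    then show ?thesis unfolding e using assms by (simp add: char_mod_eq_1_iff[THEN iffD2])
  next
    case False
    then have "char_mod q h \<noteq> 1" using assms by (simp add: char_mod_eq_1_iff)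
    moreover have "char_mod q h ^ q = 1" using assms by (simp add: char_mod_power char_mod_mult_self)
    ultimately show ?thesis unfolding e using False by (simp add: geometric_sum)
  qed
qed

section \<open>Roots with multiplicity, and complex power sums\<close>

lemma size_proots_alg_closed:
  fixes P :: "'k::alg_closed_field poly"
  assumes "P \<noteq> 0"
  shows "size (proots P) = degree P"
proof -
  obtain A where A: "size A = degree P" "P = smult (lead_coeff P) (\<Prod>x\<in>#A. [:-x, 1:])"
    using alg_closed_imp_factorization[OF assms] by blast
  have "(\<Prod>x\<in>#B. [:-x, 1:]) \<noteq> 0 \<and> proots (\<Prod>x\<in>#B. [:-x, 1:]) = B" for B :: "'k multiset"
    by (induction B) (auto simp: proots_mult simp del: mult_pCons_left)
  then have "proots P = A"
    using A(2) assms by (metis proots_smult leading_coeff_0_iff)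
  then show ?thesis using A(1) by simp
qed

lemma prod_linear_power_dvd:
  fixes g :: "'k::field poly"
  assumes "finite B" "g \<noteq> 0" "\<And>b. b \<in> B \<Longrightarrow> order b g \<ge> a"
  shows "(\<Prod>b\<in>B. [:-b, 1:]) ^ a dvd g"
  using assms
proof (induction B rule: finite_induct)
  case (insert b B)
  define P where "P = (\<Prod>b\<in>B. [:-b, 1:]) ^ a"
  have "P dvd g" unfolding P_def using insert by auto
  then obtain h where h: "g = P * h" by (elim dvdE)
  have "poly P b \<noteq> 0" using insert by (auto simp: P_def poly_prod)
  then have "order b P = 0" by (simp add: order_0I)
  moreover have "order b g = order b P + order b h" using insert.prems(1) unfolding h by (rule order_mult)
  ultimately have "order b h \<ge> a" using insert.prems(2)[of b] by simp
  then have "[:-b, 1:] ^ a dvd h" by (subst order_divides) auto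
  then have "P * [:-b, 1:] ^ a dvd g" unfolding h by (rule mult_dvd_mono[OF dvd_refl])
  then show ?case using insert by (simp add: P_def power_mult_distrib mult.commute del: mult_pCons_left mult_pCons_right)
qed simp

text \<open>A number \<open>w\<close> other than \<open>z\<close> is eliminated by taking the sum of
  order \<open>r + 1\<close> minus \<open>w\<close> times the sum of order \<open>r\<close>: the
  coefficients become \<open>c y * (y - w)\<close>, nonzero away from \<open>w\<close>, and the sums
  stay bounded. Once only \<open>z\<close> is left, \<open>norm z > 1\<close> would make its powers
  unbounded.\<close>

lemma bounded_power_sum_imp_norm_le_1:
  fixes c :: "complex \<Rightarrow> complex"
  assumes "finite Z" "z \<in> Z" "\<And>y. y \<in> Z \<Longrightarrow> c y \<noteq> 0"
    and "\<And>r. r \<ge> R \<Longrightarrow> norm (\<Sum>y\<in>Z. c y * y ^ r) \<le> C"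
  shows "norm z \<le> 1"
  using assms
proof (induction "card Z" arbitrary: Z c C rule: less_induct)
  case less
  show ?case
  proof (cases "Z = {z}")
    case True
    show ?thesis
    proof (rule ccontr)
      assume "\<not> norm z \<le> 1"
      then have z: "norm z > 1" by simp
      have c: "norm (c z) > 0" using less.prems by simp
      obtain r where r: "C / norm (c z) < norm z ^ r" using real_arch_pow[OF z] by blast
      have "norm z ^ r \<le> norm z ^ (max r R)" using z by (intro power_increasing) auto
      then have "C / norm (c z) < norm z ^ (max r R)" using r by simp
      then have "C < norm (c z) * norm z ^ (max r R)" using c by (simp add: divide_less_eq mult.commute)
      moreover have "norm (c z) * norm z ^ (max r R) \<le> C"
        using less.prems(4)[of "max r R"] True by (simp add: norm_mult norm_power)
      ultimately show False by simp
    qed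
  next
    case False
    then obtain w where w: "w \<in> Z" "w \<noteq> z" using less.prems by blast
    define Z' where "Z' = Z - {w}"
    define c' where "c' y = c y * (y - w)" for y
    show ?thesis
    proof (rule less.hyps[of Z' c' "C + norm w * C"])
      show "card Z' < card Z" using w less.prems unfolding Z'_def by (intro card_Diff1_less)
      show "finite Z'" "z \<in> Z'" using w less.prems by (auto simp: Z'_def)
      show "c' y \<noteq> 0" if "y \<in> Z'" for y using that less.prems by (auto simp: c'_def Z'_def)
      fix r assume r: "r \<ge> R"
      have "(\<Sum>y\<in>Z'. c' y * y ^ r) = (\<Sum>y\<in>Z. c' y * y ^ r)"
        unfolding Z'_def using less.prems w by (simp add: sum.remove[of Z w] c'_def)
      also have "\<dots> = (\<Sum>y\<in>Z. c y * y ^ Suc r) - w * (\<Sum>y\<in>Z. c y * y ^ r)"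
        by (simp add: c'_def sum_distrib_left algebra_simps sum_subtractf)
      also have "norm \<dots> \<le> norm (\<Sum>y\<in>Z. c y * y ^ Suc r) + norm w * norm (\<Sum>y\<in>Z. c y * y ^ r)"
        by (rule order.trans[OF norm_triangle_ineq4]) (simp add: norm_mult)
      also have "\<dots> \<le> C + norm w * C"
        using r by (intro add_mono mult_left_mono less.prems(4)) auto
      finally show "norm (\<Sum>y\<in>Z'. c' y * y ^ r) \<le> C + norm w * C" .
    qed
  qed
qed

lemma sum_count_mset:
  fixes g :: "'b \<Rightarrow> 'c::comm_semiring_1"
  assumes "finite B" "set_mset M \<subseteq> B"
  shows "(\<Sum>y\<in>B. of_nat (count M y) * g y) = (\<Sum>y\<in>#M. g y)"
  using assms
proof (induction M)
  case (add x M)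
  have "(\<Sum>y\<in>B. of_nat (count (add_mset x M) y) * g y) =
    (\<Sum>y\<in>B. of_nat (count M y) * g y + (if y = x then g y else 0))"
    by (intro sum.cong) (auto simp: algebra_simps)
  then show ?case using add by (simp add: sum.distrib add.commute)
qed simp

definition psum :: "complex multiset \<Rightarrow> nat \<Rightarrow> complex" where
  "psum W k = (\<Sum>w\<in>#W. w ^ k)"

text \<open>The polynomial with constant coefficient 1 and inverse roots \<open>W\<close>, the shape
  in which an L-function factors. Zeros in \<open>W\<close> contribute the factor 1.\<close>

definition char_fac :: "complex multiset \<Rightarrow> complex poly" where
  "char_fac W = (\<Prod>w\<in>#W. [:1, -w:])"

text \<open>The logarithmic derivative of a product of factors \<open>1 - w X\<close>: each factor
  contributes the geometric series in \<open>w X\<close> without its constant term. Multiplying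
  through by the product avoids division.\<close>

lemma newton_fps:
  "fps_X * fps_deriv (fps_of_poly (char_fac W)) =
    - (fps_of_poly (char_fac W) * Abs_fps (\<lambda>k. if k = 0 then 0 else psum W k))"
proof (induction W)
  case empty
  have "Abs_fps (\<lambda>k. if k = 0 then 0 else psum {#} k) = 0" by (rule fps_ext) (simp add: psum_def)
  then show ?case by (simp add: char_fac_def)
next
  case (add w W)
  let ?F = "fps_of_poly (char_fac W)"
  let ?P = "Abs_fps (\<lambda>k. if k = 0 then 0 else psum W k)"
  define E where "E = 1 - fps_const w * fps_X"
  define G where "G = Abs_fps (\<lambda>k. if k = 0 then 0 else w ^ k)"
  have EG: "E * G = fps_const w * fps_X"
  proof (rule fps_ext)
    fix k show "fps_nth (E * G) k = fps_nth (fps_const w * fps_X) k"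
      by (cases k) (auto simp: E_def G_def algebra_simps fps_X_mult_nth mult.assoc split: nat.splits)
  qed
  have F: "fps_of_poly (char_fac (add_mset w W)) = E * ?F"
    
  proof -
    have "fps_of_poly [:1, -w:] = E" by (simp add: E_def fps_of_poly_pCons)
    moreover have "char_fac (add_mset w W) = [:1, -w:] * char_fac W" by (simp add: char_fac_def)
    ultimately show ?thesis by (simp only: fps_of_poly_mult)
  qed
  have P: "Abs_fps (\<lambda>k. if k = 0 then 0 else psum (add_mset w W) k) = G + ?P"
    by (rule fps_ext) (simp add: psum_def G_def)
  have "fps_deriv E = - fps_const w" by (simp add: E_def)
  then have "fps_X * fps_deriv (E * ?F) = E * (fps_X * fps_deriv ?F) - fps_const w * fps_X * ?F"
    by (simp add: algebra_simps)
  also have "\<dots> = - (E * ?F * ?P) - E * G * ?F" unfolding add.IH EG by (simp add: algebra_simps)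
  also have "\<dots> = - (E * ?F * (G + ?P))" by (simp add: algebra_simps)
  finally show ?case unfolding F P .
qed

lemma newton:
  "of_nat d * coeff (char_fac W) d = - (\<Sum>j\<in>{1..d}. psum W j * coeff (char_fac W) (d - j))"
proof -
  have "of_nat d * coeff (char_fac W) d = fps_nth (fps_X * fps_deriv (fps_of_poly (char_fac W))) d"
    by (cases d) auto
  also have "\<dots> = - (\<Sum>j=0..d. (if j = 0 then 0 else psum W j) * coeff (char_fac W) (d - j))"
    unfolding newton_fps by (subst mult.commute) (simp add: fps_mult_nth)
  also have "(\<Sum>j=0..d. (if j = 0 then 0 else psum W j) * coeff (char_fac W) (d - j)) =
    (\<Sum>j\<in>{1..d}. psum W j * coeff (char_fac W) (d - j))"
    by (rule sum.mono_neutral_cong_right) auto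
  finally show ?thesis .
qed

section \<open>The complete exponential sums\<close>

definition sols :: "nat \<Rightarrow> int \<Rightarrow> (int \<times> int) set" where
  "sols q l = {(a, b). a \<in> {0..<int q} \<and> b \<in> {0..<int q} \<and> [a ^ 2 * b ^ 3 = l] (mod int q)}"

definition ES :: "nat \<Rightarrow> int \<Rightarrow> int \<Rightarrow> int \<Rightarrow> complex" where
  "ES q l u v = (\<Sum>(a, b)\<in>sols q l. char_mod q (u * a + v * b))"

lemma finite_sols [simp]: "finite (sols q l)"
  by (rule finite_subset[of _ "{0..<int q} \<times> {0..<int q}"]) (auto simp: sols_def)

text \<open>Naming the bound as a property of \<open>p\<close> allows a hypothetical counterexample
  to be chosen. Frequencies \<open>u\<close> divisible by \<open>p\<close> are left to a quadratic
  Gauss sum, because the cubic term then disappears.\<close>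

definition weil_at :: "nat \<Rightarrow> bool" where
  "weil_at p \<longleftrightarrow> (\<forall>u v l. \<not> int p dvd u \<longrightarrow> \<not> int p dvd l \<longrightarrow> norm (ES p l u v) \<le> 5 * sqrt (real p))"

section \<open>The Weil bound for \<open>m x\<^sup>3 + n x\<^sup>-\<^sup>2\<close>\<close>

text \<open>The conditions on \<open>m ^ p\<close> and \<open>n ^ p\<close> place both coefficients
  in the prime field. \<open>m \<noteq> 0\<close> gives the function a pole of order 3 at infinity,
  prime to the characteristic since \<open>p > 3\<close>; \<open>n = 0\<close> must be allowed
  because \<open>v\<close> may be divisible by \<open>p\<close>.\<close>

locale laurent_sum =
  fixes p :: nat and m n :: "'k::alg_closed_field"
  assumes prime_p: "prime p" and p_gt_3: "p > 3" and char_p: "CHAR('k) = p"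
    and m_frob: "m ^ p = m" and n_frob: "n ^ p = n" and m_nz: "m \<noteq> 0"
begin

lemma frob_add: "(x + y :: 'k) ^ (p ^ i) = x ^ (p ^ i) + y ^ (p ^ i)"
  using freshmans_dream'[where 'a='k] prime_p char_p by simp

lemma frob_sum: "(sum g A :: 'k) ^ (p ^ i) = (\<Sum>a\<in>A. g a ^ (p ^ i))"
  by (rule freshmans_dream_sum') (use prime_p char_p in auto)

lemma p_pos: "p > 0" using p_gt_3 by simp

lemma frob_uminus: "(- x :: 'k) ^ (p ^ i) = - (x ^ (p ^ i))"
proof -
  have "x ^ (p ^ i) + (-x) ^ (p ^ i) = 0"
    using frob_add[of x "-x" i] p_pos by (simp add: power_0_left)
  then show ?thesis by (simp add: add_eq_0_iff)
qed

lemma frob_diff: "(x - y :: 'k) ^ (p ^ i) = x ^ (p ^ i) - y ^ (p ^ i)"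
  using frob_add[of x "-y" i] frob_uminus[of y i] by simp

lemma frob_fixed_power: "(x::'k) ^ p = x \<Longrightarrow> x ^ (p ^ i) = x"
  by (induction i) (auto simp: power_mult)

lemma of_nat_frob: "(of_nat k :: 'k) ^ (p ^ i) = of_nat k"
  by (induction k) (auto simp: frob_add p_pos)

section \<open>The Laurent polynomial, its trace, and the Artin-Schreier curve\<close>

definition f :: "'k \<Rightarrow> 'k" where "f x = m * x ^ 3 + n * inverse x ^ 2"

definition tr :: "nat \<Rightarrow> 'k \<Rightarrow> 'k" where "tr k x = (\<Sum>i<k. x ^ (p ^ i))"

text \<open>Iterating the Artin-Schreier equation accumulates the conjugates of \<open>v\<close>.
  With exponent \<open>r\<close> this expresses a Frobenius power through \<open>y\<close> itself;
  with \<open>2 * r\<close> it only adds the trace, which is constant on the points to be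
  counted.\<close>

lemma artin_schreier_power:
  assumes "y ^ p = y + (v :: 'k)"
  shows "y ^ (p ^ k) = y + tr k v"
proof (induction k)
  case (Suc k)
  have "y ^ (p ^ Suc k) = (y ^ p) ^ (p ^ k)" by (simp add: power_mult)
  also have "\<dots> = y ^ (p ^ k) + v ^ (p ^ k)" by (simp add: assms frob_add)
  finally show ?case using Suc by (simp add: tr_def add_ac)
qed (auto simp: tr_def)

lemma artin_schreier_roots:
  "\<exists>Y. finite Y \<and> card Y = p \<and> (\<forall>y\<in>Y. y ^ p = y + (v :: 'k))"
proof -
  define P where "P = monom 1 p - [:v, 1:]"
  have "degree P = p"
    unfolding P_def using p_gt_3 
    by (subst degree_diff_eq_left) (auto simp: degree_monom_eq)
  then obtain y where "poly P y = 0"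
    using alg_closed_imp_poly_has_root[of P] p_pos by auto
  then have y: "y ^ p = y + v" by (simp add: P_def poly_monom algebra_simps)
  define Y where "Y = (\<lambda>i. y + of_nat i) ` {..<p}"
  have "inj_on (\<lambda>i. y + of_nat i) {..<p}"
    by (rule inj_onI) (auto simp: of_nat_eq_iff_cong_CHAR char_p cong_def)
  then have "card Y = p" by (simp add: Y_def card_image)
  moreover have "(y + of_nat i) ^ p = (y + of_nat i) + v" for i
    using frob_add[of y "of_nat i" 1] of_nat_frob[of i 1] y by simp
  ultimately show ?thesis by (intro exI[of _ Y]) (auto simp: Y_def)
qed

text \<open>If \<open>y ^ p = y + f x\<close> then \<open>w = x y\<close> satisfies \<open>Phi (x, w) = 0\<close>; unlike \<open>y\<close>, it has no pole over
  \<open>x = 0\<close>. \<open>mu\<close> is multiplication by \<open>w\<close> modulo \<open>Phi\<close> on polynomials of degree \<open>< p\<close> in \<open>w\<close>.\<close>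

definition FF :: "'k poly" where "FF = monom m (p + 3) + monom n (p - 2)"

definition Phi :: "'k poly poly" where
  "Phi = monom 1 p - monom (monom 1 (p - 1)) 1 - [:FF:]"

definition mu :: "'k poly poly \<Rightarrow> 'k poly poly" where
  "mu h = pCons 0 h - smult (coeff h (p - 1)) Phi"

definition ev :: "'k \<Rightarrow> 'k \<Rightarrow> 'k poly poly \<Rightarrow> 'k" where
  "ev x w h = poly (poly h [:w:]) x"

text \<open>To leading order at infinity the curve reads \<open>w ^ p = m x ^ (p + 3)\<close>, so
  after \<open>x = t ^ p\<close> the leading coefficient of \<open>w\<close> is a
  \<open>p\<close>-th root of \<open>m\<close>.\<close>

definition mu0 :: 'k where "mu0 = (SOME y. y ^ p = m)"

lemma mu0: "mu0 ^ p = m"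
  unfolding mu0_def using nth_root_exists[OF p_pos, of m] by (rule someI_ex)

lemma mu0_nz: "mu0 \<noteq> 0" using mu0 m_nz p_pos by auto

text \<open>Substituting \<open>x = t ^ p\<close> and \<open>w = mu0 t ^ (p + 3)\<close> turns the pole order at infinity into the degree
  in \<open>t\<close>. Since \<open>p\<close> does not divide \<open>3\<close>, the exponents \<open>p i + (p + 3) j\<close> with \<open>j < p\<close> are distinct, so
  no cancellation occurs.\<close>

definition Lam :: "'k poly poly \<Rightarrow> 'k poly" where
  "Lam h = poly (map_poly (\<lambda>g. pcompose g (monom 1 p)) h) (monom mu0 (p + 3))"

lemma Lam_pCons: "Lam (pCons g h) = pcompose g (monom 1 p) + monom mu0 (p + 3) * Lam h"
  by (cases "g = 0 \<and> h = 0") (auto simp: Lam_def map_poly_pCons)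

lemma Lam_0 [simp]: "Lam 0 = 0" by (simp add: Lam_def)

lemma Lam_add: "Lam (g + h) = Lam g + Lam h"
proof -
  have "map_poly (\<lambda>g. pcompose g (monom 1 p)) (g + h) =
    map_poly (\<lambda>g. pcompose g (monom 1 p)) g + map_poly (\<lambda>g. pcompose g (monom 1 p)) h"
    by (intro poly_eqI) (simp add: coeff_map_poly pcompose_add)
  then show ?thesis by (simp add: Lam_def)
qed

lemma Lam_smult: "Lam (smult g h) = pcompose g (monom 1 p) * Lam h"
proof -
  have "map_poly (\<lambda>g. pcompose g (monom 1 p)) (smult g h) =
    smult (pcompose g (monom 1 p)) (map_poly (\<lambda>g. pcompose g (monom 1 p)) h)"
    by (intro poly_eqI) (simp add: coeff_map_poly pcompose_mult)
  then show ?thesis by (simp add: Lam_def)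
qed

lemma Lam_diff: "Lam (g - h) = Lam g - Lam h"
proof -
  have "Lam (g - h) = Lam (g + smult (-1) h)" by simp
  then show ?thesis by (simp only: Lam_add Lam_smult) (simp add: pcompose_uminus)
qed

lemma Lam_sum: "Lam (sum g A) = (\<Sum>a\<in>A. Lam (g a))"
  by (induction A rule: infinite_finite_induct) (auto simp: Lam_add)

lemma Lam_const_smult: "Lam (smult [:a:] h) = smult a (Lam h)"
  by (simp add: Lam_smult)

lemma pcompose_monom_monom: "pcompose (monom a i) (monom 1 j) = monom (a :: 'k) (i * j)"
proof -
  have "pcompose (monom a i) (monom 1 j) = smult a (monom 1 j ^ i)"
    by (induction i) (auto simp: monom_0 monom_Suc pcompose_pCons)
  then show ?thesis by (simp add: monom_power smult_monom mult.commute)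
qed

lemma Lam_monom: "Lam (monom g i) = pcompose g (monom 1 p) * monom (mu0 ^ i) ((p + 3) * i)"
  by (induction i) (auto simp: monom_0 monom_Suc Lam_pCons mult_monom ac_simps)

text \<open>Modulo \<open>p\<close> the exponent \<open>p * i + (p + 3) * j\<close> is
  \<open>3 * j\<close>, which determines \<open>j < p\<close>; hence only the coefficient of
  \<open>h\<close> at \<open>j\<close> can contribute.\<close>

lemma coeff_Lam:
  assumes "degree h < p" "j < p"
  shows "coeff (Lam h) (p * i + (p + 3) * j) = mu0 ^ j * coeff (coeff h j) i"
proof -
  let ?N = "p * i + (p + 3) * j"
  have "h = (\<Sum>j'<p. monom (coeff h j') j')"
    using poly_as_sum_of_monoms'[of h "p - 1"] assms(1)
    by (simp add: lessThan_Suc_atMost[symmetric])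
  then have "Lam h = (\<Sum>j'<p. Lam (monom (coeff h j') j'))" by (metis Lam_sum)
  then have "coeff (Lam h) ?N = (\<Sum>j'<p. coeff (Lam (monom (coeff h j') j')) ?N)"
    by (simp add: coeff_sum)
  also have "\<dots> = (\<Sum>j'\<in>{j}. coeff (Lam (monom (coeff h j') j')) ?N)"
  proof (intro sum.mono_neutral_right ballI)
    fix j' assume j': "j' \<in> {..<p} - {j}"
    show "coeff (Lam (monom (coeff h j') j')) ?N = 0"
    proof (cases "(p + 3) * j' \<le> ?N")
      case True
      have "\<not> p dvd ?N - (p + 3) * j'"
      proof
        assume "p dvd ?N - (p + 3) * j'"
        then have "int p dvd int ?N - int ((p + 3) * j')" 
          using True by (metis of_nat_diff int_dvd_int_iff)
        then have "int p dvd 3 * (int j - int j') + int p * (int i + int j - int j')"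
          by (simp add: algebra_simps)
        then have "int p dvd 3 * (int j - int j')"
          by (metis dvd_add_left_iff dvd_triv_left)
        then have "int p dvd 3 \<or> int p dvd int j - int j'"
          using prime_p prime_dvd_multD[of "int p" 3 "int j - int j'"] by simp
        moreover have "\<not> int p dvd 3" using p_gt_3 by (auto dest: zdvd_imp_le)
        moreover have "\<not> int p dvd int j - int j'"
          using j' assms(2) dvd_imp_le_int[of "int j - int j'" "int p"] by auto
        ultimately show False by simp
      qed
      then show ?thesis using p_pos by (simp add: Lam_monom mult.commute[of _ "monom _ _"] coeff_monom_mult coeff_pcompose_monom)
    next
      case False
      then show ?thesis by (simp add: Lam_monom mult.commute[of _ "monom _ _"] coeff_monom_mult)
    qed
  qed (use assms in auto)
  also have "\<dots> = mu0 ^ j * coeff (coeff h j) i"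
    using p_pos by (simp add: Lam_monom mult.commute[of _ "monom _ _"] coeff_monom_mult coeff_pcompose_monom)
  finally show ?thesis .
qed

lemma degree_coeff_le_Lam:
  assumes "degree h < p" "j < p" "coeff h j \<noteq> 0"
  shows "p * degree (coeff h j) + (p + 3) * j \<le> degree (Lam h)"
  by (rule le_degree) (use assms coeff_Lam[OF assms(1,2)] mu0_nz in auto)

lemma Lam_nz:
  assumes "degree h < p" "h \<noteq> 0" shows "Lam h \<noteq> 0"
proof
  assume "Lam h = 0"
  then have "coeff (coeff h (degree h)) (degree (coeff h (degree h))) = 0"
    using coeff_Lam[of h "degree h" "degree (coeff h (degree h))"] assms mu0_nz by auto
  then show False using assms by simp
qed

lemma degree_mu: assumes "degree h < p" shows "degree (mu h) < p"
proof -
  have "coeff (mu h) i = 0" if "i \<ge> p" for i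
  proof (cases "i = p")
    case True
    have "coeff Phi p = 1" using p_gt_3 by (simp add: Phi_def coeff_pCons split: nat.splits)
    then show ?thesis using True p_pos by (simp add: mu_def coeff_pCons split: nat.splits)
  next
    case False
    then have "coeff Phi i = 0" using that p_gt_3 by (simp add: Phi_def coeff_pCons split: nat.splits)
    moreover have "coeff h (i - 1) = 0" using assms that False by (intro coeff_eq_0) auto
    ultimately show ?thesis using that False p_pos by (cases i) (auto simp: mu_def coeff_pCons)
  qed
  then have "degree (mu h) \<le> p - 1" by (intro degree_le) auto
  then show ?thesis using p_pos by auto
qed

text \<open>Because \<open>mu0 ^ p = m\<close>, the two terms of degree \<open>p * (p + 3)\<close>
  cancel. The drop to degree \<open>p * p + 3\<close> is what makes reduction modulo
  \<open>Phi\<close> harmless for the weights.\<close>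

lemma Lam_Phi: "Lam Phi = - monom mu0 (p * p + 3) - monom n (p * (p - 2))"
proof -
  have "Lam Phi = monom m ((p + 3) * p) - monom mu0 ((p - 1) * p + (p + 3)) - 
     (monom m ((p + 3) * p) + monom n ((p - 2) * p))"
    using Lam_monom[of 1 p] Lam_monom[of "monom 1 (p - 1)" 1]
    by (simp add: Phi_def Lam_diff Lam_pCons FF_def pcompose_add pcompose_monom_monom mu0 mult_monom)
  also have "(p - 1) * p + (p + 3) = p * p + 3" using p_pos by (cases p) auto
  finally show ?thesis by (simp add: mult.commute)
qed

lemma degree_pcompose_monom: "degree (pcompose g (monom (1::'k) d)) = d * degree g"
  by (simp add: degree_pcompose degree_monom_eq)

text \<open>Multiplication by \<open>w\<close> raises the pole order at infinity by exactly that of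
  \<open>w\<close>. A correction by \<open>Phi\<close> occurs only if the coefficient of
  \<open>h\<close> at \<open>p - 1\<close> is nonzero, and then \<open>Lam h\<close> already has a
  degree large enough to dominate it.\<close>

lemma degree_Lam_mu:
  assumes "degree h < p" "h \<noteq> 0"
  shows "degree (Lam (mu h)) = degree (Lam h) + (p + 3)"
proof -
  let ?g = "coeff h (p - 1)"
  have nz: "Lam h \<noteq> 0" using Lam_nz assms by auto
  have e: "Lam (mu h) = monom mu0 (p + 3) * Lam h - pcompose ?g (monom 1 p) * Lam Phi"
    by (simp add: mu_def Lam_diff Lam_pCons Lam_smult)
  have d1: "degree (monom mu0 (p + 3) * Lam h) = degree (Lam h) + (p + 3)"
    using nz mu0_nz by (subst degree_mult_eq) (auto simp: degree_monom_eq)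
  have d2: "degree (pcompose ?g (monom 1 p) * Lam Phi) < degree (Lam h) + (p + 3)"
  proof (cases "?g = 0")
    case False
    have "degree (monom n (p * (p - 2))) \<le> p * p + 3"
      using degree_monom_le[of n "p * (p - 2)"] mult_le_mono2[of "p - 2" p p] by linarith
    then have "degree (Lam Phi) \<le> p * p + 3"
      unfolding Lam_Phi by (intro degree_diff_le) (simp_all add: degree_monom_le)
    then have "degree (pcompose ?g (monom 1 p) * Lam Phi) \<le> p * degree ?g + (p * p + 3)"
      using degree_mult_le[of "pcompose ?g (monom 1 p)" "Lam Phi"] by (simp add: degree_pcompose degree_monom_eq mult.commute)
    moreover have "p * degree ?g + (p + 3) * (p - 1) \<le> degree (Lam h)"
      using degree_coeff_le_Lam[of h "p - 1"] assms False p_pos by simp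
    moreover have "p * p + 3 < (p + 3) * (p - 1) + (p + 3)" using p_gt_3 by (cases p) (auto simp: algebra_simps)
    ultimately show ?thesis by linarith
  qed (use p_gt_3 in auto)
  show ?thesis unfolding e using d1 d2 by (simp add: degree_diff_eq_left)
qed

lemma mu_nz: "degree h < p \<Longrightarrow> h \<noteq> 0 \<Longrightarrow> mu h \<noteq> 0"
  using degree_Lam_mu[of h] by auto

lemma degree_smult_lt: "degree h < p \<Longrightarrow> degree (smult (g :: 'k poly) h) < p"
  using degree_smult_le[of g h] by linarith

lemma degree_add_lt: "degree (g :: 'k poly poly) < p \<Longrightarrow> degree h < p \<Longrightarrow> degree (g + h) < p"
  using degree_add_le_max[of g h] by linarith

lemma Lam_mu_le: "degree h < p \<Longrightarrow> degree (Lam (mu h)) \<le> degree (Lam h) + (p + 3)"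
  using degree_Lam_mu[of h] by (cases "h = 0") (auto simp: mu_def)

section \<open>Evaluation at points, and Frobenius powers of \<open>w\<close>\<close>

lemma ev_add: "ev x w (g + h) = ev x w g + ev x w h" by (simp add: ev_def)
lemma ev_diff: "ev x w (g - h) = ev x w g - ev x w h" by (simp add: ev_def)
lemma ev_smult: "ev x w (smult g h) = poly g x * ev x w h" by (simp add: ev_def)
lemma ev_1: "ev x w 1 = 1" by (simp add: ev_def)
lemma ev_sum: "ev x w (sum g A) = (\<Sum>a\<in>A. ev x w (g a))"
  by (simp add: ev_def poly_sum)

lemma ev_Phi: "ev x w Phi = w ^ p - x ^ (p - 1) * w - poly FF x"
  by (simp add: ev_def Phi_def poly_monom)

lemma ev_mu: "ev x w Phi = 0 \<Longrightarrow> ev x w (mu h) = w * ev x w h"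
  by (simp add: mu_def ev_diff ev_smult) (simp add: ev_def)

text \<open>The conjugate of \<open>f\<close> with index \<open>i < r\<close> has a pole at 0 of
  order at most \<open>2 * p ^ i \<le> p ^ r\<close>; multiplying the trace by
  \<open>x ^ (p ^ r)\<close> therefore makes it a polynomial.\<close>

definition U :: "nat \<Rightarrow> 'k poly" where
  "U r = (\<Sum>i<r. monom m (p ^ r + 3 * p ^ i) + monom n (p ^ r - 2 * p ^ i))"

lemma two_pow_le: "i < r \<Longrightarrow> 2 * p ^ i \<le> p ^ r"
proof -
  assume "i < r"
  then have "p ^ Suc i \<le> p ^ r" using p_pos by (intro power_increasing) auto
  moreover have "2 * p ^ i \<le> p ^ Suc i" using p_gt_3 by simp
  ultimately show ?thesis by linarith
qed

lemma poly_U: assumes "x \<noteq> 0" shows "poly (U r) x = x ^ (p ^ r) * tr r (f x)"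
proof -
  have "poly (monom m (p ^ r + 3 * p ^ i) + monom n (p ^ r - 2 * p ^ i)) x = x ^ (p ^ r) * f x ^ (p ^ i)"
    if "i < r" for i
  proof -
    have "f x ^ (p ^ i) = m * x ^ (3 * p ^ i) + n * inverse x ^ (2 * p ^ i)"
      by (simp add: f_def frob_add power_mult_distrib frob_fixed_power m_frob n_frob power_mult)
    moreover have "x ^ (p ^ r - 2 * p ^ i) = x ^ (p ^ r) * inverse x ^ (2 * p ^ i)"
      using two_pow_le[OF that] assms by (simp add: power_diff divide_inverse power_inverse)
    ultimately show ?thesis by (simp add: poly_monom power_add algebra_simps)
  qed
  then show ?thesis by (simp add: U_def poly_sum tr_def sum_distrib_left)
qed

lemma degree_U: "degree (U (Suc r)) = p ^ Suc r + 3 * p ^ r"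
proof -
  let ?A = "\<Sum>i<r. monom m (p ^ Suc r + 3 * p ^ i)"
  let ?B = "\<Sum>i<Suc r. monom n (p ^ Suc r - 2 * p ^ i)"
  have "U (Suc r) = monom m (p ^ Suc r + 3 * p ^ r) + (?A + ?B)"
    unfolding U_def by (simp add: sum.distrib algebra_simps)
  moreover have "degree ?A < p ^ Suc r + 3 * p ^ r"
  proof (rule degree_sum_less)
    fix i assume "i \<in> {..<r}"
    then have "p ^ i < p ^ r" using p_gt_3 by (intro power_strict_increasing) auto
    then show "degree (monom m (p ^ Suc r + 3 * p ^ i)) < p ^ Suc r + 3 * p ^ r"
      by (intro le_less_trans[OF degree_monom_le]) auto
  qed (use p_pos in auto)
  moreover have "degree ?B < p ^ Suc r + 3 * p ^ r"
  proof (rule degree_sum_less)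
    fix i
    have "degree (monom n (p ^ Suc r - 2 * p ^ i)) \<le> p ^ Suc r - 2 * p ^ i" by (rule degree_monom_le)
    moreover have "p ^ r > 0" using p_pos by simp
    ultimately show "degree (monom n (p ^ Suc r - 2 * p ^ i)) < p ^ Suc r + 3 * p ^ r" by linarith
  qed (use p_pos in auto)
  ultimately show ?thesis
    using m_nz by (simp add: degree_add_eq_left degree_monom_eq degree_add_less)
qed

text \<open>On the curve \<open>om r\<close> is multiplication by \<open>w ^ (p ^ r)\<close>, and \<open>muc c\<close> is multiplication by \<open>w + c x\<close>,
  the value of \<open>w ^ (p ^ (2 r))\<close> at points with \<open>x ^ (p ^ (2 r)) = x\<close> and trace \<open>c\<close>.\<close>

definition om :: "nat \<Rightarrow> 'k poly poly \<Rightarrow> 'k poly poly" where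
  "om r h = smult (monom 1 (p ^ r - 1)) (mu h) + smult (U r) h"

definition muc :: "'k \<Rightarrow> 'k poly poly \<Rightarrow> 'k poly poly" where
  "muc c h = mu h + smult (monom c 1) h"

lemma degree_om: "degree h < p \<Longrightarrow> degree (om r h) < p"
  unfolding om_def by (intro degree_add_lt degree_smult_lt degree_mu)

lemma degree_muc: "degree h < p \<Longrightarrow> degree (muc c h) < p"
  unfolding muc_def by (intro degree_add_lt degree_smult_lt degree_mu)

lemma degree_Lam_muc:
  assumes "degree h < p"
  shows "degree (Lam (muc c h)) \<le> degree (Lam h) + (p + 3)"
proof -
  have "degree (monom c p * Lam h) \<le> degree (Lam h) + (p + 3)"
    using degree_mult_le[of "monom c p" "Lam h"] degree_monom_le[of c p] by linarith
  then show ?thesis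
    using Lam_mu_le[OF assms]
    by (auto simp: muc_def Lam_add Lam_smult pcompose_monom_monom intro!: degree_add_le)
qed

text \<open>The summand with \<open>U r\<close> dominates: after the substitution its factor has
  degree \<open>p * (p ^ r + 3 * p ^ (r - 1)) = (p + 3) * p ^ r\<close>, which is
  \<open>p ^ r\<close> times the pole order of \<open>w\<close>, while the other summand adds only
  \<open>p * p ^ r + 3\<close>.\<close>

lemma degree_Lam_om:
  assumes "degree h < p" "h \<noteq> 0" "r > 0"
  shows "degree (Lam (om r h)) = degree (Lam h) + (p + 3) * p ^ r"
proof -
  obtain r' where r': "r = Suc r'" using assms(3) by (cases r) auto
  have s: "p ^ r > 1" using assms(3) p_gt_3 by (intro one_less_power) auto
  have nz: "Lam h \<noteq> 0" "Lam (mu h) \<noteq> 0" using Lam_nz mu_nz degree_mu assms by blast+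
  have "U r \<noteq> 0" using degree_U[of r'] p_pos r' by auto
  then have U0: "pcompose (U r) (monom 1 p) \<noteq> 0"
    using p_pos by (auto simp: pcompose_eq_0_iff degree_monom_eq)
  have e: "Lam (om r h) = pcompose (U r) (monom 1 p) * Lam h + monom 1 (p * (p ^ r - 1)) * Lam (mu h)"
    by (simp add: om_def Lam_add Lam_smult pcompose_monom_monom mult.commute add.commute)
  have d1: "degree (pcompose (U r) (monom 1 p) * Lam h) = degree (Lam h) + (p + 3) * p ^ r"
    using nz U0 by (subst degree_mult_eq) (auto simp: degree_pcompose_monom degree_U degree_monom_eq r' algebra_simps)
  have d2: "degree (monom 1 (p * (p ^ r - 1)) * Lam (mu h)) = p * (p ^ r - 1) + (degree (Lam h) + (p + 3))"
    using nz by (subst degree_mult_eq) (auto simp: degree_monom_eq degree_Lam_mu assms)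
  have "p * (p ^ r - 1) + p = p * p ^ r" using s by (cases "p ^ r") auto
  moreover have "3 < 3 * p ^ r" using s by simp
  moreover have "(p + 3) * p ^ r = p * p ^ r + 3 * p ^ r" by (rule add_mult_distrib)
  ultimately have "degree (monom 1 (p * (p ^ r - 1)) * Lam (mu h)) < degree (Lam h) + (p + 3) * p ^ r"
    unfolding d2 by linarith
  then show ?thesis unfolding e by (subst degree_add_eq_left) (use d1 in auto)
qed

lemma om_nz: "degree h < p \<Longrightarrow> h \<noteq> 0 \<Longrightarrow> r > 0 \<Longrightarrow> om r h \<noteq> 0"
  using degree_Lam_om[of h r] p_pos by auto

lemma ev_om: "ev x w Phi = 0 \<Longrightarrow> ev x w (om r h) = (x ^ (p ^ r - 1) * w + poly (U r) x) * ev x w h"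
  by (simp add: om_def ev_add ev_smult ev_mu poly_monom algebra_simps)

lemma ev_muc: "ev x w Phi = 0 \<Longrightarrow> ev x w (muc c h) = (w + c * x) * ev x w h"
  by (simp add: muc_def ev_add ev_smult ev_mu poly_monom algebra_simps)

lemma mu_funpow:
  assumes "degree h < p" "h \<noteq> 0"
  shows "degree ((mu ^^ j) h) < p \<and> (mu ^^ j) h \<noteq> 0 \<and> degree (Lam ((mu ^^ j) h)) = degree (Lam h) + (p + 3) * j"
  by (induction j) (use assms in \<open>auto simp: degree_mu mu_nz degree_Lam_mu\<close>)

lemma om_funpow:
  assumes "degree h < p" "h \<noteq> 0" "r > 0"
  shows "degree ((om r ^^ j) h) < p \<and> (om r ^^ j) h \<noteq> 0 \<and>
    degree (Lam ((om r ^^ j) h)) = degree (Lam h) + (p + 3) * p ^ r * j"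
  by (induction j) (use assms in \<open>auto simp: degree_om om_nz degree_Lam_om\<close>)

lemma muc_funpow:
  assumes "degree h < p"
  shows "degree ((muc c ^^ j) h) < p \<and> degree (Lam ((muc c ^^ j) h)) \<le> degree (Lam h) + (p + 3) * j"
proof (induction j)
  case (Suc j)
  then show ?case using degree_Lam_muc[of "(muc c ^^ j) h" c] degree_muc[of "(muc c ^^ j) h" c] by auto
qed (use assms in auto)

lemma om_funpow_le:
  assumes "degree h < p" "r > 0"
  shows "degree ((om r ^^ j) h) < p \<and>
    degree (Lam ((om r ^^ j) h)) \<le> degree (Lam h) + (p + 3) * p ^ r * j"
proof (cases "h = 0")
  case True
  have "(om r ^^ j) 0 = 0" by (induction j) (auto simp: om_def mu_def)
  then show ?thesis using True p_pos by simp
next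
  case False then show ?thesis using om_funpow assms by force
qed

lemma ev_mu_funpow: "ev x w Phi = 0 \<Longrightarrow> ev x w ((mu ^^ j) h) = w ^ j * ev x w h"
  by (induction j) (auto simp: ev_mu)

lemma ev_om_funpow: "ev x w Phi = 0 \<Longrightarrow>
    ev x w ((om r ^^ j) h) = (x ^ (p ^ r - 1) * w + poly (U r) x) ^ j * ev x w h"
  by (induction j) (auto simp: ev_om)

lemma ev_muc_funpow: "ev x w Phi = 0 \<Longrightarrow> ev x w ((muc c ^^ j) h) = (w + c * x) ^ j * ev x w h"
  by (induction j) (auto simp: ev_muc)

text \<open>With \<open>s = p ^ r\<close>, \<open>Gm\<close> represents \<open>x ^ i w ^ j (x ^ s) ^ k (w ^ s) ^ l\<close>. At the points counted by
  the Stepanov bound its \<open>s\<close>-th power takes the value of \<open>Hm\<close>, which has far smaller degree. A linear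
  relation between the \<open>Hm\<close> therefore gives a nonzero combination of the \<open>Gm\<close> vanishing at all points.\<close>

definition Gm :: "nat \<Rightarrow> nat \<Rightarrow> nat \<Rightarrow> nat \<Rightarrow> nat \<Rightarrow> 'k poly poly" where
  "Gm r i j k l = smult (monom 1 (i + p ^ r * k)) ((mu ^^ j) ((om r ^^ l) 1))"

definition Hm :: "'k \<Rightarrow> nat \<Rightarrow> nat \<Rightarrow> nat \<Rightarrow> nat \<Rightarrow> nat \<Rightarrow> 'k poly poly" where
  "Hm c r i j k l = smult (monom 1 (p ^ r * i + k)) ((om r ^^ j) ((muc c ^^ l) 1))"

lemma Lam_1: "Lam 1 = 1"
  using Lam_pCons[of 1 0] by (simp flip: one_pCons)

lemma Gm:
  assumes "r > 0"
  shows "degree (Gm r i j k l) < p" "Lam (Gm r i j k l) \<noteq> 0"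
    "degree (Lam (Gm r i j k l)) = (p * i + (p + 3) * j) + p ^ r * (p * k + (p + 3) * l)"
proof -
  have 1: "degree ((om r ^^ l) 1) < p" "(om r ^^ l) 1 \<noteq> 0" 
    "degree (Lam ((om r ^^ l) 1)) = (p + 3) * p ^ r * l"
    using om_funpow[of 1 r l] assms p_pos by (auto simp: Lam_1)
  note 2 = mu_funpow[OF 1(1,2), of j]
  show "degree (Gm r i j k l) < p" using 2 by (auto simp: Gm_def intro!: degree_smult_lt)
  have e: "Lam (Gm r i j k l) = monom 1 ((i + p ^ r * k) * p) * Lam ((mu ^^ j) ((om r ^^ l) 1))"
    by (simp add: Gm_def Lam_smult pcompose_monom_monom)
  have 3: "Lam ((mu ^^ j) ((om r ^^ l) 1)) \<noteq> 0" using 2 Lam_nz by auto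
  then show "Lam (Gm r i j k l) \<noteq> 0" by (simp add: e)
  show "degree (Lam (Gm r i j k l)) = (p * i + (p + 3) * j) + p ^ r * (p * k + (p + 3) * l)"
    unfolding e using 1 2 3 by (subst degree_mult_eq) (auto simp: degree_monom_eq algebra_simps)
qed

lemma ev_Gm: "ev x w Phi = 0 \<Longrightarrow> ev x w (Gm r i j k l) =
   x ^ i * w ^ j * (x ^ (p ^ r)) ^ k * (x ^ (p ^ r - 1) * w + poly (U r) x) ^ l"
  by (simp add: Gm_def ev_smult ev_mu_funpow ev_om_funpow ev_1 poly_monom power_add power_mult)

lemma Hm:
  assumes "r > 0"
  shows "degree (Hm c r i j k l) < p"
    "degree (Lam (Hm c r i j k l)) \<le> p * (p ^ r * i + k) + (p + 3) * (p ^ r * j + l)"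
proof -
  have 1: "degree ((muc c ^^ l) 1) < p" 
    "degree (Lam ((muc c ^^ l) 1)) \<le> (p + 3) * l"
    using muc_funpow[of 1 l c] p_pos by (auto simp: Lam_1)
  note 2 = om_funpow_le[OF 1(1) assms, of j]
  show "degree (Hm c r i j k l) < p" using 2 by (auto simp: Hm_def intro!: degree_smult_lt)
  have e: "Lam (Hm c r i j k l) = monom 1 ((p ^ r * i + k) * p) * Lam ((om r ^^ j) ((muc c ^^ l) 1))"
    by (simp add: Hm_def Lam_smult pcompose_monom_monom)
  have "degree (Lam (Hm c r i j k l)) \<le> (p ^ r * i + k) * p + ((p + 3) * p ^ r * j + (p + 3) * l)"
    unfolding e using 1 2 by (intro order.trans[OF degree_mult_le] add_mono degree_monom_le) auto
  then show "degree (Lam (Hm c r i j k l)) \<le> p * (p ^ r * i + k) + (p + 3) * (p ^ r * j + l)"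
    by (simp add: algebra_simps)
qed

lemma ev_Hm: "ev x w Phi = 0 \<Longrightarrow> ev x w (Hm c r i j k l) =
   (x ^ (p ^ r)) ^ i * x ^ k * (x ^ (p ^ r - 1) * w + poly (U r) x) ^ j * (w + c * x) ^ l"
  by (simp add: Hm_def ev_smult ev_muc_funpow ev_om_funpow ev_1 poly_monom power_add power_mult)

text \<open>The constant of the Stepanov bound; only its independence of \<open>r\<close> matters.\<close>

definition C0 :: nat where "C0 = 4 * (p\<^sup>2 + 3 * p + 1) + 1"

lemma nat_pow4: "(r :: nat) \<ge> 4 \<Longrightarrow> \<exists>u. r = u + 4" by (rule exI[of _ "r - 4"]) simp

text \<open>This keeps the weights \<open>p * i + (p + 3) * j\<close> with
  \<open>i < p ^ (r - 2)\<close> and \<open>j < p\<close> below \<open>p ^ r\<close>, so that they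
  can serve as the lowest digit in base \<open>p ^ r\<close>.\<close>

lemma p_pow_ge: "r \<ge> 4 \<Longrightarrow> p * p ^ (r - 2) + p\<^sup>2 + 3 * p < p ^ r"
proof -
  assume "r \<ge> 4"
  then obtain u where u: "r = u + 4" using nat_pow4 by auto
  define t where "t = p ^ u"
  have t: "t \<ge> 1" using p_pos by (simp add: t_def)
  have e: "p ^ (r - 2) = t * p\<^sup>2" "p ^ r = t * p ^ 4"
    unfolding t_def u power_add[symmetric] by simp_all
  have "p\<^sup>2 + 3 * p \<le> t * (p\<^sup>2 + 3 * p)" using t by simp
  moreover have "p * p\<^sup>2 + (p\<^sup>2 + 3 * p) < p ^ 4"
  proof -
    have "p * p\<^sup>2 + (p\<^sup>2 + 3 * p) < p * p\<^sup>2 + (p\<^sup>2 + p\<^sup>2)" using p_gt_3 by (simp add: power2_eq_square)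
    also have "\<dots> \<le> p * p\<^sup>2 + p * p\<^sup>2" using p_gt_3 mult_le_mono1[of 2 p "p\<^sup>2"] by linarith
    also have "\<dots> \<le> p * (p * p\<^sup>2)" using p_gt_3 mult_le_mono1[of 2 p "p * p\<^sup>2"] by linarith
    finally show ?thesis by (simp add: power4_eq_xxxx power2_eq_square)
  qed
  then have "t * (p * p\<^sup>2 + (p\<^sup>2 + 3 * p)) < t * p ^ 4" using t by simp
  ultimately show ?thesis unfolding e by (simp add: algebra_simps)
qed

text \<open>The left side counts the coefficients available to the \<open>Hm\<close>, the right side
  the index quadruples. Their leading terms \<open>s * p ^ (r - 1)\<close> agree; the surplus
  \<open>s * C0\<close> on the right has to exceed everything else, which is how \<open>C0\<close>
  was chosen.\<close>

lemma stepanov_count: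
  assumes "r \<ge> 4"
  defines "s \<equiv> p ^ r"
  shows "p * (s * p ^ (r - 2) + (p ^ (r - 1) + C0)) + (p + 3) * (s * p + p) + 1
    < p ^ (r - 2) * p * (p ^ (r - 1) + C0) * p"
proof -
  obtain u where u: "r = u + 4" using nat_pow4 assms by auto
  define t where "t = p ^ (u + 2)"
  have t: "t \<ge> p\<^sup>2" unfolding t_def using p_pos by (intro power_increasing) auto
  have e: "p ^ (r - 2) = t" "p ^ (r - 1) = t * p" "s = t * p\<^sup>2"
  proof -
    have *: "r - 2 = u + 2" "r - 1 = Suc (u + 2)" "r = Suc (Suc (u + 2))" by (simp_all add: u)
    show "p ^ (r - 2) = t" by (simp only: t_def *(1))
    show "p ^ (r - 1) = t * p" by (simp only: t_def *(2) power_Suc2)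
    show "s = t * p\<^sup>2" by (simp only: s_def t_def *(3) power_Suc2 power2_eq_square mult.assoc)
  qed
  define P where "P = p\<^sup>2 + 3 * p + 1"
  have "2 * p \<le> p\<^sup>2" using p_gt_3 by (simp add: power2_eq_square)
  also have "\<dots> \<le> t" by (rule t)
  also have "\<dots> \<le> s" using p_pos by (simp add: e)
  finally have sp: "2 * p \<le> s" .
  have "s + p * C0 + (p + 3) * (s * p + p) + 1 < s * C0"
  proof -
    have "s \<ge> 1" using sp p_pos by linarith
    have "2 * (p * C0) \<le> s * C0" using mult_le_mono1[OF sp, of C0] by (simp add: mult_ac)
    moreover have "2 * (s + (p + 3) * (s * p + p) + 1) = 2 * P * (s + 1)"
      by (simp add: P_def algebra_simps power2_eq_square)
    moreover have "2 * P * (s + 1) \<le> 4 * P * s" using \<open>s \<ge> 1\<close> by (simp add: algebra_simps)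
    moreover have "4 * P * s < s * C0" using \<open>s \<ge> 1\<close> by (simp add: C0_def P_def)
    moreover have "2 * a \<le> b \<Longrightarrow> 2 * (s + d + 1) = e \<Longrightarrow> e \<le> g \<Longrightarrow> g < b \<Longrightarrow> s + a + d + 1 < b"
      for a b d e g :: nat by presburger
    ultimately show ?thesis by blast
  qed
  then show ?thesis unfolding e by (simp add: algebra_simps power2_eq_square)
qed


text \<open>The points are counted through their \<open>x\<close>-coordinates: if a reduced polynomial in \<open>w\<close> of degree
  \<open>< p\<close> vanishes at all \<open>p\<close> points over some \<open>x\<close>, then all its coefficients vanish at \<open>x\<close>.\<close>

lemma ev_as_poly: "ev x w h = poly (map_poly (\<lambda>g. poly g x) h) w"
proof (induction h)
  case (pCons g h)
  then show ?case 
    by (cases "g = 0 \<and> h = 0") (auto simp: ev_def map_poly_pCons)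
qed (auto simp: ev_def)

lemma FF_eq: "x \<noteq> 0 \<Longrightarrow> poly FF x = x ^ p * f x"
proof -
  assume "x \<noteq> 0"
  then have "x ^ (p - 2) = x ^ p * inverse x ^ 2"
    using p_gt_3 by (simp add: power_diff divide_inverse power_inverse)
  then show ?thesis by (simp add: FF_def f_def poly_monom power_add algebra_simps)
qed

text \<open>Over the field with \<open>p ^ (2 * r)\<close> elements, the \<open>p ^ r\<close>-power
  map applied twice fixes \<open>x\<close> and adds the trace \<open>c\<close> to \<open>y\<close>,
  hence \<open>c * x\<close> to \<open>w = x * y\<close>. So the \<open>p ^ r\<close>-th powers of
  \<open>x ^ (p ^ r)\<close> and \<open>w ^ (p ^ r)\<close> collapse to expressions of low
  degree.\<close>

lemma ev_point:
  assumes x: "x \<noteq> 0" "x ^ (p ^ (2 * r)) = x" and y: "y ^ p = y + f x" and c: "tr (2 * r) (f x) = c"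
  shows "ev x (x * y) Phi = 0" "x ^ (p ^ r - 1) * (x * y) + poly (U r) x = (x * y) ^ (p ^ r)"
    "(x ^ (p ^ r)) ^ (p ^ r) = x" "((x * y) ^ (p ^ r)) ^ (p ^ r) = x * y + c * x"
proof -
  have "x ^ p = x ^ (p - 1) * x" using p_pos by (simp flip: power_Suc2)
  then show "ev x (x * y) Phi = 0"
    using FF_eq[OF x(1)] y by (simp add: ev_Phi power_mult_distrib algebra_simps)
  have s: "x ^ (p ^ r) = x ^ (p ^ r - 1) * x" using p_pos by (simp flip: power_Suc2)
  have "(x * y) ^ (p ^ r) = x ^ (p ^ r) * (y + tr r (f x))"
    by (simp add: power_mult_distrib artin_schreier_power[OF y])
  then show "x ^ (p ^ r - 1) * (x * y) + poly (U r) x = (x * y) ^ (p ^ r)"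
    using poly_U[OF x(1)] s by (simp add: algebra_simps)
  have q: "(z ^ (p ^ r)) ^ (p ^ r) = z ^ (p ^ (2 * r))" for z :: 'k
    by (simp add: power_add mult_2 flip: power_mult)
  show "(x ^ (p ^ r)) ^ (p ^ r) = x" by (simp only: q x(2))
  show "((x * y) ^ (p ^ r)) ^ (p ^ r) = x * y + c * x"
    unfolding q by (simp only: power_mult_distrib x(2) artin_schreier_power[OF y] c) (simp add: algebra_simps)
qed

text \<open>Reduction modulo \<open>s\<close> separates the two weights like digits, and within each
  weight the residue \<open>3 * j\<close> modulo \<open>p\<close> determines
  \<open>j < p\<close>.\<close>

lemma weight_inj:
  assumes "p * i + (p + 3) * j < s" "p * i' + (p + 3) * j' < s" "j < p" "j' < p" "l < p" "l' < p"
    and eq: "(p * i + (p + 3) * j) + s * (p * k + (p + 3) * l) = (p * i' + (p + 3) * j') + s * (p * k' + (p + 3) * l')"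
  shows "i = i' \<and> j = j' \<and> k = k' \<and> l = l'"
proof -
  have aux: "i = i' \<and> j = j'" if e: "p * i + (p + 3) * j = p * i' + (p + 3) * j'" and "j < p" "j' < p" for i i' j j'
  proof -
    have "int p * int i + (int p + 3) * int j = int p * int i' + (int p + 3) * int j'"
      using arg_cong[OF e, of int] by simp
    then have "3 * (int j - int j') = int p * (int i' + int j' - int i - int j)" by (simp add: algebra_simps)
    then have "int p dvd 3 * (int j - int j')" by simp
    then have "int p dvd 3 \<or> int p dvd int j - int j'"
      using prime_p prime_dvd_multD[of "int p" 3 "int j - int j'"] by simp
    moreover have "\<not> int p dvd 3" using p_gt_3 by (auto dest: zdvd_imp_le)
    ultimately have "int p dvd int j - int j'" by simp
    then have "j = j'" using that(2,3) dvd_imp_le_int[of "int j - int j'" "int p"] by linarith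
    then show ?thesis using e p_pos by simp
  qed
  have "((p * i + (p + 3) * j) + s * (p * k + (p + 3) * l)) mod s = p * i + (p + 3) * j"
    using assms(1) by (simp only: mod_mult_self2 mod_less)
  moreover have "((p * i' + (p + 3) * j') + s * (p * k' + (p + 3) * l')) mod s = p * i' + (p + 3) * j'"
    using assms(2) by (simp only: mod_mult_self2 mod_less)
  ultimately have 1: "p * i + (p + 3) * j = p * i' + (p + 3) * j'" using eq by metis
  then have "s * (p * k + (p + 3) * l) = s * (p * k' + (p + 3) * l')" using eq by linarith
  then have 2: "p * k + (p + 3) * l = p * k' + (p + 3) * l'" using assms(1) by simp
  show ?thesis using aux[OF 1 assms(3,4)] aux[OF 2 assms(5,6)] by simp
qed

text \<open>The term \<open>p ^ (2 * r - 1)\<close> is the expected share of one of the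
  \<open>p\<close> trace values; the excess is a constant times the square root of the size of the
  field. The count is at most the degree of one coefficient of the auxiliary function, and that
  degree is governed by \<open>s * k0\<close>.\<close>

lemma stepanov:
  assumes r: "r \<ge> 4"
  shows "card {x. x \<noteq> 0 \<and> x ^ (p ^ (2 * r)) = x \<and> tr (2 * r) (f x) = c}
    \<le> p ^ (2 * r - 1) + (C0 + 2 * p + 7) * p ^ r"
proof -
  define s where "s = p ^ r"
  \<comment> \<open>\<open>i0\<close> is small enough for the low weights to stay below
    \<open>s\<close>; \<open>k0\<close> is \<open>s / p\<close> plus the surplus that makes the
    family larger than the space containing the images of the \<open>Hm\<close> under
    \<open>Lam\<close>.\<close>
  define i0 where "i0 = p ^ (r - 2)"
  define k0 where "k0 = p ^ (r - 1) + C0"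
  define I where "I = {..<i0} \<times> {..<p} \<times> {..<k0} \<times> {..<p}"
  define H where "H = (\<lambda>(i, j, k, l). Hm c r i j k l)"
  define G where "G = (\<lambda>(i, j, k, l). Gm r i j k l)"
  define N where "N = p * (s * i0 + k0) + (p + 3) * (s * p + p) + 1"
  have r0: "r > 0" using r by simp
  have s0: "s > 0" using p_pos by (simp add: s_def)
  have fin: "finite I" by (simp add: I_def)
  have "card I > N"
    using stepanov_count[OF r] by (simp add: I_def N_def s_def i0_def k0_def card_cartesian_product mult_ac)
  moreover have "coeff (Lam (H t)) k' = 0" if t: "t \<in> I" and k': "k' \<ge> N" for t k'
  proof -
    obtain i j k l where [simp]: "t = (i, j, k, l)" by (cases t)
    have "i \<le> i0" "j \<le> p" "k \<le> k0" "l \<le> p" using t by (auto simp: I_def)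
    then have "p * (s * i + k) + (p + 3) * (s * j + l) \<le> p * (s * i0 + k0) + (p + 3) * (s * p + p)"
      by (intro add_mono mult_le_mono order.refl)
    then have "degree (Lam (H t)) < N"
      using Hm(2)[OF r0, of c i j k l] by (simp add: H_def N_def s_def)
    then show ?thesis using k' by (intro coeff_eq_0) simp
  qed
  ultimately obtain b where b: "\<exists>t\<in>I. b t \<noteq> 0" "(\<Sum>t\<in>I. smult (b t) (Lam (H t))) = 0"
    using linear_dependence_poly[OF fin, of N "\<lambda>t. Lam (H t)"] by blast
  \<comment> \<open>The relation holds among the \<open>Hm\<close>, but their values are taken by
    \<open>s\<close>-th powers of the \<open>Gm\<close>. Since the \<open>s\<close>-power map is
    additive, the coefficients of the auxiliary function must be \<open>s\<close>-th roots of the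
    \<open>b t\<close>.\<close>
  define a where "a t = (SOME y. y ^ s = b t)" for t
  have a: "a t ^ s = b t" for t
    unfolding a_def using nth_root_exists[OF s0, of "b t"] by (rule someI_ex)
  define HH where "HH = (\<Sum>t\<in>I. smult [:b t:] (H t))"
  define GG where "GG = (\<Sum>t\<in>I. smult [:a t:] (G t))"
  have "degree (H t) < p" "degree (G t) < p" for t
    using Hm(1)[OF r0] Gm(1)[OF r0] by (auto simp: H_def G_def split: prod.splits)
  then have deg: "degree HH < p" "degree GG < p"
    unfolding HH_def GG_def using p_pos by (auto intro!: degree_sum_less degree_smult_lt)
  \<comment> \<open>On reduced polynomials \<open>Lam\<close> is injective, so a relation between
    the images is a relation between the \<open>Hm\<close> themselves.\<close>
  have "Lam HH = 0" using b(2) by (simp add: HH_def Lam_sum Lam_const_smult)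
  then have HH: "HH = 0" using Lam_nz deg by blast
  have LGG: "Lam GG = (\<Sum>t\<in>I. smult (a t) (Lam (G t)))"
    by (simp add: GG_def Lam_sum Lam_const_smult)
  have degG: "degree (Lam (G (i, j, k, l))) = (p * i + (p + 3) * j) + s * (p * k + (p + 3) * l)" for i j k l
    using Gm(3)[OF r0] by (simp add: G_def s_def)
  have small: "p * i + (p + 3) * j < s" if "i < i0" "j < p" for i j
  proof -
    have "p * i + (p + 3) * j \<le> p * i0 + (p + 3) * p" using that by (intro add_mono mult_le_mono) auto
    also have "\<dots> < s" using p_pow_ge[OF r] by (simp add: s_def i0_def algebra_simps power2_eq_square)
    finally show ?thesis .
  qed
  have inj: "inj_on (\<lambda>t. degree (Lam (G t))) I"
  proof (rule inj_onI)
    fix t t' assume t: "t \<in> I" "t' \<in> I" "degree (Lam (G t)) = degree (Lam (G t'))"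
    obtain i j k l where [simp]: "t = (i, j, k, l)" by (cases t)
    obtain i' j' k' l' where [simp]: "t' = (i', j', k', l')" by (cases t')
    show "t = t'"
      using weight_inj[of i j s i' j' l l' k k'] small[of i j] small[of i' j'] t
      by (simp add: degG) (simp add: I_def)
  qed
  have "Lam GG \<noteq> 0"
  proof -
    obtain t where t: "t \<in> I" "b t \<noteq> 0" using b(1) by blast
    then have "a t \<noteq> 0" using a[of t] s0 by (auto simp: power_0_left)
    moreover have "Lam (G t) \<noteq> 0" for t using Gm(2)[OF r0] by (auto simp: G_def split: prod.splits)
    ultimately show ?thesis unfolding LGG
      using sum_smult_distinct_degree_neq_0[OF fin _ inj t(1)] by blast
  qed
  then have "GG \<noteq> 0" by auto
  define j0 where "j0 = degree GG"
  define g where "g = coeff GG j0"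
  have g: "g \<noteq> 0" using \<open>GG \<noteq> 0\<close> by (simp add: g_def j0_def)
  have j0: "j0 < p" using deg by (simp add: j0_def)
  have "degree (Lam GG) \<le> (p * i0 + (p + 3) * p) + s * (p * k0 + (p + 3) * p)"
    unfolding LGG
  proof (intro degree_sum_le fin order.trans[OF degree_smult_le])
    fix t assume t: "t \<in> I"
    obtain i j k l where [simp]: "t = (i, j, k, l)" by (cases t)
    have "i \<le> i0" "j \<le> p" "k \<le> k0" "l \<le> p" using t by (auto simp: I_def)
    then show "degree (Lam (G t)) \<le> (p * i0 + (p + 3) * p) + s * (p * k0 + (p + 3) * p)"
      by (simp only: degG \<open>t = _\<close>) (intro add_mono mult_le_mono order.refl)
  qed
  moreover have "p * degree g + (p + 3) * j0 \<le> degree (Lam GG)"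
    unfolding g_def using degree_coeff_le_Lam[OF deg(2) j0] g by (simp add: g_def)
  ultimately have "p * degree g \<le> p * ((i0 + (p + 3)) + s * (k0 + (p + 3)))"
    by (simp add: algebra_simps)
  then have dg: "degree g \<le> (i0 + (p + 3)) + s * (k0 + (p + 3))" using p_pos by simp
  have vanish: "poly g x = 0" if x: "x \<noteq> 0" "x ^ (p ^ (2 * r)) = x" "tr (2 * r) (f x) = c" for x
  proof -
    obtain Y where Y: "finite Y" "card Y = p" "\<forall>y\<in>Y. y ^ p = y + f x"
      using artin_schreier_roots[of "f x"] by blast
    define P where "P = map_poly (\<lambda>g. poly g x) GG"
    have "poly P (x * y) = 0" if "y \<in> Y" for y
    proof -
      have "y ^ p = y + f x" using Y that by blast
      note pt = ev_point[OF x(1,2) this x(3)]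
      have *: "ev x (x * y) (G t) ^ s = ev x (x * y) (H t)" for t
      proof -
        obtain i j k l where [simp]: "t = (i, j, k, l)" by (cases t)
        have 1: "ev x (x * y) (G t) ^ s =
          (x ^ s) ^ i * ((x * y) ^ s) ^ j * ((x ^ s) ^ s) ^ k * (((x * y) ^ s) ^ s) ^ l"
          unfolding s_def
          by (simp only: G_def prod.case \<open>t = _\<close> ev_Gm[OF pt(1)] pt(2) power_mult_distrib[of "_ * _"]
              power_mult_distrib[of "_ ^ _" "_ ^ _"] power_commutes)
            (simp only: power_mult[symmetric] mult_ac)
        show ?thesis unfolding 1 unfolding s_def
          by (simp only: H_def prod.case \<open>t = _\<close> ev_Hm[OF pt(1)] pt(2-4), (simp only: mult_ac)?)
      qed
      have "ev x (x * y) GG ^ s = (\<Sum>t\<in>I. (a t * ev x (x * y) (G t)) ^ s)"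
        unfolding s_def by (simp add: GG_def ev_sum ev_smult frob_sum)
      also have "\<dots> = ev x (x * y) HH"
        by (simp add: power_mult_distrib a * HH_def ev_sum ev_smult)
      also have "\<dots> = 0" by (simp add: HH ev_def)
      finally show ?thesis using s0 by (simp add: P_def ev_as_poly)
    qed
    then have sub: "(\<lambda>y. x * y) ` Y \<subseteq> {z. poly P z = 0}" by auto
    have cY: "card ((\<lambda>y. x * y) ` Y) = p" using Y x by (subst card_image) (auto simp: inj_on_def)
    have "P = 0"
    proof (rule ccontr)
      assume "P \<noteq> 0"
      then have "p \<le> degree P"
        using card_mono[OF poly_roots_finite[of P] sub] cY card_poly_roots_bound[of P] by simp
      moreover have "degree P \<le> degree GG" by (simp add: P_def degree_map_poly_le)
      ultimately show False using deg by simp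
    qed
    then have "coeff P j0 = 0" by simp
    then show ?thesis by (simp add: P_def coeff_map_poly g_def)
  qed
  have "card {x. x \<noteq> 0 \<and> x ^ (p ^ (2 * r)) = x \<and> tr (2 * r) (f x) = c} \<le> card {x. poly g x = 0}"
    using vanish by (intro card_mono poly_roots_finite g) auto
  also have "\<dots> \<le> degree g" using g by (rule card_poly_roots_bound)
  also have "\<dots> \<le> (i0 + (p + 3)) + s * (k0 + (p + 3))" by (rule dg)
  also have "\<dots> \<le> p ^ (2 * r - 1) + (C0 + 2 * p + 7) * s"
  proof -
    have "i0 \<le> s" using p_pos by (simp add: i0_def s_def power_increasing)
    moreover have "s * p ^ (r - 1) = p ^ (2 * r - 1)"
      using r0 by (simp add: s_def flip: power_add) (simp add: mult_2)
    moreover have "(p + 3) * 1 \<le> (p + 3) * s" using s0 by (intro mult_le_mono) auto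
    ultimately show ?thesis by (simp add: k0_def algebra_simps)
  qed
  finally show ?thesis by (simp only: s_def)
qed

section \<open>The prime field, its additive character, and the sums over extensions\<close>

lemma frob_add_p: "(x + y :: 'k) ^ p = x ^ p + y ^ p" using frob_add[of x y 1] by simp
lemma frob_uminus_p: "(- x :: 'k) ^ p = - (x ^ p)" using frob_uminus[of x 1] by simp
lemma frob_diff_p: "(x - y :: 'k) ^ p = x ^ p - y ^ p" using frob_diff[of x y 1] by simp
lemma frob_sum_p: "(sum g A :: 'k) ^ p = (\<Sum>a\<in>A. g a ^ p)" using frob_sum[of g A 1] by simp

definition Fp :: "'k set" where "Fp = {x. x ^ p = x}"

lemma of_nat_in_Fp [simp]: "of_nat i \<in> Fp"
  using of_nat_frob[of i 1] by (simp add: Fp_def)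

lemma of_nat_eq_iff: "(of_nat i :: 'k) = of_nat j \<longleftrightarrow> [i = j] (mod p)"
  by (simp add: of_nat_eq_iff_cong_CHAR char_p)

lemma inj_of_nat: "inj_on (of_nat :: nat \<Rightarrow> 'k) {..<p}"
  by (rule inj_onI) (auto simp: of_nat_eq_iff cong_def)

text \<open>In characteristic \<open>p\<close> the polynomial \<open>X ^ q - X\<close> has
  derivative -1, so its roots are simple and their number is its degree.\<close>

lemma card_fixed_points:
  assumes "k > 0"
  shows "finite {x::'k. x ^ (p ^ k) = x}" "card {x::'k. x ^ (p ^ k) = x} = p ^ k"
proof -
  define q where "q = p ^ k"
  have q: "q > 1" unfolding q_def using assms p_gt_3 by (intro one_less_power) auto
  define P :: "'k poly" where "P = monom 1 q - monom 1 1"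
  have dP: "degree P = q" unfolding P_def using q by (subst degree_diff_eq_left) (auto simp: degree_monom_eq)
  have P0: "P \<noteq> 0" using dP q by auto
  have roots: "{x::'k. x ^ (p ^ k) = x} = {x. poly P x = 0}"
    by (auto simp: P_def poly_monom q_def)
  show "finite {x::'k. x ^ (p ^ k) = x}" unfolding roots by (rule poly_roots_finite[OF P0])
  have "(of_nat q :: 'k) = 0" using assms by (simp add: of_nat_eq_0_iff_char_dvd char_p q_def)
  then have deriv: "pderiv P = - 1"
    by (simp add: P_def pderiv_diff pderiv_monom monom_0 flip: one_pCons)
  have ord: "order x P = 1" if "poly P x = 0" for x
  proof (rule ccontr)
    assume "order x P \<noteq> 1"
    moreover have "order x P \<noteq> 0" using that P0 by (simp add: order_root)
    ultimately have "[:-x, 1:] ^ 2 dvd P" by (subst order_divides) auto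
    then obtain g where g: "P = [:-x, 1:] ^ 2 * g" by auto
    have "poly (pderiv P) x = 0"
      unfolding g power2_eq_square pderiv_mult poly_add poly_mult by simp
    then show False by (simp add: deriv)
  qed
  have "q = size (proots P)" using size_proots_alg_closed[OF P0] dP by simp
  also have "\<dots> = (\<Sum>x\<in>{x. poly P x = 0}. order x P)"
    using P0 by (simp add: size_multiset_overloaded_eq)
  also have "\<dots> = card {x. poly P x = 0}" by (simp add: ord)
  finally show "card {x::'k. x ^ (p ^ k) = x} = p ^ k" unfolding roots q_def by (rule sym)
qed

lemma Fp_eq: "Fp = of_nat ` {..<p}"
proof -
  have "card (of_nat ` {..<p} :: 'k set) = p" by (simp add: card_image inj_of_nat)
  moreover have "(of_nat ` {..<p} :: 'k set) \<subseteq> Fp" by auto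
  moreover have "finite Fp" "card Fp = p" using card_fixed_points[of 1] by (simp_all add: Fp_def)
  ultimately show ?thesis by (metis card_subset_eq)
qed

lemma finite_Fp [simp]: "finite Fp" by (simp add: Fp_eq)
lemma card_Fp: "card Fp = p" using card_fixed_points[of 1] by (simp add: Fp_def)

lemma Fp_closed:
  "x \<in> Fp \<Longrightarrow> y \<in> Fp \<Longrightarrow> x + y \<in> Fp" "x \<in> Fp \<Longrightarrow> y \<in> Fp \<Longrightarrow> x * y \<in> Fp"
  "x \<in> Fp \<Longrightarrow> - x \<in> Fp" "x \<in> Fp \<Longrightarrow> y \<in> Fp \<Longrightarrow> x - y \<in> Fp"
  "x \<in> Fp \<Longrightarrow> inverse x \<in> Fp" "x \<in> Fp \<Longrightarrow> y \<in> Fp \<Longrightarrow> x / y \<in> Fp"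
  "x \<in> Fp \<Longrightarrow> x ^ i \<in> Fp"  "0 \<in> Fp" "1 \<in> Fp" "numeral w \<in> Fp"
  "m \<in> Fp" "n \<in> Fp"
  using of_nat_in_Fp[of "numeral w"] p_pos m_frob n_frob
  by (auto simp: Fp_def frob_add_p frob_uminus_p frob_diff_p power_mult_distrib power_inverse power_divide 
      power_mult[symmetric] mult.commute[of i p] simp del: of_nat_in_Fp) (simp add: power_mult)

text \<open>Meaningful on \<open>Fp\<close>, where the representative below \<open>p\<close> is
  unique; elsewhere the value is unspecified but still of norm 1.\<close>

definition psi :: "'k \<Rightarrow> complex" where
  "psi x = char_mod p (int (THE i. i < p \<and> of_nat i = x))"

lemma psi_of_nat: "psi (of_nat i) = char_mod p (int i)"
proof -
  have "(THE j. j < p \<and> (of_nat j :: 'k) = of_nat i) = i mod p"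
    using p_pos by (intro the_equality) (auto simp: of_nat_eq_iff cong_def)
  then show ?thesis unfolding psi_def 
    by (auto intro!: char_mod_cong p_pos simp: cong_def zmod_int)
qed

lemma Fp_cases: "x \<in> Fp \<Longrightarrow> (\<And>i. i < p \<Longrightarrow> x = of_nat i \<Longrightarrow> P) \<Longrightarrow> P"
  by (auto simp: Fp_eq)

lemma psi_add: "x \<in> Fp \<Longrightarrow> y \<in> Fp \<Longrightarrow> psi (x + y) = psi x * psi y"
  by (auto elim!: Fp_cases simp: psi_of_nat char_mod_add simp flip: of_nat_add) 
    (simp add: char_mod_add)

lemma psi_0 [simp]: "psi 0 = 1" using psi_of_nat[of 0] by simp

lemma norm_psi [simp]: "norm (psi x) = 1" by (simp add: psi_def)

lemma psi_1: "psi 1 \<noteq> 1"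
  using psi_of_nat[of 1] p_gt_3 by (auto simp: char_mod_eq_1_iff dest: zdvd_imp_le)

lemma sum_psi: "(\<Sum>c\<in>Fp. psi c) = 0"
proof -
  have "(\<Sum>c\<in>Fp. psi c) = (\<Sum>i<p. char_mod p (1 * int i))"
    unfolding Fp_eq by (subst sum.reindex[OF inj_of_nat]) (simp add: psi_of_nat)
  also have "\<dots> = 0" using p_gt_3 by (subst sum_char_mod) auto
  finally show ?thesis .
qed

text \<open>The nonzero elements of the field with \<open>p ^ k\<close> elements; 0 is left out
  because \<open>f\<close> may have a pole there.\<close>

definition Fs :: "nat \<Rightarrow> 'k set" where "Fs k = {x. x \<noteq> 0 \<and> x ^ (p ^ k) = x}"

lemma finite_Fs: "k > 0 \<Longrightarrow> finite (Fs k)"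
  using card_fixed_points(1)[of k] by (rule rev_finite_subset) (auto simp: Fs_def)

lemma card_Fs: assumes "k > 0" shows "card (Fs k) = p ^ k - 1"
proof -
  have "Fs k = {x. x ^ (p ^ k) = x} - {0}" by (auto simp: Fs_def)
  then show ?thesis using card_fixed_points[OF assms] p_pos by (simp add: power_0_left)
qed

lemma f_frob: "f (x ^ (p ^ i)) = f x ^ (p ^ i)"
  by (simp add: f_def frob_add power_mult_distrib frob_fixed_power m_frob n_frob power_inverse
      flip: power_mult) (simp add: mult.commute)

lemma tr_in_Fp: assumes "x ^ (p ^ k) = x" shows "tr k x \<in> Fp"
proof -
  have "tr k x ^ p = (\<Sum>i<k. x ^ (p ^ Suc i))"
    by (simp add: tr_def frob_sum_p mult.commute flip: power_mult)
  moreover have "(\<Sum>i<k. x ^ (p ^ Suc i)) + x ^ (p ^ 0) = tr k x + x ^ (p ^ k)"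
    unfolding tr_def using sum.lessThan_Suc_shift[of "\<lambda>i. x ^ (p ^ i)" k] 
      sum.lessThan_Suc[of "\<lambda>i. x ^ (p ^ i)" k] by (simp add: add.commute)
  ultimately show ?thesis using assms by (simp add: Fp_def)
qed

lemma tr_f_in_Fp: "x \<in> Fs k \<Longrightarrow> tr k (f x) \<in> Fp"
  by (rule tr_in_Fp) (simp add: Fs_def flip: f_frob)

definition S :: "nat \<Rightarrow> complex" where "S k = (\<Sum>x\<in>Fs k. psi (tr k (f x)))"

text \<open>A one-sided bound for the fibres of the trace is enough. Since \<open>psi\<close> sums
  to 0, the upper bound \<open>M\<close> may be subtracted from every count; all differences then
  have one sign, and their absolute values add up to \<open>p * M - (p ^ (2 * r) - 1)\<close>, in
  which the main terms cancel.\<close>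

lemma S_bound:
  assumes r: "r \<ge> 4"
  shows "norm (S (2 * r)) \<le> real (p * (C0 + 2 * p + 7) + 1) * real p ^ r"
proof -
  define D where "D = C0 + 2 * p + 7"
  define M where "M = p ^ (2 * r - 1) + D * p ^ r"
  define N where "N c = card {x \<in> Fs (2 * r). tr (2 * r) (f x) = c}" for c
  have fin: "finite (Fs (2 * r))" using r by (intro finite_Fs) auto
  have NM: "N c \<le> M" for c
    using stepanov[OF r, of c] by (simp add: N_def Fs_def M_def D_def conj_ac)
  have "S (2 * r) = (\<Sum>c\<in>Fp. \<Sum>x\<in>{x \<in> Fs (2 * r). tr (2 * r) (f x) = c}. psi (tr (2 * r) (f x)))"
    unfolding S_def by (rule sum.group[symmetric]) (auto simp: fin tr_f_in_Fp)
  also have "\<dots> = (\<Sum>c\<in>Fp. of_nat (N c) * psi c)"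
    by (intro sum.cong) (auto simp: N_def)
  also have "\<dots> = (\<Sum>c\<in>Fp. of_nat (N c) * psi c) - of_nat M * (\<Sum>c\<in>Fp. psi c)"
    by (simp add: sum_psi)
  also have "\<dots> = (\<Sum>c\<in>Fp. (of_nat (N c) - of_nat M) * psi c)"
    by (simp add: sum_distrib_left left_diff_distrib sum_subtractf)
  finally have "norm (S (2 * r)) \<le> (\<Sum>c\<in>Fp. norm ((of_nat (N c) - of_nat M) * psi c))"
    by (metis norm_sum)
  also have "\<dots> = (\<Sum>c\<in>Fp. real M - real (N c))"
  proof (intro sum.cong refl)
    fix c
    have "norm (of_nat (N c) - of_nat M :: complex) = norm (of_real (real (N c) - real M) :: complex)" by simp
    also have "\<dots> = real M - real (N c)" unfolding norm_of_real using NM[of c] by simp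
    finally show "norm ((of_nat (N c) - of_nat M) * psi c) = real M - real (N c)" by (simp add: norm_mult)
  qed
  also have "\<dots> = real p * real M - real (\<Sum>c\<in>Fp. N c)"
    by (simp add: sum_subtractf card_Fp)
  also have "(\<Sum>c\<in>Fp. N c) = card (Fs (2 * r))"
    unfolding N_def card_eq_sum by (rule sum.group) (auto simp: fin tr_f_in_Fp)
  also have "card (Fs (2 * r)) = p ^ (2 * r) - 1" using r by (intro card_Fs) auto
  also have "real p * real M = real (p * p ^ (2 * r - 1)) + real p * real D * real p ^ r"
    by (simp add: M_def algebra_simps)
  also have "p * p ^ (2 * r - 1) = p ^ (2 * r)" using r by (cases r) auto
  also have "real (p ^ (2 * r)) + real p * real D * real p ^ r - real (p ^ (2 * r) - 1) = real p * real D * real p ^ r + 1"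
    using p_pos by (simp add: of_nat_diff)
  also have "\<dots> \<le> real p * real D * real p ^ r + real p ^ r"
    using p_gt_3 by simp
  finally show ?thesis by (simp add: D_def algebra_simps)
qed

section \<open>The L-function over the prime field\<close>

definition frp :: "'k poly \<Rightarrow> 'k poly" where "frp g = map_poly (\<lambda>x. x ^ p) g"

lemma coeff_frp: "coeff (frp g) i = coeff g i ^ p"
  unfolding frp_def using p_pos by (simp add: coeff_map_poly)

lemma frp_mult: "frp (g * h) = frp g * frp h"
  by (rule poly_eqI) (simp add: coeff_frp coeff_mult frob_sum_p power_mult_distrib)

lemma frp_1: "frp 1 = 1"
  by (rule poly_eqI) (use p_pos in \<open>simp add: coeff_frp coeff_1\<close>)

lemma frp_prod: "frp (prod h A) = (\<Prod>a\<in>A. frp (h a))"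
  by (induction A rule: infinite_finite_induct) (auto simp: frp_mult frp_1)

lemma frp_power: "frp (h ^ k) = frp h ^ k"
  by (induction k) (auto simp: frp_mult frp_1)

lemma frp_linear: "frp [:-a, 1:] = [:-(a ^ p), 1:]"
  by (rule poly_eqI) (use p_pos in \<open>auto simp: coeff_frp coeff_pCons frob_uminus_p split: nat.splits\<close>)

text \<open>Monic polynomials over the prime field that are prime to \<open>X\<close>; invariance
  under the coefficientwise Frobenius \<open>frp\<close> expresses that the coefficients lie in the
  prime field. Keeping them over the algebraically closed field makes their roots available.\<close>

definition Mon :: "nat \<Rightarrow> 'k poly set" where
  "Mon d = {g. degree g = d \<and> lead_coeff g = 1 \<and> coeff g 0 \<noteq> 0 \<and> frp g = g}"

lemma finite_Mon: "finite (Mon d)"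
proof (rule finite_subset)
  have "coeff g i \<in> Fp" if "g \<in> Mon d" for g i
    using that coeff_frp[of g i] by (simp add: Mon_def Fp_def)
  then show "Mon d \<subseteq> {g. degree g \<le> d \<and> (\<forall>i. coeff g i \<in> Fp)}"
    by (auto simp: Mon_def)
  show "finite {g. degree g \<le> d \<and> (\<forall>i. coeff g i \<in> Fp)}"
  proof (rule finite_subset)
    show "{g. degree g \<le> d \<and> (\<forall>i. coeff g i \<in> Fp)} \<subseteq> (\<lambda>xs. Poly xs) ` {xs. set xs \<subseteq> Fp \<and> length xs \<le> Suc d}"
    proof
      fix g assume g: "g \<in> {g. degree g \<le> d \<and> (\<forall>i. coeff g i \<in> Fp)}"
      have "set (coeffs g) \<subseteq> range (coeff g)" by (auto simp: coeffs_def)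
      moreover have "length (coeffs g) \<le> Suc d" using g by (simp add: coeffs_def)
      ultimately show "g \<in> (\<lambda>xs. Poly xs) ` {xs. set xs \<subseteq> Fp \<and> length xs \<le> Suc d}"
        using g by (intro image_eqI[of _ _ "coeffs g"]) auto
    qed
    show "finite ((\<lambda>xs. Poly xs) ` {xs. set xs \<subseteq> Fp \<and> length xs \<le> Suc d})"
      by (intro finite_imageI finite_lists_length_le) auto
  qed
qed

text \<open>\<open>lam g\<close> is the sum of \<open>f\<close> over the roots of the monic polynomial \<open>g\<close>, written through its extreme
  coefficients by Newton's identities for the power sums of order \<open>3\<close> and \<open>-2\<close>.\<close>

definition lam :: "'k poly \<Rightarrow> 'k" where
  "lam g = (let R = reflect_poly g; a = coeff R 1; b = coeff R 2; c = coeff R 3; u = coeff g 1 / coeff g 0; v = coeff g 2 / coeff g 0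
     in m * (- (a ^ 3) + 3 * a * b - 3 * c) + n * (u ^ 2 - 2 * v))"

lemma coeff_mult_low:
  "coeff (g * h) 1 = coeff g 0 * coeff h 1 + coeff g 1 * coeff h 0"
  "coeff (g * h) 2 = coeff g 0 * coeff h 2 + coeff g 1 * coeff h 1 + coeff g 2 * coeff h 0"
  "coeff (g * h) 3 = coeff g 0 * coeff h 3 + coeff g 1 * coeff h 2 + coeff g 2 * coeff h 1 + coeff g 3 * coeff h 0"
  by (simp_all add: coeff_mult numeral_2_eq_2 numeral_3_eq_3 atMost_Suc add_ac)

lemma lam_mult:
  assumes "lead_coeff g = 1" "lead_coeff h = 1" "coeff g 0 \<noteq> 0" "coeff h 0 \<noteq> 0"
  shows "lam (g * h) = lam g + lam h"
proof -
  have 0: "coeff (reflect_poly g) 0 = 1" "coeff (reflect_poly h) 0 = 1" using assms by simp_all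
  obtain a b c a' b' c' where R: "a = coeff (reflect_poly g) 1" "b = coeff (reflect_poly g) 2" "c = coeff (reflect_poly g) 3"
    "a' = coeff (reflect_poly h) 1" "b' = coeff (reflect_poly h) 2" "c' = coeff (reflect_poly h) 3" by blast
  obtain u v u' v' where L: "u = coeff g 1 / coeff g 0" "v = coeff g 2 / coeff g 0"
    "u' = coeff h 1 / coeff h 0" "v' = coeff h 2 / coeff h 0" by blast
  have L1: "coeff (g * h) 1 / coeff (g * h) 0 = u + u'"
    unfolding L coeff_mult_low coeff_mult_0 using assms by (simp add: field_simps)
  have L2: "coeff (g * h) 2 / coeff (g * h) 0 = v + u * u' + v'"
    unfolding L coeff_mult_low coeff_mult_0 using assms by (simp add: field_simps)
  have "lam (g * h) = m * (- ((a + a') ^ 3) + 3 * (a + a') * (b + a * a' + b') - 3 * (c + b * a' + a * b' + c'))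
     + n * ((u + u') ^ 2 - 2 * (v + u * u' + v'))"
    unfolding lam_def Let_def unfolding L1 L2 unfolding reflect_poly_mult coeff_mult_low 0 R[symmetric] by (simp add: algebra_simps)
  also have "\<dots> = (m * (- (a ^ 3) + 3 * a * b - 3 * c) + n * (u ^ 2 - 2 * v)) +
     (m * (- (a' ^ 3) + 3 * a' * b' - 3 * c') + n * (u' ^ 2 - 2 * v'))"
    by (simp add: power2_eq_square power3_eq_cube algebra_simps)
  also have "\<dots> = lam g + lam h" by (simp add: lam_def Let_def R L)
  finally show ?thesis .
qed

lemma lam_linear: "x \<noteq> 0 \<Longrightarrow> lam [:-x, 1:] = f x"
  by (simp add: lam_def Let_def f_def reflect_poly_pCons coeff_pCons numeral_2_eq_2 numeral_3_eq_3 divide_inverse)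

lemma lam_1: "lam 1 = 0"
  by (simp add: lam_def Let_def)

lemma lam_prod:
  assumes "finite A" "\<And>a. a \<in> A \<Longrightarrow> x a \<noteq> 0"
  shows "lam (\<Prod>a\<in>A. [:-x a, 1:]) = (\<Sum>a\<in>A. f (x a))"
  using assms
proof (induction A rule: finite_induct)
  case (insert a A)
  have "coeff (\<Prod>a\<in>A. [:-x a, 1:]) 0 \<noteq> 0"
    using insert by (simp add: poly_0_coeff_0[symmetric] poly_prod)
  moreover have "lead_coeff (\<Prod>a\<in>A. [:-x a, 1:]) = 1" by (simp add: lead_coeff_prod)
  ultimately show ?case using insert by (simp add: lam_mult lam_linear del: mult_pCons_left)
qed (simp add: lam_1)

lemma Mon_coeff: "g \<in> Mon d \<Longrightarrow> coeff g i \<in> Fp"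
  using coeff_frp[of g i] by (simp add: Mon_def Fp_def)

lemma lam_in_Fp: assumes "g \<in> Mon d" shows "lam g \<in> Fp"
proof -
  have "coeff g i \<in> Fp" for i using Mon_coeff[OF assms] .
  moreover have "coeff (reflect_poly g) i \<in> Fp" for i
    using Mon_coeff[OF assms] Fp_closed by (simp add: coeff_reflect_poly)
  ultimately show ?thesis unfolding lam_def Let_def by (intro Fp_closed)
qed

text \<open>The coefficient of degree \<open>d\<close> of the L-function attached to the
  multiplicative function \<open>g \<mapsto> psi (lam g)\<close>.\<close>

definition A :: "nat \<Rightarrow> complex" where "A d = (\<Sum>g\<in>Mon d. psi (lam g))"

lemma Mon_0: "Mon 0 = {1}"
proof (intro equalityI subsetI)
  fix g assume "g \<in> Mon 0"
  then have "degree g = 0" "coeff g 0 = 1" by (auto simp: Mon_def)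
  then have "g = [:1:]" by (metis degree_0_id)
  then show "g \<in> {1}" by (simp add: one_pCons)
qed (auto simp: Mon_def frp_1)

lemma A_0: "A 0 = 1" by (simp add: A_def Mon_0 lam_1)

text \<open>The coefficient of \<open>X ^ (d - 3)\<close> enters \<open>lam\<close> linearly, so the character sum over it vanishes.\<close>

lemma shift_Mon:
  assumes "g \<in> Mon d" "d \<ge> 6" "t \<in> Fp"
  shows "g + monom t (d - 3) \<in> Mon d" "lam (g + monom t (d - 3)) = lam g - 3 * m * t"
proof -
  let ?g = "g + monom t (d - 3)"
  have g: "degree g = d" "coeff g d = 1" "coeff g 0 \<noteq> 0" "frp g = g" using assms by (auto simp: Mon_def)
  have c: "coeff ?g i = coeff g i" if "i \<noteq> d - 3" for i using that by simp
  have c3: "coeff ?g (d - 3) = coeff g (d - 3) + t" by simp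
  have deg: "degree ?g = d"
    using g assms(2) degree_monom_le[of t "d - 3"] by (subst degree_add_eq_left) auto
  have "frp ?g = ?g"
  proof (rule poly_eqI)
    fix i show "coeff (frp ?g) i = coeff ?g i"
      using Mon_coeff[OF assms(1), of i] assms(3) p_pos by (simp add: coeff_frp frob_add_p Fp_def)
  qed
  then show "?g \<in> Mon d" using deg g assms(2) c[of d] c[of 0] by (simp add: Mon_def)
  have low: "coeff ?g 0 = coeff g 0" "coeff ?g 1 = coeff g 1" "coeff ?g 2 = coeff g 2"
    using assms(2) by (intro c; simp)+
  have high: "coeff (reflect_poly ?g) 1 = coeff (reflect_poly g) 1"
     "coeff (reflect_poly ?g) 2 = coeff (reflect_poly g) 2"
    unfolding coeff_reflect_poly deg g(1) using assms(2) c[of "d - 1"] c[of "d - 2"] by auto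
  have high3: "coeff (reflect_poly ?g) 3 = coeff (reflect_poly g) 3 + t"
    unfolding coeff_reflect_poly deg g(1) using assms(2) c3 by auto
  show "lam ?g = lam g - 3 * m * t"
    unfolding lam_def Let_def low high high3 by (simp add: algebra_simps)
qed

lemma three_nz: "(3 :: 'k) \<noteq> 0"
proof -
  have "\<not> p dvd 3" using p_gt_3 by (auto dest: dvd_imp_le)
  then show ?thesis using of_nat_eq_0_iff_char_dvd[of 3, where 'a='k] by (simp add: char_p)
qed

text \<open>For \<open>d \<ge> 6\<close> the index \<open>d - 3\<close> lies above 2, so the
  coefficient that is varied is not also one of the low coefficients in \<open>lam\<close>. The
  shift changes \<open>lam\<close> by 1, which multiplies \<open>A d\<close> by
  \<open>psi 1 \<noteq> 1\<close>. This is the source of the degree bound 5.\<close>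

lemma A_eq_0: assumes "d \<ge> 6" shows "A d = 0"
proof -
  define t where "t = - (1 / (3 * m))"
  have t: "t \<in> Fp" unfolding t_def by (intro Fp_closed)
  have mt: "- (3 * m * t) = 1" using three_nz m_nz by (simp add: t_def)
  have neg: "-t \<in> Fp" using t by (intro Fp_closed)
  have "A d = (\<Sum>g\<in>Mon d. psi (lam (g + monom t (d - 3))))"
    unfolding A_def
  proof (rule sum.reindex_bij_witness[of _ "\<lambda>g. g + monom t (d - 3)" "\<lambda>g. g + monom (-t) (d - 3)"])
    fix g assume g: "g \<in> Mon d"
    show "g + monom (-t) (d - 3) \<in> Mon d" "g + monom t (d - 3) \<in> Mon d"
      using shift_Mon[OF g assms] t neg by auto
  qed (auto simp: add.assoc add_monom)
  also have "\<dots> = (\<Sum>g\<in>Mon d. psi (lam g) * psi 1)"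
  proof (intro sum.cong refl)
    fix g assume g: "g \<in> Mon d"
    have "lam (g + monom t (d - 3)) = lam g + 1" unfolding shift_Mon(2)[OF g assms t] mt[symmetric] by simp
    then show "psi (lam (g + monom t (d - 3))) = psi (lam g) * psi 1"
      using lam_in_Fp[OF g] by (simp add: psi_add Fp_closed)
  qed
  also have "\<dots> = A d * psi 1" by (simp add: A_def sum_distrib_right)
  finally show ?thesis using psi_1 by simp
qed

text \<open>For \<open>a\<close> in \<open>Fs j\<close> this is the characteristic polynomial of
  \<open>a\<close> over the prime field: conjugates are repeated when \<open>a\<close> lies in a
  smaller field, so it is a power of the minimal polynomial.\<close>

definition Q :: "'k \<Rightarrow> nat \<Rightarrow> 'k poly" where "Q a j = (\<Prod>i<j. [:- (a ^ (p ^ i)), 1:])"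

lemma degree_Q: "degree (Q a j) = j"
  unfolding Q_def by (subst degree_prod_sum_eq) auto

text \<open>Frobenius moves every linear factor to the next one, and the last returns to the first.
  Multiplying both products by the common factor \<open>X - a\<close> compares them without a case
  distinction about repeated conjugates.\<close>

lemma Q_Mon: assumes "a \<in> Fs j" shows "Q a j \<in> Mon j"
proof -
  have a: "a \<noteq> 0" "a ^ (p ^ j) = a" using assms by (auto simp: Fs_def)
  have 1: "[:- (a ^ (p ^ 0)), 1:] * frp (Q a j) = [:- (a ^ (p ^ j)), 1:] * Q a j"
  proof -
    have "frp (Q a j) = (\<Prod>i<j. [:- (a ^ (p ^ Suc i)), 1:])"
      unfolding Q_def by (simp add: frp_prod frp_linear mult.commute flip: power_mult)
    then show ?thesis unfolding Q_def
      using prod.lessThan_Suc_shift[of "\<lambda>i. [:- (a ^ (p ^ i)), 1:]" j]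
        prod.lessThan_Suc[of "\<lambda>i. [:- (a ^ (p ^ i)), 1:]" j]
      by (metis mult.commute)
  qed
  have ne: "[:- a, 1:] \<noteq> 0" by simp
  have "[:- a, 1:] * frp (Q a j) = [:- a, 1:] * Q a j" using 1 a by simp
  then have "frp (Q a j) = Q a j" using mult_left_cancel[OF ne] by blast
  moreover have "lead_coeff (Q a j) = 1" by (simp add: Q_def lead_coeff_prod)
  moreover have "coeff (Q a j) 0 \<noteq> 0" using a by (simp add: Q_def poly_0_coeff_0[symmetric] poly_prod)
  ultimately show ?thesis by (simp add: Mon_def degree_Q)
qed

lemma lam_Q: "a \<in> Fs j \<Longrightarrow> lam (Q a j) = tr j (f a)"
  unfolding Q_def tr_def by (subst lam_prod) (auto simp: Fs_def f_frob)

lemma Mon_mult: "g \<in> Mon d \<Longrightarrow> h \<in> Mon e \<Longrightarrow> g * h \<in> Mon (d + e)"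
  unfolding Mon_def
  by (auto simp: frp_mult lead_coeff_mult coeff_mult_0 degree_mult_eq 
    intro!: degree_mult_eq)

lemma Mon_divide: 
  assumes "g \<in> Mon j" "g * h \<in> Mon d" shows "h \<in> Mon (d - j)" "j \<le> d"
proof -
  have g: "degree g = j" "lead_coeff g = 1" "coeff g 0 \<noteq> 0" "frp g = g" "g \<noteq> 0" using assms by (auto simp: Mon_def)
  have gh: "degree (g * h) = d" "lead_coeff (g * h) = 1" "coeff (g * h) 0 \<noteq> 0" "frp (g * h) = g * h" using assms by (auto simp: Mon_def)
  have "h \<noteq> 0" using gh(3) by auto
  then have "degree (g * h) = degree g + degree h" using g by (simp add: degree_mult_eq)
  then have "degree h = d - j" "j \<le> d" using gh(1) g(1) by auto
  moreover have "lead_coeff h = 1" using gh(2) g(2) by (simp add: lead_coeff_mult)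
  moreover have "coeff h 0 \<noteq> 0" using gh(3) by (auto simp: coeff_mult_0)
  moreover have "frp h = h" using gh(4) g(4,5) by (simp add: frp_mult)
  ultimately show "h \<in> Mon (d - j)" "j \<le> d" by (auto simp: Mon_def)
qed

lemma frob_inj: "(x :: 'k) ^ (p ^ i) = y ^ (p ^ i) \<Longrightarrow> x = y"
proof -
  assume "x ^ (p ^ i) = y ^ (p ^ i)"
  then have "(x - y) ^ (p ^ i) = 0" by (simp add: frob_diff)
  then show "x = y" by simp
qed

lemma order_frob_le:
  assumes "frp g = g" "g \<noteq> 0" shows "order x g \<le> order (x ^ p) g"
proof -
  obtain h where "g = [:-x, 1:] ^ order x g * h" using order_1[of x g] by auto
  then have "frp g = [:-(x ^ p), 1:] ^ order x g * frp h"
    by (metis frp_mult frp_power frp_linear)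
  then have "[:-(x ^ p), 1:] ^ order x g dvd g" using assms(1) by (metis dvd_triv_left)
  then show ?thesis using assms(2) by (simp add: order_divides)
qed

lemma order_frob_pow_le:
  assumes "frp g = g" "g \<noteq> 0" shows "order x g \<le> order (x ^ (p ^ i)) g"
proof (induction i)
  case (Suc i)
  then show ?case using order_frob_le[OF assms, of "x ^ (p ^ i)"]
    by (simp add: mult.commute flip: power_mult)
qed simp

text \<open>Let \<open>\<delta>\<close> be the exact period of \<open>x\<close> under Frobenius.
  Only multiples \<open>j = \<delta> * a\<close> qualify, and \<open>Q x j\<close> is then the
  \<open>a\<close>-th power of the minimal polynomial, which divides \<open>g\<close> exactly when
  \<open>a \<le> order x g\<close>.\<close>

lemma order_eq_card:
  assumes g: "g \<in> Mon d" and root: "poly g x = 0"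
  shows "order x g = card {j \<in> {1..d}. x \<in> Fs j \<and> Q x j dvd g}"
proof -
  have g': "degree g = d" "frp g = g" "g \<noteq> 0" "coeff g 0 \<noteq> 0" using g by (auto simp: Mon_def)
  have x0: "x \<noteq> 0" using root g'(4) by (metis poly_0_coeff_0)
  have ord1: "order x g \<ge> 1" using root g'(3) by (simp add: order_root Suc_leI)
  \<comment> \<open>The Frobenius orbit of a root stays among the finitely many roots of
    \<open>g\<close>, so it repeats; injectivity of Frobenius makes it periodic from the
    start.\<close>
  have "x ^ (p ^ i) \<in> {z. poly g z = 0}" for i
    using order_frob_pow_le[OF g'(2,3), of x i] ord1 g'(3) by (simp add: order_root)
  then have "range (\<lambda>i. x ^ (p ^ i)) \<subseteq> {z. poly g z = 0}" by auto
  then have "finite (range (\<lambda>i. x ^ (p ^ i)))"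
    using poly_roots_finite[OF g'(3)] by (rule finite_subset)
  then have "\<not> inj (\<lambda>i. x ^ (p ^ i))" using finite_imageD infinite_UNIV_nat by blast
  then obtain i i' where "i < i'" "x ^ (p ^ i) = x ^ (p ^ i')"
    unfolding inj_def by (metis linorder_neqE_nat)
  then have "x ^ (p ^ i) = (x ^ (p ^ (i' - i))) ^ (p ^ i)"
    by (simp flip: power_mult power_add)
  then have ex: "\<exists>j>0. x ^ (p ^ j) = x" using frob_inj[of x i "x ^ (p ^ (i' - i))"] \<open>i < i'\<close>
    by (intro exI[of _ "i' - i"]) auto
  define \<delta> where "\<delta> = (LEAST j. j > 0 \<and> x ^ (p ^ j) = x)"
  have \<delta>: "\<delta> > 0" "x ^ (p ^ \<delta>) = x" using LeastI_ex[OF ex] by (auto simp: \<delta>_def)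
  have \<delta>_min: "\<not> (j > 0 \<and> x ^ (p ^ j) = x)" if "j < \<delta>" for j
    using that unfolding \<delta>_def by (rule not_less_Least)
  have per_mult: "x ^ (p ^ (\<delta> * a)) = x" for a
    by (induction a) (simp_all add: power_add power_mult \<delta>(2))
  have per_mod: "x ^ (p ^ j) = x ^ (p ^ (j mod \<delta>))" for j
  proof -
    have "x ^ (p ^ j) = (x ^ (p ^ (\<delta> * (j div \<delta>)))) ^ (p ^ (j mod \<delta>))"
      by (simp flip: power_mult power_add)
    then show ?thesis by (simp only: per_mult)
  qed
  have per_iff: "x ^ (p ^ j) = x \<longleftrightarrow> \<delta> dvd j" for j
  proof
    assume "x ^ (p ^ j) = x"
    then have "\<not> j mod \<delta> > 0" using \<delta>_min[of "j mod \<delta>"] per_mod[of j] \<delta>(1) by auto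
    then show "\<delta> dvd j" by (simp add: dvd_eq_mod_eq_0)
  qed (auto simp: per_mult)
  have inj: "inj_on (\<lambda>i. x ^ (p ^ i)) {..<\<delta>}"
  proof (rule linorder_inj_onI)
    fix i i' assume ii: "i < i'" "i \<in> {..<\<delta>}" "i' \<in> {..<\<delta>}"
    show "x ^ (p ^ i) \<noteq> x ^ (p ^ i')"
    proof
      assume "x ^ (p ^ i) = x ^ (p ^ i')"
      then have "x ^ (p ^ i) = (x ^ (p ^ (i' - i))) ^ (p ^ i)"
        using ii by (simp flip: power_mult power_add)
      then have "x ^ (p ^ (i' - i)) = x" using frob_inj by metis
      moreover have "i' - i < \<delta>" "i' - i > 0" using ii by auto
      ultimately show False using \<delta>_min by blast
    qed
  qed auto
  have Q_mult: "Q x (\<delta> * a) = Q x \<delta> ^ a" for a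
  proof (induction a)
    case (Suc a)
    have "Q x (\<delta> * a + k) = Q x (\<delta> * a) * Q x k" for k
    proof (induction k)
      case (Suc k)
      have "x ^ (p ^ (\<delta> * a + k)) = x ^ (p ^ k)"
        by (simp add: power_add power_mult[of x] per_mult)
      then show ?case using Suc by (simp add: Q_def mult.assoc del: mult_pCons_left mult_pCons_right)
    qed (simp add: Q_def)
    from this[of \<delta>] show ?case using Suc by (simp add: mult.commute add.commute)
  qed (simp add: Q_def)
  have Q_dvd: "Q x (\<delta> * a) dvd g \<longleftrightarrow> a \<le> order x g" for a
  proof
    assume "Q x (\<delta> * a) dvd g"
    moreover have "[:-x, 1:] dvd Q x \<delta>"
      unfolding Q_def using \<delta>(1) dvd_prodI[of "{..<\<delta>}" 0 "\<lambda>i. [:- (x ^ (p ^ i)), 1:]"] by simp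
    then have "[:-x, 1:] ^ a dvd Q x \<delta> ^ a" by (rule dvd_power_same)
    ultimately have "[:-x, 1:] ^ a dvd g" unfolding Q_mult by (rule dvd_trans[rotated])
    then show "a \<le> order x g" using g'(3) by (simp add: order_divides)
  next
    assume a: "a \<le> order x g"
    have "Q x \<delta> = (\<Prod>b\<in>(\<lambda>i. x ^ (p ^ i)) ` {..<\<delta>}. [:-b, 1:])"
      unfolding Q_def by (subst prod.reindex[OF inj]) simp
    moreover have "(\<Prod>b\<in>(\<lambda>i. x ^ (p ^ i)) ` {..<\<delta>}. [:-b, 1:]) ^ a dvd g"
      using a order_frob_pow_le[OF g'(2,3), of x] g'(3) by (intro prod_linear_power_dvd) (auto intro: order.trans)
    ultimately show "Q x (\<delta> * a) dvd g" by (simp add: Q_mult)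
  qed
  have "{j \<in> {1..d}. x \<in> Fs j \<and> Q x j dvd g} = (\<lambda>a. \<delta> * a) ` {1..order x g}"
  proof (intro equalityI subsetI)
    fix j assume j: "j \<in> {j \<in> {1..d}. x \<in> Fs j \<and> Q x j dvd g}"
    then have "x ^ (p ^ j) = x" by (auto simp: Fs_def)
    then have "\<delta> dvd j" using per_iff by blast
    then obtain a where a: "j = \<delta> * a" by auto
    moreover have "a \<ge> 1" using a j by (cases a) auto
    ultimately show "j \<in> (\<lambda>a. \<delta> * a) ` {1..order x g}" using j Q_dvd[of a] by auto
  next
    fix j assume "j \<in> (\<lambda>a. \<delta> * a) ` {1..order x g}"
    then obtain a where "j = \<delta> * a" "a \<in> {1..order x g}" by (rule imageE)
    then have a: "j = \<delta> * a" "a \<ge> 1" "a \<le> order x g" by auto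
    then have "Q x j dvd g" using Q_dvd by simp
    moreover from this have "j \<le> d" using g' dvd_imp_degree_le[of "Q x j" g] by (simp add: degree_Q)
    ultimately show "j \<in> {j \<in> {1..d}. x \<in> Fs j \<and> Q x j dvd g}"
      using a \<delta>(1) x0 per_mult by (auto simp: Fs_def)
  qed
  moreover have "inj_on (\<lambda>a. \<delta> * a) {1..order x g}" using \<delta>(1) by (intro inj_onI) auto
  ultimately show ?thesis by (simp add: card_image)
qed

text \<open>The analogue of writing the logarithm of an integer as the sum of the von Mangoldt
  function over its divisors: the degree counts the roots with multiplicity, and
  \<open>order_eq_card\<close> spreads each multiplicity over the admissible
  \<open>j\<close>.\<close>

lemma degree_eq_sum:
  assumes g: "g \<in> Mon d"
  shows "d = (\<Sum>j\<in>{1..d}. card {x \<in> Fs j. Q x j dvd g})"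
proof -
  have g': "degree g = d" "g \<noteq> 0" using g by (auto simp: Mon_def)
  let ?R = "{x. poly g x = 0}"
  have finR: "finite ?R" using g'(2) by (rule poly_roots_finite)
  have sub: "poly g x = 0" if "x \<in> Fs j" "Q x j dvd g" "j \<in> {1..d}" for x j
  proof -
    have "[:-x, 1:] dvd Q x j"
      unfolding Q_def using that(3) dvd_prodI[of "{..<j}" 0 "\<lambda>i. [:- (x ^ (p ^ i)), 1:]"] by simp
    then have "[:-x, 1:] dvd g" using that(2) by (rule dvd_trans)
    then show ?thesis by (simp add: poly_eq_0_iff_dvd)
  qed
  have "d = size (proots g)" using g' by (simp add: size_proots_alg_closed)
  also have "\<dots> = (\<Sum>x\<in>?R. order x g)" using g' by (simp add: size_multiset_overloaded_eq)
  also have "\<dots> = (\<Sum>x\<in>?R. card {j \<in> {1..d}. x \<in> Fs j \<and> Q x j dvd g})"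
    using order_eq_card[OF g] by (intro sum.cong) auto
  also have "\<dots> = (\<Sum>x\<in>?R. \<Sum>j\<in>{1..d}. if x \<in> Fs j \<and> Q x j dvd g then 1 else 0)"
    by (intro sum.cong refl) (simp add: sum.If_cases Int_def)
  also have "\<dots> = (\<Sum>j\<in>{1..d}. \<Sum>x\<in>?R. if x \<in> Fs j \<and> Q x j dvd g then 1 else 0)"
    by (rule sum.swap)
  also have "\<dots> = (\<Sum>j\<in>{1..d}. card {x \<in> Fs j. Q x j dvd g})"
  proof (intro sum.cong refl)
    fix j assume j: "j \<in> {1..d}"
    have "{x \<in> ?R. x \<in> Fs j \<and> Q x j dvd g} = {x \<in> Fs j. Q x j dvd g}" using sub j by auto
    then show "(\<Sum>x\<in>?R. if x \<in> Fs j \<and> Q x j dvd g then 1 else 0) = card {x \<in> Fs j. Q x j dvd g}"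
      using finR by (simp add: sum.If_cases Int_def)
  qed
  finally show ?thesis .
qed

lemma sum_multiples:
  assumes x: "x \<in> Fs j" and j: "j \<in> {1..d}"
  shows "(\<Sum>g\<in>{g \<in> Mon d. Q x j dvd g}. psi (lam g)) = psi (tr j (f x)) * A (d - j)"
proof -
  have Q: "Q x j \<in> Mon j" using x by (rule Q_Mon)
  then have Q': "Q x j \<noteq> 0" "lead_coeff (Q x j) = 1" "coeff (Q x j) 0 \<noteq> 0" by (auto simp: Mon_def)
  have "{g \<in> Mon d. Q x j dvd g} = (\<lambda>h. Q x j * h) ` Mon (d - j)"
    using Mon_divide[OF Q] Mon_mult[OF Q, of _ "d - j"] j by fastforce
  moreover have "inj_on (\<lambda>h. Q x j * h) (Mon (d - j))" using Q' by (intro inj_onI) simp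
  ultimately have "(\<Sum>g\<in>{g \<in> Mon d. Q x j dvd g}. psi (lam g)) = (\<Sum>h\<in>Mon (d - j). psi (lam (Q x j * h)))"
    by (simp add: sum.reindex)
  also have "\<dots> = (\<Sum>h\<in>Mon (d - j). psi (tr j (f x)) * psi (lam h))"
  proof (intro sum.cong refl)
    fix h assume h: "h \<in> Mon (d - j)"
    then have "lam (Q x j * h) = tr j (f x) + lam h"
      using Q' lam_Q[OF x] by (subst lam_mult) (auto simp: Mon_def)
    then show "psi (lam (Q x j * h)) = psi (tr j (f x)) * psi (lam h)"
      using tr_f_in_Fp[OF x] lam_in_Fp[OF h] by (simp add: psi_add)
  qed
  finally show ?thesis by (simp add: A_def sum_distrib_left)
qed

text \<open>The logarithmic derivative of the Euler product of the L-function whose coefficients are \<open>A\<close>.\<close>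

theorem L_recurrence: "of_nat d * A d = (\<Sum>j\<in>{1..d}. S j * A (d - j))"
proof -
  have "of_nat d * A d = (\<Sum>g\<in>Mon d. of_nat (\<Sum>j\<in>{1..d}. card {x \<in> Fs j. Q x j dvd g}) * psi (lam g))"
    unfolding A_def sum_distrib_left using degree_eq_sum by (intro sum.cong) auto
  also have "\<dots> = (\<Sum>g\<in>Mon d. \<Sum>j\<in>{1..d}. \<Sum>x\<in>Fs j. if Q x j dvd g then psi (lam g) else 0)"
    by (intro sum.cong refl) (simp add: sum_distrib_right sum.If_cases finite_Fs Int_def)
  also have "\<dots> = (\<Sum>j\<in>{1..d}. \<Sum>x\<in>Fs j. \<Sum>g\<in>Mon d. if Q x j dvd g then psi (lam g) else 0)"
    by (subst sum.swap) (intro sum.cong refl sum.swap)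
  also have "\<dots> = (\<Sum>j\<in>{1..d}. \<Sum>x\<in>Fs j. psi (tr j (f x)) * A (d - j))"
    by (intro sum.cong refl) (simp add: sum.If_cases finite_Mon Int_def flip: sum_multiples)
  also have "\<dots> = (\<Sum>j\<in>{1..d}. S j * A (d - j))"
    by (simp add: S_def sum_distrib_right)
  finally show ?thesis .
qed

text \<open>The recurrence for the \<open>S k\<close> in terms of the \<open>A d\<close> is Newton's
  recurrence up to sign, and it has only one solution because \<open>A 0 = 1\<close>.\<close>

lemma S_eq_psum: "\<exists>W. size W = 5 \<and> (\<forall>k\<ge>1. S k = - psum W k)"
proof -
  \<comment> \<open>The reversed L-polynomial is monic of degree exactly 5 even if the L-polynomial
    has smaller degree; missing inverse roots then appear in \<open>W\<close> as zeros.\<close>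
  define P :: "complex poly" where "P = (\<Sum>d\<le>5. monom (A d) (5 - d))"
  have cP: "coeff P (5 - d) = A d" if "d \<le> 5" for d
  proof -
    have "coeff P (5 - d) = (\<Sum>e\<le>5. if e = d then A e else 0)"
      unfolding P_def coeff_sum by (intro sum.cong refl) (use that in auto)
    then show ?thesis using that by simp
  qed
  have "degree P \<le> 5" unfolding P_def
    by (intro degree_sum_le) (auto intro: order.trans[OF degree_monom_le])
  moreover have lc: "coeff P 5 = 1" using cP[of 0] A_0 by simp
  ultimately have dP: "degree P = 5" by (intro antisym le_degree) auto
  have P0: "P \<noteq> 0" using lc by auto
  define W where "W = proots P"
  have "P = smult (lead_coeff P) (\<Prod>w\<in>#W. [:-w, 1:])"
    by (simp add: W_def complex_poly_decompose_multiset)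
  then have PW: "P = (\<Prod>w\<in>#W. [:-w, 1:])" using dP lc by simp
  have "reflect_poly [:-w, 1:] = [:1, -w:]" for w :: complex
    by (rule poly_eqI) (auto simp: coeff_reflect_poly coeff_pCons split: nat.splits)
  then have "reflect_poly (\<Prod>w\<in>#V. [:-w, 1:]) = char_fac V" for V
    by (induction V) (simp_all add: char_fac_def reflect_poly_mult del: mult_pCons_left)
  then have refl: "reflect_poly P = char_fac W" using PW by metis
  have cA: "coeff (char_fac W) d = A d" for d
    unfolding refl[symmetric] coeff_reflect_poly dP using cP[of d] A_eq_0[of d] by auto
  have "S k = - psum W k" if "k \<ge> 1" for k
    using that
  proof (induction k rule: less_induct)
    case (less k)
    have "(\<Sum>j\<in>{1..k}. (S j + psum W j) * A (k - j)) = 0"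
      using L_recurrence[of k] newton[of k W] by (simp add: cA distrib_right sum.distrib)
    moreover have "(\<Sum>j\<in>{1..k}. (S j + psum W j) * A (k - j)) = (\<Sum>j\<in>{k}. (S j + psum W j) * A (k - j))"
      using less by (intro sum.mono_neutral_right) auto
    ultimately show ?case by (simp add: A_0 add_eq_0_iff)
  qed
  moreover have "size W = 5" using dP by (simp add: W_def size_proots_complex)
  ultimately show ?thesis by blast
qed

theorem norm_S1_le: "norm (S 1) \<le> 5 * sqrt (real p)"
proof -
  obtain W where W: "size W = 5" "\<And>k. k \<ge> 1 \<Longrightarrow> S k = - psum W k" using S_eq_psum by blast
  \<comment> \<open>Stepanov controls only the even orders \<open>2 * r\<close>, so the numbers are
    squared; dividing by \<open>p\<close> turns the bound of size \<open>p ^ r\<close> into a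
    bounded sequence of power sums.\<close>
  define V where "V = image_mset (\<lambda>w. w ^ 2 / of_nat p) W"
  define C where "C = real (p * (C0 + 2 * p + 7) + 1)"
  have "norm (\<Sum>y\<in>set_mset V. of_nat (count V y) * y ^ r) \<le> C" if r: "r \<ge> 4" for r
  proof -
    have "(\<Sum>y\<in>set_mset V. of_nat (count V y) * y ^ r) = psum V r"
      unfolding psum_def by (rule sum_count_mset) auto
    also have "\<dots> = psum W (2 * r) / of_nat p ^ r"
    proof -
      have "psum (image_mset (\<lambda>w. w ^ 2 / of_nat p) U) r = psum U (2 * r) / of_nat p ^ r" for U
        by (induction U) (simp_all add: psum_def power_divide add_divide_distrib power_mult)
      then show ?thesis by (simp only: V_def)
    qed
    also have "norm \<dots> = norm (S (2 * r)) / real p ^ r"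
      using W(2)[of "2 * r"] r by (simp add: norm_divide norm_power)
    also have "\<dots> \<le> C" using S_bound[OF r] p_pos by (simp add: C_def field_simps)
    finally show ?thesis .
  qed
  then have V: "norm z \<le> 1" if "z \<in># V" for z
    using bounded_power_sum_imp_norm_le_1[of "set_mset V" z "\<lambda>y. of_nat (count V y)" 4 C] that by simp
  have w: "norm w \<le> sqrt (real p)" if "w \<in># W" for w
  proof -
    have "norm (w ^ 2 / of_nat p) \<le> 1" using that by (intro V) (auto simp: V_def)
    then have "norm w ^ 2 \<le> real p" using p_pos by (simp add: norm_divide norm_power divide_le_eq)
    then show ?thesis by (simp add: real_le_rsqrt)
  qed
  have "norm (psum U 1) \<le> real (size U) * sqrt (real p)" if "\<And>w. w \<in># U \<Longrightarrow> norm w \<le> sqrt (real p)" for U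
    using that
  proof (induction U)
    case (add w U)
    have "norm (w + psum U 1) \<le> norm w + norm (psum U 1)" by (rule norm_triangle_ineq)
    also have "\<dots> \<le> sqrt (real p) + real (size U) * sqrt (real p)" using add by (intro add_mono) auto
    finally show ?case by (simp add: psum_def algebra_simps)
  qed (simp add: psum_def)
  from this[of W] w W show ?thesis by simp
qed

section \<open>From the Weil sum back to \<open>ES\<close>\<close>

lemma S1_eq: "S 1 = (\<Sum>x\<in>Fs 1. psi (f x))"
  by (simp add: S_def tr_def)

lemma of_int_eq_iff: "(of_int i :: 'k) = of_int j \<longleftrightarrow> [i = j] (mod int p)"
  by (simp add: of_int_eq_iff_cong_CHAR char_p)

lemma of_int_eq_of_nat: "(of_int k :: 'k) = of_nat (nat (k mod int p))"
proof -
  have "(of_int k :: 'k) = of_int (k mod int p)" by (simp only: of_int_eq_iff) (simp add: cong_def)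
  then show ?thesis using p_pos by simp
qed

lemma of_int_in_Fp: "of_int k \<in> Fp"
  by (simp only: of_int_eq_of_nat of_nat_in_Fp)

lemma psi_of_int: "psi (of_int k) = char_mod p k"
proof -
  have "psi (of_int k) = char_mod p (int (nat (k mod int p)))"
    by (simp only: of_int_eq_of_nat psi_of_nat)
  also have "\<dots> = char_mod p k"
    using p_pos by (intro char_mod_cong) (auto simp: cong_def)
  finally show ?thesis .
qed

lemma Fp_cases_int: assumes "x \<in> Fp" obtains i where "i \<in> {0..<int p}" "x = of_int i"
proof -
  obtain j where "j < p" "x = of_nat j" using Fp_cases[OF assms] by blast
  then show ?thesis using that[of "int j"] by simp
qed

text \<open>With \<open>t = a * b\<close> one has \<open>a = t ^ 3 / l\<close> and
  \<open>b = l / t ^ 2\<close> in the prime field, so the phase \<open>u * a + v * b\<close> becomes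
  \<open>f t\<close> for these \<open>m\<close> and \<open>n\<close>.\<close>

lemma ES_eq_S1:
  fixes u v l :: int
  assumes m: "m = of_int u / of_int l" and n: "n = of_int v * of_int l" and l: "\<not> int p dvd l"
  shows "ES p l u v = S 1"
proof -
  define L where "L = (of_int l :: 'k)"
  have L: "L \<noteq> 0" using l of_int_eq_iff[of l 0] by (simp add: L_def cong_0_iff)
  define h where "h = (\<lambda>(a, b). of_int (a * b) :: 'k)"
  have sol: "h (a, b) \<in> Fs 1" "of_int b = L / h (a, b) ^ 2" "of_int a = h (a, b) ^ 3 / L"
    "f (h (a, b)) = of_int (u * a + v * b)" if "(a, b) \<in> sols p l" for a b
  proof -
    have "(of_int (a ^ 2 * b ^ 3) :: 'k) = of_int l" 
      using that by (simp only: of_int_eq_iff) (simp add: sols_def)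
    then have e: "(of_int a)\<^sup>2 * (of_int b) ^ 3 = L" by (simp add: L_def)
    then have nz: "(of_int a :: 'k) \<noteq> 0" "(of_int b :: 'k) \<noteq> 0" using L by auto
    have h: "h (a, b) = of_int a * of_int b" by (simp add: h_def)
    have "(of_int k :: 'k) ^ p = of_int k" for k
      using of_int_in_Fp[of k] by (simp add: Fp_def)
    then show "h (a, b) \<in> Fs 1" using nz by (simp add: h Fs_def power_mult_distrib)
    show b: "of_int b = L / h (a, b) ^ 2" unfolding h e[symmetric] using nz
      by (simp add: field_simps power2_eq_square power3_eq_cube)
    show a: "of_int a = h (a, b) ^ 3 / L" unfolding h e[symmetric] using nz
      by (simp add: field_simps power2_eq_square power3_eq_cube)
    have "f (h (a, b)) = of_int u * (h (a, b) ^ 3 / L) + of_int v * (L / h (a, b) ^ 2)"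
      unfolding f_def unfolding m n L_def by (simp add: divide_inverse power_inverse mult_ac)
    then show "f (h (a, b)) = of_int (u * a + v * b)" unfolding a[symmetric] b[symmetric] by simp
  qed
  have "bij_betw h (sols p l) (Fs 1)"
    unfolding bij_betw_def
  proof
    show "inj_on h (sols p l)"
    proof (rule inj_onI)
      fix s s' assume s: "s \<in> sols p l" "s' \<in> sols p l" "h s = h s'"
      obtain a b a' b' where ab: "s = (a, b)" "s' = (a', b')" by (cases s, cases s')
      have "(of_int b :: 'k) = of_int b'" "(of_int a :: 'k) = of_int a'"
        using sol(2,3)[of a b] sol(2,3)[of a' b'] s ab by auto
      then show "s = s'" using s ab by (auto simp: of_int_eq_iff sols_def cong_def)
    qed
    show "h ` sols p l = Fs 1"
    proof (intro equalityI subsetI)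
      fix x assume "x \<in> Fs 1"
      then have x: "x \<noteq> 0" "x \<in> Fp" by (auto simp: Fs_def Fp_def)
      have "L \<in> Fp" unfolding L_def by (rule of_int_in_Fp)
      then have "L / x ^ 2 \<in> Fp" "x ^ 3 / L \<in> Fp" using x by (auto intro!: Fp_closed)
      then obtain a b where b: "b \<in> {0..<int p}" "L / x ^ 2 = of_int b"
        and a: "a \<in> {0..<int p}" "x ^ 3 / L = of_int a" by (metis Fp_cases_int)
      have "of_int (a ^ 2 * b ^ 3) = (x ^ 3 / L) ^ 2 * (L / x ^ 2) ^ 3" by (simp add: a b)
      also have "\<dots> = L" using x L by (simp add: field_simps power2_eq_square power3_eq_cube)
      finally have "(a, b) \<in> sols p l" using a b by (simp add: sols_def L_def of_int_eq_iff del: of_int_mult of_int_power)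
      moreover have "h (a, b) = x"
        unfolding h_def using x L by (simp flip: a b) (simp add: field_simps power2_eq_square power3_eq_cube)
      ultimately show "x \<in> h ` sols p l" by force
    qed (use sol(1) in auto)
  qed
  then have "S 1 = (\<Sum>s\<in>sols p l. psi (f (h s)))"
    unfolding S1_eq by (rule sum.reindex_bij_betw[symmetric])
  also have "\<dots> = ES p l u v"
    unfolding ES_def using sol(4) by (intro sum.cong refl) (auto simp: psi_of_int simp del: of_int_add of_int_mult)
  finally show ?thesis by simp
qed

end

text \<open>The algebraic closure of the field of residues serves as ambient field; integers are
  fixed by Frobenius there, so the coefficients formed from \<open>u\<close>, \<open>v\<close> and
  \<open>l\<close> are admissible.\<close>

lemma weil_at_card:
  assumes "CARD('a::prime_card) > 3"
  shows "weil_at CARD('a)"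
  unfolding weil_at_def
proof (intro allI impI)
  fix u v l :: int
  assume u: "\<not> int CARD('a) dvd u" and l: "\<not> int CARD('a) dvd l"
  have CH: "CHAR('a mod_ring alg_closure) = CARD('a)"
  proof -
    have "CHAR('a mod_ring) = CARD('a)"
    proof (rule CHAR_eqI)
      show "of_nat CARD('a) = (0 :: 'a mod_ring)" by simp
      fix x assume "of_nat x = (0 :: 'a mod_ring)"
      then show "CARD('a) dvd x"
        by (simp add: of_nat_of_int_mod_ring) (transfer, simp add: zmod_int[symmetric] mod_eq_0_iff_dvd)
    qed
    then show ?thesis by simp
  qed
  have pr: "prime CARD('a)" by (rule prime_card)
  have nz: "(of_int u :: 'a mod_ring alg_closure) \<noteq> 0" "(of_int l :: 'a mod_ring alg_closure) \<noteq> 0"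
    using u l of_int_eq_iff_cong_CHAR[of u 0, where 'a = "'a mod_ring alg_closure"] of_int_eq_iff_cong_CHAR[of l 0, where 'a = "'a mod_ring alg_closure"]
    by (auto simp: CH cong_0_iff)
  have frob: "(of_int k :: 'a mod_ring alg_closure) ^ CARD('a) = of_int k" for k
  proof -
    have "(of_nat k :: 'a mod_ring alg_closure) ^ CARD('a) = of_nat k" for k
      using pr by (induction k) (auto simp: freshmans_dream CH)
    moreover have "(of_int k :: 'a mod_ring alg_closure) = of_nat (nat (k mod int CARD('a)))"
    proof -
      have "(of_int k :: 'a mod_ring alg_closure) = of_int (k mod int CARD('a))"
        by (subst of_int_eq_iff_cong_CHAR) (simp add: CH cong_def)
      then show ?thesis by simp
    qed
    ultimately show ?thesis by metis
  qed
  interpret laurent_sum "CARD('a)" "of_int u / of_int l :: 'a mod_ring alg_closure" "of_int v * of_int l"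
    by unfold_locales (use pr assms CH nz frob in \<open>auto simp: power_divide power_mult_distrib\<close>)
  show "norm (ES CARD('a) l u v) \<le> 5 * sqrt (real CARD('a))"
    using norm_S1_le ES_eq_S1[OF refl refl l] by simp
qed

text \<open>\<open>weil_at_card\<close> only covers primes that are the cardinality of a type. A type cannot depend on a
  value, but it may depend on a closed term: take the prime to be a counterexample, if there is one.\<close>

definition bad_prime :: nat where
  "bad_prime = (if \<exists>p>3. prime p \<and> \<not> weil_at p then SOME p. p > 3 \<and> prime p \<and> \<not> weil_at p else 5)"

lemma bad_prime: "bad_prime > 3" "prime bad_prime"
proof -
  have "bad_prime > 3 \<and> prime bad_prime"
  proof (cases "\<exists>p>3. prime p \<and> \<not> weil_at p")
    case True
    then show ?thesis unfolding bad_prime_def using someI_ex[of "\<lambda>p. p > 3 \<and> prime p \<and> \<not> weil_at p"] by auto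
  qed (auto simp: bad_prime_def)
  then show "bad_prime > 3" "prime bad_prime" by auto
qed

typedef exceptional = "{0..<bad_prime}"
  using bad_prime by (intro exI[of _ 0]) auto

lemma card_exceptional: "CARD(exceptional) = bad_prime"
  using type_definition.card[OF type_definition_exceptional] by simp

instance exceptional :: prime_card
  by standard (simp add: card_exceptional bad_prime)

theorem weil_bound:
  assumes "prime p" "p > 3" shows "weil_at p"
proof (rule ccontr)
  assume "\<not> weil_at p"
  then have ex: "\<exists>p. p > 3 \<and> prime p \<and> \<not> weil_at p" using assms by blast
  then have "bad_prime = (SOME p. p > 3 \<and> prime p \<and> \<not> weil_at p)" by (auto simp: bad_prime_def)
  then have "\<not> weil_at bad_prime" using someI_ex[OF ex] by simp
  moreover have "weil_at bad_prime" using weil_at_card[where 'a = exceptional] bad_prime by (simp add: card_exceptional)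
  ultimately show False by simp
qed

section \<open>Exponential sums to composite moduli\<close>

lemma int_div_less:
  fixes m n x :: int
  assumes "m > 0" "x < n * m" shows "x div m < n"
proof -
  have "x < m * n" using assms(2) by (simp only: mult.commute)
  then have "m * (x div m) < m * n"
    using mult_div_mod_eq[of m x] pos_mod_sign[OF assms(1), of x] by linarith
  then show ?thesis using assms(1) by simp
qed

section \<open>Solutions modulo \<open>q\<close>, lifting and multiplicativity\<close>

definition units_mod :: "nat \<Rightarrow> int set" where
  "units_mod q = {t \<in> {0..<int q}. coprime t (int q)}"

lemma finite_units_mod [simp]: "finite (units_mod q)"
  unfolding units_mod_def by (rule finite_subset[of _ "{0..<int q}"]) auto

lemma card_units_mod: assumes "q > 0" shows "card (units_mod q) = totient q"
proof (cases "q = 1")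
  case True
  then have "units_mod q = {0}" by (auto simp: units_mod_def)
  then show ?thesis using True by simp
next
  case False
  have "units_mod q = int ` totatives q"
  proof (intro equalityI subsetI)
    fix t assume t: "t \<in> units_mod q"
    then have "t \<noteq> 0" using False assms by (auto simp: units_mod_def)
    then have "nat t \<in> totatives q" "t = int (nat t)"
      using t by (auto simp: units_mod_def in_totatives_iff simp flip: coprime_int_iff)
    then show "t \<in> int ` totatives q" by blast
  next
    fix t assume "t \<in> int ` totatives q"
    then obtain k where "t = int k" "k \<in> totatives q" by auto
    moreover from this have "k < q" using totatives_less[of k q] False assms by auto
    ultimately show "t \<in> units_mod q" by (auto simp: units_mod_def in_totatives_iff)
  qed
  then show ?thesis by (simp add: card_image totient_def)
qed

context
  fixes q :: nat and l :: int
  assumes q: "q > 0" and l: "coprime l (int q)"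
begin

lemma sols_coprime: 
  assumes "[a ^ 2 * b ^ 3 = l] (mod int q)" shows "coprime a (int q)" "coprime b (int q)"
proof -
  have "coprime (a ^ 2 * b ^ 3) (int q)" using cong_imp_coprime[OF cong_sym[OF assms] l] .
  then show "coprime a (int q)" "coprime b (int q)" by auto
qed

text \<open>A solution is determined by \<open>t = a b\<close>, because \<open>t\<^sup>2 b = l\<close> and \<open>a l = t\<^sup>3\<close>.\<close>

lemma sols_cong_unique:
  assumes 1: "[a ^ 2 * b ^ 3 = l] (mod int q)" and 2: "[a' ^ 2 * b' ^ 3 = l] (mod int q)"
    and t: "[a * b = a' * b'] (mod int q)"
  shows "[a = a'] (mod int q)" "[b = b'] (mod int q)"
proof -
  have "[(a * b) ^ 2 * b = l] (mod int q)" "[(a' * b') ^ 2 * b' = l] (mod int q)"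
  proof -
    have "(x * y) ^ 2 * y = x ^ 2 * y ^ 3" for x y :: int
      by (simp add: power2_eq_square power3_eq_cube)
    then show "[(a * b) ^ 2 * b = l] (mod int q)" "[(a' * b') ^ 2 * b' = l] (mod int q)" using 1 2 by simp_all
  qed
  moreover have "[(a * b) ^ 2 * b' = (a' * b') ^ 2 * b'] (mod int q)"
    by (rule cong_mult[OF cong_pow[OF t] cong_refl])
  ultimately have "[(a * b) ^ 2 * b = (a * b) ^ 2 * b'] (mod int q)"
    by (meson cong_sym cong_trans)
  moreover have "coprime ((a * b) ^ 2) (int q)" using sols_coprime[OF 1] by simp
  ultimately show b: "[b = b'] (mod int q)" by (simp add: cong_mult_lcancel)
  have "[a' * b' = a' * b] (mod int q)" using b by (intro cong_mult) (auto intro: cong_sym)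
  then have "[a * b = a' * b] (mod int q)" using t by (rule cong_trans[rotated])
  then show "[a = a'] (mod int q)" using sols_coprime(2)[OF 1] by (simp add: cong_mult_rcancel)
qed

lemma mod_in_sols: "[a ^ 2 * b ^ 3 = l] (mod int q) \<Longrightarrow> (a mod int q, b mod int q) \<in> sols q l"
proof -
  assume "[a ^ 2 * b ^ 3 = l] (mod int q)"
  moreover have "[(a mod int q) ^ 2 * (b mod int q) ^ 3 = a ^ 2 * b ^ 3] (mod int q)"
    by (intro cong_mult cong_pow) auto
  ultimately show ?thesis using q cong_trans by (auto simp: sols_def)
qed

lemma bij_sols: "bij_betw (\<lambda>(a, b). (a * b) mod int q) (sols q l) (units_mod q)"
  unfolding bij_betw_def
proof
  show "inj_on (\<lambda>(a, b). (a * b) mod int q) (sols q l)"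
  proof (rule inj_onI, clarsimp)
    fix a b a' b' assume s: "(a, b) \<in> sols q l" "(a', b') \<in> sols q l" "(a * b) mod int q = (a' * b') mod int q"
    then have "[a = a'] (mod int q)" "[b = b'] (mod int q)"
      using sols_cong_unique[of a b a' b'] by (auto simp: sols_def cong_def)
    then show "a = a' \<and> b = b'" using s by (auto simp: sols_def intro: cong_less_imp_eq_int)
  qed
  show "(\<lambda>(a, b). (a * b) mod int q) ` sols q l = units_mod q"
  proof (intro equalityI subsetI)
    fix t assume "t \<in> (\<lambda>(a, b). (a * b) mod int q) ` sols q l"
    then show "t \<in> units_mod q"
      using sols_coprime q by (auto simp: sols_def units_mod_def)
  next
    fix t assume t: "t \<in> units_mod q"
    then have "coprime t (int q)" by (simp add: units_mod_def)
    then obtain s where s: "[t * s = 1] (mod int q)" using cong_solve_coprime_int by blast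
    obtain k where k: "[l * k = 1] (mod int q)" using cong_solve_coprime_int[OF l] by blast
    \<comment> \<open>With \<open>s\<close> inverse to \<open>t\<close> and \<open>k\<close> inverse
      to \<open>l\<close>, these are \<open>t ^ 3 / l\<close> and \<open>l / t ^ 2\<close>, the
      values forced by \<open>t = a * b\<close>.\<close>
    define a where "a = t ^ 3 * k"
    define b where "b = l * s ^ 2"
    have "a ^ 2 * b ^ 3 = (t * s) ^ 6 * (l * k) ^ 2 * l"
      by (simp add: a_def b_def power_mult_distrib eval_nat_numeral algebra_simps)
    also have "[\<dots> = 1 ^ 6 * 1 ^ 2 * l] (mod int q)" by (intro cong_mult cong_pow s k cong_refl)
    finally have sol: "[a ^ 2 * b ^ 3 = l] (mod int q)" by simp
    have "a * b = (t * s) ^ 2 * (l * k) * t"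
      by (simp add: a_def b_def eval_nat_numeral algebra_simps)
    also have "[\<dots> = 1 ^ 2 * 1 * t] (mod int q)" by (intro cong_mult cong_pow s k cong_refl)
    finally have ab: "[a * b = t] (mod int q)" by simp
    have "((a mod int q) * (b mod int q)) mod int q = t"
      using ab t by (auto simp: mod_mult_eq cong_def units_mod_def)
    then show "t \<in> (\<lambda>(a, b). (a * b) mod int q) ` sols q l"
      using mod_in_sols[OF sol] by force
  qed
qed

lemma card_sols: "card (sols q l) = totient q"
  using bij_betw_same_card[OF bij_sols] card_units_mod[OF q] by simp

lemma norm_ES_le_totient: "norm (ES q l u v) \<le> totient q"
proof -
  have "norm (ES q l u v) \<le> (\<Sum>x\<in>sols q l. 1)"
    unfolding ES_def by (intro sum_norm_le) auto
  then show ?thesis by (simp add: card_sols)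
qed

lemma ES_0: "int q dvd u \<Longrightarrow> int q dvd v \<Longrightarrow> ES q l u v = of_nat (totient q)"
proof -
  assume "int q dvd u" "int q dvd v"
  then obtain u' v' where "u = int q * u'" "v = int q * v'" by (elim dvdE)
  then have "u * a + v * b = int q * (u' * a + v' * b)" for a b by (simp add: algebra_simps)
  then show ?thesis using q by (simp add: ES_def char_mod_mult_self card_sols case_prod_unfold)
qed

end

text \<open>Both frequencies contain \<open>d\<close>, so the phase depends only on the solution
  modulo \<open>q'\<close>. Each such solution has exactly \<open>d\<close> lifts: through
  \<open>a * b\<close> they correspond to the lifts of a unit, and \<open>rad\<close> makes every
  lift a unit again.\<close>

lemma ES_reduce:
  fixes d q' :: nat
  assumes d: "d > 0" "q' > 0" and rad: "\<And>x :: int. coprime x (int q') \<Longrightarrow> coprime x (int (d * q'))"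
    and l: "coprime l (int (d * q'))"
  shows "ES (d * q') l (int d * u) (int d * v) = of_nat d * ES q' l u v"
proof -
  define q where "q = d * q'"
  define \<rho> where "\<rho> = (\<lambda>(a, b). (a mod int q', b mod int q'))"
  have q: "q > 0" and lq: "coprime l (int q)" and lq': "coprime l (int q')"
    using d l by (simp_all add: q_def)
  have dvd: "int q' dvd int q" by (simp add: q_def)
  have down: "[a ^ 2 * b ^ 3 = l] (mod int q')" if "[a ^ 2 * b ^ 3 = l] (mod int q)" for a b
    using that dvd by (rule cong_dvd_modulus)
  have \<rho>: "\<rho> x \<in> sols q' l" if "x \<in> sols q l" for x
    using that mod_in_sols[OF d(2) lq'] down by (cases x) (auto simp: sols_def \<rho>_def)
  have fiber: "card {x \<in> sols q l. \<rho> x = y} = d" if y: "y \<in> sols q' l" for y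
  proof -
    obtain a0 b0 where ab0: "y = (a0, b0)" by (cases y)
    have s0: "[a0 ^ 2 * b0 ^ 3 = l] (mod int q')" "a0 mod int q' = a0" "b0 mod int q' = b0"
      using y ab0 by (auto simp: sols_def)
    define t0 where "t0 = (a0 * b0) mod int q'"
    have t0: "0 \<le> t0" "t0 < int q'" using d by (auto simp: t0_def)
    have copt0: "coprime t0 (int q')" using sols_coprime[OF d(2) lq' s0(1)] using d(2) by (simp add: t0_def coprime_mod_left_iff)
    let ?h = "\<lambda>(a, b). (a * b) mod int q"
    let ?T = "{t \<in> {0..<int q}. t mod int q' = t0}"
    have "bij_betw ?h {x \<in> sols q l. \<rho> x = y} ?T"
      unfolding bij_betw_def
    proof
      show "inj_on ?h {x \<in> sols q l. \<rho> x = y}"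
        using bij_sols[OF q lq] by (rule inj_on_subset[OF bij_betw_imp_inj_on]) auto
      show "?h ` {x \<in> sols q l. \<rho> x = y} = ?T"
      proof (intro equalityI subsetI)
        fix t assume "t \<in> ?h ` {x \<in> sols q l. \<rho> x = y}"
        then obtain a b where ab: "(a, b) \<in> sols q l" "\<rho> (a, b) = y" "t = (a * b) mod int q" by auto
        have "t mod int q' = (a * b) mod int q'" using ab dvd by (simp add: mod_mod_cancel)
        also have "\<dots> = t0" using ab ab0 by (auto simp: \<rho>_def t0_def mod_mult_eq)
        finally show "t \<in> ?T" using ab q by simp
      next
        fix t assume t: "t \<in> ?T"
        then have "coprime t (int q')" using copt0 d(2) coprime_mod_left_iff[of "int q'" t] by auto
        then have "t \<in> units_mod q" using rad t by (simp add: units_mod_def q_def)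
        then obtain a b where ab: "(a, b) \<in> sols q l" "t = (a * b) mod int q"
          using bij_sols[OF q lq] unfolding bij_betw_def by fastforce
        have sab: "[a ^ 2 * b ^ 3 = l] (mod int q')" using ab down by (auto simp: sols_def)
        have "(a * b) mod int q' = t mod int q'" using ab dvd by (simp add: mod_mod_cancel)
        then have "[a * b = a0 * b0] (mod int q')" using t by (simp add: cong_def t0_def)
        from sols_cong_unique[OF d(2) lq' sab s0(1) this] have "\<rho> (a, b) = y"
          using ab0 s0 by (simp add: \<rho>_def cong_def)
        then show "t \<in> ?h ` {x \<in> sols q l. \<rho> x = y}" using ab by force
      qed
    qed
    then have "card {x \<in> sols q l. \<rho> x = y} = card ?T" by (rule bij_betw_same_card)
    also have "?T = (\<lambda>k. t0 + int q' * int k) ` {..<d}"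
    proof (intro equalityI subsetI)
      fix t assume t: "t \<in> ?T"
      then have "t = t0 + int q' * (t div int q')" using mult_div_mod_eq[of "int q'" t] by auto
      moreover have "0 \<le> t div int q'" using t d by (simp add: pos_imp_zdiv_nonneg_iff)
      moreover have "t div int q' < int d" using t d by (intro int_div_less) (auto simp: q_def)
      ultimately show "t \<in> (\<lambda>k. t0 + int q' * int k) ` {..<d}"
        by (intro image_eqI[of _ _ "nat (t div int q')"]) auto
    next
      fix t assume "t \<in> (\<lambda>k. t0 + int q' * int k) ` {..<d}"
      then obtain k where k: "k < d" "t = t0 + int q' * int k" by auto
      have "t < int q' * (int k + 1)" using t0 k by (simp add: algebra_simps)
      also have "\<dots> \<le> int q' * int d" using k by (intro mult_left_mono) auto
      finally have "t < int q" by (simp add: q_def mult.commute)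
      then show "t \<in> ?T" using k t0 by simp
    qed
    also have "card \<dots> = d" using d by (subst card_image) (auto simp: inj_on_def)
    finally show ?thesis .
  qed
  define F where "F = (\<lambda>(a, b). char_mod q' (u * a + v * b))"
  have "ES q l (int d * u) (int d * v) = (\<Sum>x\<in>sols q l. F (\<rho> x))"
    unfolding ES_def
  proof (intro sum.cong refl)
    fix x assume x: "x \<in> sols q l"
    obtain a b where ab: "x = (a, b)" by (cases x)
    have "char_mod q (int d * u * a + int d * v * b) = char_mod (d * q') (int d * (u * a + v * b))"
      by (simp add: q_def algebra_simps)
    also have "\<dots> = char_mod q' (u * a + v * b)" by (rule char_mod_scale[OF d(1)])
    also have "\<dots> = char_mod q' (u * (a mod int q') + v * (b mod int q'))"
      by (rule char_mod_cong[OF d(2)]) (intro cong_add cong_mult; simp)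
    finally show "(case x of (a, b) \<Rightarrow> char_mod q (int d * u * a + int d * v * b)) = F (\<rho> x)"
      by (simp add: ab \<rho>_def F_def)
  qed
  also have "\<dots> = (\<Sum>y\<in>sols q' l. \<Sum>x\<in>{x \<in> sols q l. \<rho> x = y}. F (\<rho> x))"
    by (rule sum.group[symmetric]) (auto simp: \<rho>)
  also have "\<dots> = (\<Sum>y\<in>sols q' l. of_nat d * F y)"
  proof (intro sum.cong refl)
    fix y assume y: "y \<in> sols q' l"
    have "(\<Sum>x\<in>{x \<in> sols q l. \<rho> x = y}. F (\<rho> x)) = (\<Sum>x\<in>{x \<in> sols q l. \<rho> x = y}. F y)"
      by (intro sum.cong) auto
    then show "(\<Sum>x\<in>{x \<in> sols q l. \<rho> x = y}. F (\<rho> x)) = of_nat d * F y" by (simp add: fiber[OF y])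
  qed
  also have "\<dots> = of_nat d * ES q' l u v" unfolding ES_def F_def by (simp add: sum_distrib_left)
  finally show ?thesis by (simp add: q_def)
qed

text \<open>Chinese remaindering. The congruence \<open>q2 * r2 + q1 * r1 = 1\<close> modulo
  \<open>q1 * q2\<close> splits the phase, at the price of multiplying the frequencies by the
  inverses \<open>r2\<close> and \<open>r1\<close>. That every pair of solutions arises follows by
  counting, as the totient is multiplicative.\<close>

lemma ES_mult:
  fixes q1 q2 :: nat
  assumes q: "q1 > 0" "q2 > 0" "coprime q1 q2" and l: "coprime l (int (q1 * q2))"
    and r2: "[int q2 * r2 = 1] (mod int q1)" and r1: "[int q1 * r1 = 1] (mod int q2)"
  shows "ES (q1 * q2) l u v = ES q1 l (u * r2) (v * r2) * ES q2 l (u * r1) (v * r1)"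
proof -
  have l12: "coprime l (int q1)" "coprime l (int q2)" using l by auto
  define h where "h = (\<lambda>(a, b). ((a mod int q1, b mod int q1), (a mod int q2, b mod int q2)))"
  have cop: "coprime (int q1) (int q2)" using q by simp
  have "inj_on h (sols (q1 * q2) l)"
  proof (rule inj_onI)
    fix x y assume x: "x \<in> sols (q1 * q2) l" "y \<in> sols (q1 * q2) l" "h x = h y"
    obtain a b a' b' where ab: "x = (a, b)" "y = (a', b')" by (cases x, cases y)
    have "[a = a'] (mod int q1 * int q2)" "[b = b'] (mod int q1 * int q2)"
      using x ab cop by (auto simp: h_def cong_def intro!: coprime_cong_mult[unfolded cong_def])
    then show "x = y" using x ab by (auto simp: sols_def intro: cong_less_imp_eq_int)
  qed
  moreover have "h ` sols (q1 * q2) l \<subseteq> sols q1 l \<times> sols q2 l"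
  proof (clarsimp simp: h_def)
    fix a b assume "(a, b) \<in> sols (q1 * q2) l"
    then have "[a ^ 2 * b ^ 3 = l] (mod int q1 * int q2)" by (auto simp: sols_def)
    then have "[a ^ 2 * b ^ 3 = l] (mod int q1)" "[a ^ 2 * b ^ 3 = l] (mod int q2)"
      by (auto elim: cong_dvd_modulus)
    then show "(a mod int q1, b mod int q1) \<in> sols q1 l \<and> (a mod int q2, b mod int q2) \<in> sols q2 l"
      using mod_in_sols q l12 by blast
  qed
  moreover have "card (sols (q1 * q2) l) = card (sols q1 l \<times> sols q2 l)"
    using q l l12 by (simp add: card_sols totient_mult_coprime)
  ultimately have bij: "bij_betw h (sols (q1 * q2) l) (sols q1 l \<times> sols q2 l)"
    unfolding bij_betw_def by (metis card_image card_subset_eq finite_SigmaI finite_sols)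
  have phase: "char_mod (q1 * q2) (u * a + v * b) =
     char_mod q1 (u * r2 * (a mod int q1) + v * r2 * (b mod int q1)) *
     char_mod q2 (u * r1 * (a mod int q2) + v * r1 * (b mod int q2))" for a b
  proof -
    define x where "x = u * a + v * b"
    have "[int q2 * r2 + int q1 * r1 = 1 + 0] (mod int q1)" using r2 by (intro cong_add) (auto simp: cong_0_iff)
    moreover have "[int q2 * r2 + int q1 * r1 = 0 + 1] (mod int q2)" using r1 by (intro cong_add) (auto simp: cong_0_iff)
    ultimately have "[int q2 * r2 + int q1 * r1 = 1] (mod int q1 * int q2)"
      using cop by (intro coprime_cong_mult) auto
    then have "[(int q2 * r2 + int q1 * r1) * x = 1 * x] (mod int q1 * int q2)" by (intro cong_mult) auto
    then have "char_mod (q1 * q2) x = char_mod (q1 * q2) (int q2 * (r2 * x) + int q1 * (r1 * x))"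
      using q by (intro char_mod_cong) (auto simp: algebra_simps cong_sym)
    also have "\<dots> = char_mod (q2 * q1) (int q2 * (r2 * x)) * char_mod (q1 * q2) (int q1 * (r1 * x))"
      by (simp add: char_mod_add mult.commute)
    also have "\<dots> = char_mod q1 (r2 * x) * char_mod q2 (r1 * x)"
      using q by (simp only: char_mod_scale)
    also have "r2 * x = u * r2 * a + v * r2 * b" by (simp add: x_def algebra_simps)
    also have "char_mod q1 (u * r2 * a + v * r2 * b) = char_mod q1 (u * r2 * (a mod int q1) + v * r2 * (b mod int q1))"
      by (rule char_mod_cong[OF q(1)]) (intro cong_add cong_mult; simp)
    also have "r1 * x = u * r1 * a + v * r1 * b" by (simp add: x_def algebra_simps)
    also have "char_mod q2 (u * r1 * a + v * r1 * b) = char_mod q2 (u * r1 * (a mod int q2) + v * r1 * (b mod int q2))"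
      by (rule char_mod_cong[OF q(2)]) (intro cong_add cong_mult; simp)
    finally show ?thesis by (simp add: x_def)
  qed
  define F where "F = (\<lambda>(a, b). char_mod q1 (u * r2 * a + v * r2 * b))"
  define G where "G = (\<lambda>(a, b). char_mod q2 (u * r1 * a + v * r1 * b))"
  have "ES q1 l (u * r2) (v * r2) * ES q2 l (u * r1) (v * r1) =
    (\<Sum>(x, y)\<in>sols q1 l \<times> sols q2 l. F x * G y)"
    unfolding ES_def F_def G_def by (simp add: sum_product sum.cartesian_product)
  also have "\<dots> = (\<Sum>z\<in>sols (q1 * q2) l. (\<lambda>(x, y). F x * G y) (h z))"
    using bij by (rule sum.reindex_bij_betw[symmetric])
  also have "\<dots> = ES (q1 * q2) l u v"
    unfolding ES_def by (intro sum.cong refl) (auto simp: h_def phase F_def G_def)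
  finally show ?thesis by simp
qed

section \<open>Counting in residue classes, averaging, and Gauss sums\<close>

lemma card_cong_class_le:
  fixes M N :: nat
  assumes "A \<subseteq> {0..<int (M * N)}" "M > 0" "\<And>x y. x \<in> A \<Longrightarrow> y \<in> A \<Longrightarrow> [x = y] (mod int M)"
  shows "card A \<le> N"
proof -
  have "inj_on (\<lambda>x. x div int M) A"
  proof (rule inj_onI)
    fix x y assume xy: "x \<in> A" "y \<in> A" "x div int M = y div int M"
    then have m: "x mod int M = y mod int M" using assms(3)[of x y] by (simp add: cong_def)
    have "x = int M * (x div int M) + x mod int M" by (rule mult_div_mod_eq[symmetric])
    also have "\<dots> = int M * (y div int M) + y mod int M" by (simp only: m xy(3))
    also have "\<dots> = y" by (rule mult_div_mod_eq)
    finally show "x = y" .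
  qed
  moreover have "(\<lambda>x. x div int M) ` A \<subseteq> {0..<int N}"
  proof
    fix y assume "y \<in> (\<lambda>x. x div int M) ` A"
    then obtain x where "x \<in> A" "y = x div int M" by auto
    moreover from this have "0 \<le> x" "x < int N * int M" using assms(1) by (auto simp: mult.commute)
    ultimately show "y \<in> {0..<int N}" using assms(2) by (simp add: pos_imp_zdiv_nonneg_iff int_div_less)
  qed
  ultimately have "card A \<le> card {0..<int N}" by (intro card_inj_on_le) auto
  then show ?thesis by simp
qed

lemma card_le_fibers:
  assumes "finite A" "\<And>r. r \<in> g ` A \<Longrightarrow> card {x \<in> A. g x = r} \<le> N" "card (g ` A) \<le> R"
  shows "card A \<le> R * N"
proof -
  have "card A = (\<Sum>r\<in>g ` A. card {x \<in> A. g x = r})"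
    unfolding card_eq_sum using assms(1) by (intro sum.group[symmetric]) auto
  also have "\<dots> \<le> (\<Sum>r\<in>g ` A. N)" by (intro sum_mono assms(2))
  also have "\<dots> \<le> R * N" using assms(3) by simp
  finally show ?thesis .
qed

text \<open>Every \<open>h z\<close> permutes \<open>A\<close>, so the sum may be averaged over the
  whole family; the inner sums over \<open>B\<close> are where stationary phase finds its
  cancellation.\<close>

lemma sum_average:
  fixes g :: "'a \<Rightarrow> complex" and h :: "'b \<Rightarrow> 'a \<Rightarrow> 'a"
  assumes "finite A" "finite B" "\<And>z. z \<in> B \<Longrightarrow> h z ` A \<subseteq> A" "\<And>z. z \<in> B \<Longrightarrow> inj_on (h z) A"
  shows "of_nat (card B) * (\<Sum>x\<in>A. g x) = (\<Sum>x\<in>A. \<Sum>z\<in>B. g (h z x))"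
proof -
  have "(\<Sum>x\<in>A. \<Sum>z\<in>B. g (h z x)) = (\<Sum>z\<in>B. \<Sum>x\<in>A. g (h z x))" by (rule sum.swap)
  also have "\<dots> = (\<Sum>z\<in>B. \<Sum>x\<in>A. g x)"
  proof (rule sum.cong[OF refl])
    fix z assume "z \<in> B"
    then have "bij_betw (h z) A A" using assms endo_inj_surj[of A "h z"] by (simp add: bij_betw_def)
    then show "(\<Sum>x\<in>A. g (h z x)) = (\<Sum>x\<in>A. g x)" by (rule sum.reindex_bij_betw)
  qed
  finally show ?thesis by simp
qed

lemma sum_shift_periodic:
  fixes F :: "int \<Rightarrow> complex"
  assumes "p > 0" "\<And>x. F (x mod int p) = F x"
  shows "(\<Sum>z<p. F (int z + y)) = (\<Sum>z<p. F (int z))"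
proof -
  define T where "T = (\<lambda>z. nat ((int z + y) mod int p))"
  have "inj_on T {..<p}"
  proof (rule inj_onI)
    fix z z' assume z: "z \<in> {..<p}" "z' \<in> {..<p}" "T z = T z'"
    then have "[int z + y = int z' + y] (mod int p)" using assms(1) by (simp add: T_def cong_def eq_nat_nat_iff)
    then have "[int z = int z'] (mod int p)" by (simp add: cong_add_rcancel)
    then show "z = z'" using z by (auto simp: cong_def)
  qed
  moreover have "T ` {..<p} \<subseteq> {..<p}" using assms(1) by (auto simp: T_def nat_less_iff)
  ultimately have "bij_betw T {..<p} {..<p}" using endo_inj_surj[of "{..<p}" T] by (simp add: bij_betw_def)
  then have "(\<Sum>z<p. F (int z)) = (\<Sum>z<p. F (int (T z)))" by (rule sum.reindex_bij_betw[symmetric])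
  also have "\<dots> = (\<Sum>z<p. F (int z + y))" using assms by (simp add: T_def)
  finally show ?thesis by simp
qed

text \<open>In the squared modulus, shifting one variable by the other leaves the phase
  \<open>2 * c * h * y\<close>, linear in \<open>y\<close>; orthogonality keeps only
  \<open>h = 0\<close>, as \<open>p\<close> divides neither 2 nor \<open>c\<close>.\<close>

lemma norm_gauss_sum:
  fixes p :: nat
  assumes p: "prime p" "p > 2" and c: "\<not> int p dvd c"
  shows "norm (\<Sum>z<p. char_mod p (w * int z + c * int z ^ 2)) = sqrt (real p)"
proof -
  have p0: "p > 0" using p by simp
  define F where "F = (\<lambda>z. char_mod p (w * z + c * z ^ 2))"
  have per: "F (x mod int p) = F x" for x unfolding F_def
    by (rule char_mod_cong[OF p0]) (intro cong_add cong_mult cong_pow; simp)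
  define G where "G = (\<Sum>z<p. F (int z))"
  have cnj: "cnj (char_mod p k) = char_mod p (- k)" for k by (simp add: char_mod_def cis_cnj)
  have "G * cnj G = (\<Sum>y<p. G * cnj (F (int y)))"
    by (simp add: G_def sum_distrib_left)
  also have "\<dots> = (\<Sum>y<p. \<Sum>h<p. F (int h + int y) * cnj (F (int y)))"
    using sum_shift_periodic[of p F, OF p0 per] by (simp add: G_def flip: sum_distrib_right)
  also have "\<dots> = (\<Sum>y<p. \<Sum>h<p. F (int h) * char_mod p (2 * c * int h * int y))"
    unfolding F_def cnj char_mod_add[symmetric] 
    by (intro sum.cong refl arg_cong[of _ _ "char_mod p"]) (simp add: algebra_simps power2_eq_square)
  also have "\<dots> = (\<Sum>h<p. F (int h) * (\<Sum>y<p. char_mod p (2 * c * int h * int y)))"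
    by (subst sum.swap) (simp add: sum_distrib_left)
  also have "\<dots> = (\<Sum>h<p. if h = 0 then of_nat p else 0)"
  proof (intro sum.cong refl)
    fix h assume h: "h \<in> {..<p}"
    have "int p dvd 2 * c * int h \<longleftrightarrow> h = 0"
    proof
      assume "int p dvd 2 * c * int h"
      then have "int p dvd 2 \<or> int p dvd c \<or> int p dvd int h"
        using p by (auto simp: prime_dvd_mult_iff)
      moreover have "\<not> int p dvd 2" using p by (auto dest: zdvd_imp_le)
      ultimately have "p dvd h" using c by simp
      then show "h = 0" using h by (auto dest: dvd_imp_le)
    qed auto
    then show "F (int h) * (\<Sum>y<p. char_mod p (2 * c * int h * int y)) = (if h = 0 then of_nat p else 0)"
      using p0 by (subst sum_char_mod) (auto simp: F_def)
  qed
  also have "\<dots> = of_nat p" using p0 by simp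
  finally have "G * cnj G = of_nat p" .
  then have "of_real (norm G ^ 2) = (of_real (real p) :: complex)" 
    using complex_norm_square[of G] by simp
  then have "norm G ^ 2 = real p" by (simp only: of_real_eq_iff)
  then show ?thesis unfolding G_def F_def by (simp add: real_sqrt_unique)
qed

section \<open>The critical equation modulo prime powers\<close>

lemma prime_power_dvd_mult_drop:
  fixes p :: int
  assumes "prime p" "p ^ a dvd x * y" "\<not> p ^ 2 dvd y"
  shows "p ^ (a - 1) dvd x"
proof (cases "p dvd y")
  case True
  then obtain y' where y': "y = p * y'" by (elim dvdE)
  have "\<not> p dvd y'" using assms(3) by (auto simp: y' power2_eq_square mult_dvd_mono)
  then have cop: "coprime (p ^ (a - 1)) y'" using assms(1) by (simp add: prime_imp_coprime)
  have "p ^ (a - 1) dvd x * y'"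
  proof (cases a)
    case (Suc a')
    have "p * p ^ a' dvd p * (x * y')" using assms(2) by (simp add: Suc y' mult_ac)
    then show ?thesis using assms(1) Suc by (subst (asm) dvd_mult_cancel_left) auto
  qed simp
  then show ?thesis using cop by (simp add: coprime_dvd_mult_left_iff)
next
  case False
  then have "coprime (p ^ a) y" using assms(1) by (simp add: prime_imp_coprime)
  then have "p ^ a dvd x" using assms(2) by (simp add: coprime_dvd_mult_left_iff)
  then show ?thesis by (rule dvd_trans[rotated]) (simp add: le_imp_power_dvd)
qed

text \<open>The cofactor of \<open>t - s\<close> in \<open>t ^ 5 - s ^ 5\<close>. At congruent units
  it is congruent to \<open>5 * t ^ 4\<close>, hence prime to \<open>p\<close> unless
  \<open>p = 5\<close>; this gives uniqueness when fifth roots are lifted.\<close>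

definition quintic :: "int \<Rightarrow> int \<Rightarrow> int" where
  "quintic t s = t ^ 4 + t ^ 3 * s + t ^ 2 * s ^ 2 + t * s ^ 3 + s ^ 4"

lemma quintic: "t ^ 5 - s ^ 5 = (t - s) * quintic t s"
  by (simp add: quintic_def eval_nat_numeral algebra_simps)

lemma quintic_cong: "[t = s] (mod m) \<Longrightarrow> [quintic t s = 5 * t ^ 4] (mod m)"
proof -
  assume "[t = s] (mod m)"
  then have s: "[s = t] (mod m)" by (rule cong_sym)
  have "[quintic t s = t ^ 4 + t ^ 3 * t + t ^ 2 * t ^ 2 + t * t ^ 3 + t ^ 4] (mod m)"
    unfolding quintic_def by (intro cong_add cong_mult cong_pow s cong_refl)
  also have "t ^ 4 + t ^ 3 * t + t ^ 2 * t ^ 2 + t * t ^ 3 + t ^ 4 = 5 * t ^ 4"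
    by (simp add: eval_nat_numeral)
  finally show ?thesis .
qed

text \<open>At \<open>p = 5\<close> a congruence modulo 5 carries no information. In terms of
  \<open>s = t + 5 * y\<close> all corrections carry the factor 25, so for a unit \<open>t\<close>
  exactly one factor 5 is present.\<close>

lemma quintic_cong_25: "[t = s] (mod 5) \<Longrightarrow> [quintic t s = 5 * t ^ 4] (mod 25)"
proof -
  assume "[t = s] (mod 5)"
  then obtain y where y: "s = t + 5 * y" by (metis cong_iff_lin cong_sym)
  have "quintic t s = 5 * t ^ 4 + 25 * (2 * t ^ 3 * y + 10 * t ^ 2 * y ^ 2 + 25 * t * y ^ 3 + 25 * y ^ 4)"
    by (simp add: quintic_def y eval_nat_numeral algebra_simps)
  then have "quintic t s - 5 * t ^ 4 = 25 * (2 * t ^ 3 * y + 10 * t ^ 2 * y ^ 2 + 25 * t * y ^ 3 + 25 * y ^ 4)"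
    by simp
  then show ?thesis by (simp only: cong_iff_dvd_diff dvd_triv_left)
qed

context
  fixes p e k :: nat and u v l :: int
  assumes p: "prime p" and k: "k \<ge> 1" "k < e" and l: "\<not> int p dvd l"
    and uv: "\<not> (int p dvd u \<and> int p dvd v)"
begin

text \<open>The stationarity condition \<open>3 * u * a = 2 * v * b\<close>, multiplied by
  \<open>a ^ 4 * b ^ 5\<close> and rewritten for \<open>t = a * b\<close> by means of
  \<open>a ^ 2 * b ^ 3 = l\<close>. Points are counted modulo \<open>p ^ e\<close> although the
  condition is one modulo \<open>p ^ k\<close>.\<close>

definition crit :: "int set" where
  "crit = {t \<in> {0..<int (p ^ e)}. \<not> int p dvd t \<and> [3 * u * t ^ 5 = 2 * v * l ^ 2] (mod int p ^ k)}"

lemma prime_int: "prime (int p)" using p by simp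

text \<open>There are at most \<open>R\<close> classes modulo \<open>p\<close>; the points in each
  lie in a single class modulo \<open>p ^ j\<close>, which has \<open>p ^ (e - j)\<close>
  representatives below \<open>p ^ e\<close>.\<close>

lemma card_fiber:
  assumes "j \<le> e" "\<And>t s. t \<in> crit \<Longrightarrow> s \<in> crit \<Longrightarrow> [t = s] (mod int p) \<Longrightarrow> [t = s] (mod int p ^ j)"
    "card ((\<lambda>t. t mod int p) ` crit) \<le> R"
  shows "card crit \<le> R * p ^ (e - j)"
proof (rule card_le_fibers)
  show "finite crit" unfolding crit_def by (rule finite_subset[of _ "{0..<int (p ^ e)}"]) auto
  fix r
  show "card {t \<in> crit. t mod int p = r} \<le> p ^ (e - j)"
  proof (rule card_cong_class_le)
    have "p ^ j * p ^ (e - j) = p ^ e" using assms(1) by (simp flip: power_add)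
    then show "{t \<in> crit. t mod int p = r} \<subseteq> {0..<int (p ^ j * p ^ (e - j))}" by (auto simp: crit_def)
    show "p ^ j > 0" using p by (simp add: prime_gt_0_nat)
    fix t s assume "t \<in> {t \<in> crit. t mod int p = r}" "s \<in> {t \<in> crit. t mod int p = r}"
    then show "[t = s] (mod int (p ^ j))" using assms(2)[of t s] by (simp add: cong_def)
  qed
qed (use assms in auto)

lemma crit_diff: "t \<in> crit \<Longrightarrow> s \<in> crit \<Longrightarrow> int p ^ k dvd (t ^ 5 - s ^ 5) * (3 * u)"
proof -
  assume "t \<in> crit" "s \<in> crit"
  then have "[3 * u * t ^ 5 = 3 * u * s ^ 5] (mod int p ^ k)"
    unfolding crit_def by (auto intro: cong_trans cong_sym)
  then show ?thesis by (simp add: cong_iff_dvd_diff algebra_simps)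
qed

lemma p_dvd_of_crit:
  assumes "t \<in> crit" "int p dvd 3 * u" shows "int p dvd 2 * v"
proof -
  have "[3 * u * t ^ 5 = 2 * v * l ^ 2] (mod int p)"
    using assms(1) k(1) by (auto simp: crit_def intro: cong_dvd_modulus dvd_power)
  moreover have "int p dvd 3 * u * t ^ 5" using assms(2) by simp
  ultimately have "int p dvd 2 * v * l ^ 2" using cong_dvd_iff by blast
  then show ?thesis using l prime_int by (metis prime_dvd_mult_iff prime_dvd_power)
qed

text \<open>Once a critical point exists, \<open>u\<close> is a unit, so \<open>t ^ 5\<close> is
  prescribed modulo \<open>p ^ k\<close>. This leaves at most five residues modulo \<open>p\<close>,
  and each lifts in at most one way because \<open>5 * t ^ 4\<close> is a unit.\<close>

lemma card_crit_large: assumes "p \<ge> 7" shows "card crit \<le> 5 * p ^ (e - k)"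
proof (cases "crit = {}")
  case False
  then obtain t0 where t0: "t0 \<in> crit" by auto
  have n: "\<not> int p dvd 2" "\<not> int p dvd 3" "\<not> int p dvd 5" using assms by (auto dest: zdvd_imp_le)
  have pu: "\<not> int p dvd u"
  proof
    assume u: "int p dvd u"
    then have "int p dvd v" using p_dvd_of_crit[OF t0] n prime_int by (auto simp: prime_dvd_mult_iff)
    then show False using u uv by simp
  qed
  then have "coprime (int p ^ k) (3 * u)" using n prime_int by (simp add: prime_imp_coprime prime_dvd_mult_iff)
  then have fifth: "int p ^ k dvd t ^ 5 - s ^ 5" if "t \<in> crit" "s \<in> crit" for t s
    using crit_diff[OF that] by (simp add: coprime_dvd_mult_left_iff)
  show ?thesis
  proof (rule card_fiber)
    show "k \<le> e" using k by simp
    fix t s assume ts: "t \<in> crit" "s \<in> crit" "[t = s] (mod int p)"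
    have "\<not> int p dvd 5 * t ^ 4" using ts(1) n prime_int
      by (auto simp: crit_def prime_dvd_mult_iff prime_dvd_power_iff)
    then have "\<not> int p dvd quintic t s" using cong_dvd_iff[OF quintic_cong[OF ts(3)]] by simp
    then have "coprime (int p ^ k) (quintic t s)" using prime_int by (simp add: prime_imp_coprime)
    then show "[t = s] (mod int p ^ k)"
      using fifth[OF ts(1,2)] unfolding quintic by (simp add: coprime_dvd_mult_left_iff cong_iff_dvd_diff)
  next
    have p0: "p > 0" using assms by simp
    define c where "c = nat (t0 ^ 5 mod int p)"
    have "nat ` (\<lambda>t. t mod int p) ` crit \<subseteq> {x \<in> {..<p}. [x ^ 5 = c] (mod p)}"
    proof clarsimp
      fix t assume t: "t \<in> crit"
      have "[t ^ 5 = t0 ^ 5] (mod int p)"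
        using fifth[OF t t0] k(1) by (auto simp: cong_iff_dvd_diff intro: dvd_trans[OF dvd_power])
      then have "[int (nat (t mod int p) ^ 5) = int c] (mod int p)"
        using p0 by (simp add: c_def cong_def power_mod)
      then show "nat (t mod int p) < p \<and> [nat (t mod int p) ^ 5 = c] (mod p)"
        using p0 by (simp only: cong_int_iff) (simp add: nat_less_iff)
    qed
    then have "card (nat ` (\<lambda>t. t mod int p) ` crit) \<le> card {x \<in> {..<p}. [x ^ 5 = c] (mod p)}"
      by (intro card_mono) auto
    also have "\<dots> \<le> 5" using roots_mod_prime_bound[OF p, of 5 c] by simp
    also have "card (nat ` (\<lambda>t. t mod int p) ` crit) = card ((\<lambda>t. t mod int p) ` crit)"
      using p0 by (intro card_image inj_onI) (auto simp: eq_nat_nat_iff)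
    finally show "card ((\<lambda>t. t mod int p) ` crit) \<le> 5" .
  qed
qed simp

text \<open>At 2, 3 and 5 one power of \<open>p\<close> may be lost to the factor
  \<open>3 * u\<close> and one more to \<open>quintic t s\<close>, so uniqueness holds only modulo
  \<open>p ^ (k - 2)\<close>, with the exponent truncated at 0. With at most \<open>p\<close>
  classes this costs \<open>p * p ^ 2 \<le> 125\<close>.\<close>

lemma card_crit_small: assumes "p \<le> 5" shows "card crit \<le> 125 * p ^ (e - k)"
proof -
  have p235: "p = 2 \<or> p = 3 \<or> p = 5"
  proof -
    have "p \<noteq> 4" using p by auto
    then show ?thesis using assms prime_ge_2_nat[OF p] by linarith
  qed
  have p0: "p > 0" using p by (simp add: prime_gt_0_nat)
  have "card crit \<le> p * p ^ (e - (k - 1 - 1))"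
  proof (rule card_fiber)
    show "k - 1 - 1 \<le> e" using k by simp
    have "(\<lambda>t. t mod int p) ` crit \<subseteq> {0..<int p}" using p0 by auto
    then show "card ((\<lambda>t. t mod int p) ` crit) \<le> p" using card_mono[of "{0..<int p}"] by fastforce
    fix t s assume ts: "t \<in> crit" "s \<in> crit" "[t = s] (mod int p)"
    have pt: "\<not> int p dvd t" using ts by (simp add: crit_def)
    have "int p ^ (k - 1) dvd t ^ 5 - s ^ 5"
    proof (cases "int p ^ 2 dvd 3 * u")
      case False
      then show ?thesis using prime_power_dvd_mult_drop[OF prime_int crit_diff[OF ts(1,2)]] by blast
    next
      \<comment> \<open>Here \<open>p\<close> divides \<open>u\<close> and hence not
        \<open>v\<close>, so only \<open>p = 2\<close> survives; with \<open>k \<ge> 2\<close> the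
        critical equation modulo 4 would force \<open>v\<close> or \<open>l\<close> to be even. So
        \<open>k = 1\<close>, and divisibility by \<open>p ^ (k - 1)\<close> is trivial.\<close>
      case True
      have "int p dvd 3 * u" using True by (rule dvd_trans[rotated]) (simp add: power2_eq_square)
      then have v2: "int p dvd 2 * v" using p_dvd_of_crit[OF ts(1)] by simp
      have "int p dvd u"
      proof -
        consider "p = 2" | "p = 3" | "p = 5" using p235 by auto
        then show ?thesis
        proof cases
          case 1 then show ?thesis using True by simp presburger
        next
          case 2 then show ?thesis using True by simp presburger
        next
          case 3 then show ?thesis using True by simp presburger
        qed
      qed
      then have "\<not> int p dvd v" using uv by simp
      then have "int p dvd 2" using v2 prime_int by (auto simp: prime_dvd_mult_iff)
      then have p2: "p = 2" using p235 by auto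
      have "k < 2"
      proof (rule ccontr)
        assume "\<not> k < 2"
        then have "(4 :: int) dvd int p ^ k" using p2 le_imp_power_dvd[of 2 k "2 :: int"] by simp
        moreover have "[3 * u * t ^ 5 = 2 * v * l ^ 2] (mod int p ^ k)" using ts(1) by (simp add: crit_def)
        ultimately have "[3 * u * t ^ 5 = 2 * v * l ^ 2] (mod 4)" by (rule cong_dvd_modulus[rotated])
        moreover have "4 dvd 3 * u * t ^ 5" using True p2 by simp
        ultimately have "4 dvd 2 * v * l ^ 2" using cong_dvd_iff by blast
        then have "2 * 2 dvd 2 * (v * l ^ 2)" by (simp add: mult.assoc)
        then have "2 dvd v * l ^ 2" by (subst (asm) dvd_mult_cancel_left) auto
        then show False using \<open>\<not> int p dvd v\<close> l p2 by simp
      qed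
      then show ?thesis by simp
    qed
    moreover have "\<not> int p ^ 2 dvd quintic t s"
    proof
      assume q: "int p ^ 2 dvd quintic t s"
      show False
      proof (cases "p = 5")
        case True
        then have "25 dvd 5 * t ^ 4" using q cong_dvd_iff[OF quintic_cong_25[of t s]] ts(3) by simp
        then have "5 * 5 dvd 5 * t ^ 4" by simp
        then have "5 dvd t ^ 4" by (subst (asm) dvd_mult_cancel_left) auto
        then show False using pt True prime_int by (auto simp: prime_dvd_power_iff)
      next
        case False
        have "int p dvd quintic t s" using q by (rule dvd_trans[rotated]) (simp add: power2_eq_square)
        then have "int p dvd 5 * t ^ 4" using cong_dvd_iff[OF quintic_cong[OF ts(3)]] by simp
        then have "int p dvd 5" using pt prime_int by (auto simp: prime_dvd_mult_iff prime_dvd_power_iff)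
        then show False using p235 False by auto
      qed
    qed
    ultimately have "int p ^ (k - 1 - 1) dvd t - s"
      unfolding quintic by (rule prime_power_dvd_mult_drop[OF prime_int])
    then show "[t = s] (mod int p ^ (k - 1 - 1))" by (simp only: cong_iff_dvd_diff)
  qed
  also have "p * p ^ (e - (k - 1 - 1)) \<le> 5 * (p ^ (e - k) * p ^ 2)"
  proof (rule mult_mono)
    have "p ^ (e - (k - 1 - 1)) \<le> p ^ (e - k + 2)" using p0 k by (intro power_increasing) auto
    then show "p ^ (e - (k - 1 - 1)) \<le> p ^ (e - k) * p ^ 2" by (simp only: power_add)
  qed (use assms in auto)
  also have "\<dots> \<le> 5 * (p ^ (e - k) * 5 ^ 2)" using assms by (intro mult_left_mono power_mono) auto
  finally show ?thesis by simp
qed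

end

section \<open>Stationary phase modulo prime powers\<close>

lemma sols_twist:
  fixes q :: nat
  assumes q: "q > 0" and l: "coprime l (int q)" and c: "[\<alpha> ^ 2 * \<beta> ^ 3 = 1] (mod int q)"
  shows "(\<lambda>(a, b). (a * \<alpha> mod int q, b * \<beta> mod int q)) ` sols q l \<subseteq> sols q l"
    and "inj_on (\<lambda>(a, b). (a * \<alpha> mod int q, b * \<beta> mod int q)) (sols q l)"
proof -
  show "(\<lambda>(a, b). (a * \<alpha> mod int q, b * \<beta> mod int q)) ` sols q l \<subseteq> sols q l"
  proof clarify
    fix a b assume ab: "(a, b) \<in> sols q l"
    have "(a * \<alpha>) ^ 2 * (b * \<beta>) ^ 3 = (a ^ 2 * b ^ 3) * (\<alpha> ^ 2 * \<beta> ^ 3)"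
      by (simp add: power_mult_distrib)
    also have "[\<dots> = l * 1] (mod int q)" using ab c by (intro cong_mult) (auto simp: sols_def)
    finally have "[(a * \<alpha>) ^ 2 * (b * \<beta>) ^ 3 = l] (mod int q)" by simp
    then show "(a * \<alpha> mod int q, b * \<beta> mod int q) \<in> sols q l" by (rule mod_in_sols[OF q l])
  qed
  have cop: "coprime \<alpha> (int q)" "coprime \<beta> (int q)" using sols_coprime[OF q _ c] by auto
  show "inj_on (\<lambda>(a, b). (a * \<alpha> mod int q, b * \<beta> mod int q)) (sols q l)"
  proof (rule inj_onI, clarify)
    fix a b a' b' assume s: "(a, b) \<in> sols q l" "(a', b') \<in> sols q l"
      and e: "a * \<alpha> mod int q = a' * \<alpha> mod int q" "b * \<beta> mod int q = b' * \<beta> mod int q"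
    have "[a = a'] (mod int q)" "[b = b'] (mod int q)"
      using e cop by (simp_all add: cong_def[symmetric] cong_mult_rcancel)
    then show "a = a' \<and> b = b'" using s by (auto simp: sols_def intro: cong_less_imp_eq_int)
  qed
qed

context
  fixes p e k :: nat and u v l :: int
  assumes p: "prime p" and k: "k \<ge> 1" "2 * k \<le> e" and l: "\<not> int p dvd l"
    and uv: "\<not> (int p dvd u \<and> int p dvd v)"
begin

text \<open>\<open>3 * u * a - 2 * v * b\<close> is the derivative of the phase along the twist, so
  these are the stationary solutions, to the precision \<open>p ^ k\<close> that averaging
  detects.\<close>

definition Crit :: "(int \<times> int) set" where
  "Crit = {(a, b) \<in> sols (p ^ e) l. [3 * u * a = 2 * v * b] (mod int p ^ k)}"

lemma finite_Crit: "finite Crit"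
  by (rule finite_subset[of _ "sols (p ^ e) l"]) (auto simp: Crit_def)

lemma p_pos': "p > 0" using p by (simp add: prime_gt_0_nat)

lemma l_cop: "coprime l (int (p ^ e))"
  using l p prime_imp_coprime[of "int p" l] by (simp add: coprime_commute)

lemma pk_dvd: "int p ^ k dvd int (p ^ e)" using k by (simp add: le_imp_power_dvd)

lemma card_Crit_le: "card Crit \<le> card (crit p e k u v l)"
proof (rule card_inj_on_le)
  let ?h = "\<lambda>(a, b). (a * b) mod int (p ^ e)"
  have q: "p ^ e > 0" using p_pos' by simp
  show "inj_on ?h Crit"
    using bij_betw_imp_inj_on[OF bij_sols[OF q l_cop]] by (rule inj_on_subset) (auto simp: Crit_def)
  have k': "1 \<le> k" "k < e" using k by auto
  show "finite (crit p e k u v l)"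
    unfolding crit_def[OF p k' l uv] by (rule finite_subset[of _ "{0..<int (p ^ e)}"]) auto
  show "?h ` Crit \<subseteq> crit p e k u v l"
  proof clarify
    fix a b assume ab: "(a, b) \<in> Crit"
    then have s: "[a ^ 2 * b ^ 3 = l] (mod int (p ^ e))" "(a, b) \<in> sols (p ^ e) l" 
      and c: "[3 * u * a = 2 * v * b] (mod int p ^ k)" by (auto simp: Crit_def sols_def)
    define t where "t = (a * b) mod int (p ^ e)"
    have "t \<in> units_mod (p ^ e)" using bij_sols[OF q l_cop] s(2) unfolding bij_betw_def t_def by force
    then have t: "t \<in> {0..<int (p ^ e)}" "coprime t (int (p ^ e))" by (auto simp: units_mod_def)
    have "\<not> int p dvd t"
    proof
      assume "int p dvd t"
      moreover have "int p dvd int (p ^ e)" using k by (simp add: dvd_power)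
      ultimately have "is_unit (int p)" using t(2) by (rule coprime_common_divisor[rotated])
      then show False using p by (auto dest: prime_ge_2_nat)
    qed
    moreover have "[3 * u * t ^ 5 = 2 * v * l ^ 2] (mod int p ^ k)"
    proof -
      have "[t = a * b] (mod int p ^ k)" using pk_dvd by (rule cong_dvd_modulus[rotated]) (simp add: t_def)
      then have "[3 * u * t ^ 5 = 3 * u * (a * b) ^ 5] (mod int p ^ k)" by (intro cong_mult cong_pow cong_refl)
      also have "3 * u * (a * b) ^ 5 = (3 * u * a) * (a ^ 4 * b ^ 5)" by (simp add: eval_nat_numeral)
      also have "[\<dots> = (2 * v * b) * (a ^ 4 * b ^ 5)] (mod int p ^ k)" by (rule cong_mult[OF c cong_refl])
      also have "(2 * v * b) * (a ^ 4 * b ^ 5) = 2 * v * (a ^ 2 * b ^ 3) ^ 2" by (simp add: eval_nat_numeral)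
      also have "[\<dots> = 2 * v * l ^ 2] (mod int p ^ k)"
        by (rule cong_mult[OF cong_refl cong_pow[OF cong_dvd_modulus[OF s(1) pk_dvd]]])
      finally show ?thesis .
    qed
    ultimately show "(a * b) mod int (p ^ e) \<in> crit p e k u v l"
      using t(1) unfolding crit_def[OF p k' l uv] t_def by blast
  qed
qed

text \<open>The twist \<open>(a, b) \<mapsto> (a (1 + 3 x), b (1 - 2 x))\<close> preserves \<open>a\<^sup>2 b\<^sup>3\<close> to first order in \<open>x\<close>.\<close>

lemma ES_eq_Crit: "ES (p ^ e) l u v = (\<Sum>(a, b)\<in>Crit. char_mod (p ^ e) (u * a + v * b))"
proof -
  define q where "q = p ^ e"
  \<comment> \<open>The steps are multiples of \<open>p ^ (e - k)\<close>. Since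
    \<open>2 * k \<le> e\<close>, their squares vanish modulo \<open>p ^ e\<close>; the phase is
    linear in \<open>z\<close>, and orthogonality modulo \<open>p ^ k\<close> applies.\<close>
  define x where "x z = int (p ^ (e - k)) * int z" for z
  define T where "T z = (\<lambda>(a, b). (a * (1 + 3 * x z) mod int q, b * (1 - 2 * x z) mod int q))" for z
  define g where "g = (\<lambda>(a, b). char_mod q (u * a + v * b))"
  have q: "q > 0" using p_pos' by (simp add: q_def)
  have lq: "coprime l (int q)" using l_cop by (simp add: q_def)
  have qk: "q = p ^ (e - k) * p ^ k" using k by (simp add: q_def flip: power_add)
  have x2: "int q dvd x z ^ 2" for z
  proof -
    have "p ^ e dvd p ^ ((e - k) * 2)" using k by (intro le_imp_power_dvd) auto
    then have "int q dvd int (p ^ (e - k)) ^ 2" by (simp add: q_def power_mult flip: of_nat_power)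
    then show ?thesis by (simp add: x_def power_mult_distrib)
  qed
  have tw: "[(1 + 3 * x z) ^ 2 * (1 - 2 * x z) ^ 3 = 1] (mod int q)" for z
  proof -
    have "(1 + 3 * x z) ^ 2 * (1 - 2 * x z) ^ 3 - 1 = x z ^ 2 * (- 15 + 10 * x z + 60 * x z ^ 2 - 72 * x z ^ 3)"
      by (simp add: eval_nat_numeral algebra_simps)
    then show ?thesis using x2[of z] by (simp add: cong_iff_dvd_diff)
  qed
  have ph: "g (T z (a, b)) = g (a, b) * char_mod (p ^ k) ((3 * u * a - 2 * v * b) * int z)" for z a b
  proof -
    have "g (T z (a, b)) = char_mod q (u * (a * (1 + 3 * x z)) + v * (b * (1 - 2 * x z)))"
      unfolding g_def T_def prod.case by (rule char_mod_cong[OF q]) (intro cong_add cong_mult; simp)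
    also have "u * (a * (1 + 3 * x z)) + v * (b * (1 - 2 * x z)) =
      (u * a + v * b) + int (p ^ (e - k)) * ((3 * u * a - 2 * v * b) * int z)"
      by (simp add: x_def algebra_simps)
    also have "char_mod q \<dots> = g (a, b) * char_mod (p ^ (e - k) * p ^ k) (int (p ^ (e - k)) * ((3 * u * a - 2 * v * b) * int z))"
      by (simp only: char_mod_add g_def prod.case qk[symmetric])
    also have "\<dots> = g (a, b) * char_mod (p ^ k) ((3 * u * a - 2 * v * b) * int z)"
      using p_pos' by (subst char_mod_scale) auto
    finally show ?thesis .
  qed
  have "of_nat (card {..<p ^ k}) * (\<Sum>s\<in>sols q l. g s) = (\<Sum>s\<in>sols q l. \<Sum>z\<in>{..<p ^ k}. g (T z s))"
    by (rule sum_average) (use sols_twist[OF q lq tw] in \<open>auto simp: T_def\<close>)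
  also have "\<dots> = (\<Sum>s\<in>sols q l. if s \<in> Crit then of_nat (p ^ k) * g s else 0)"
  proof (rule sum.cong[OF refl])
    fix s assume s: "s \<in> sols q l"
    obtain a b where ab: "s = (a, b)" by (cases s)
    have "(\<Sum>z\<in>{..<p ^ k}. g (T z s)) = g s * (\<Sum>z<p ^ k. char_mod (p ^ k) ((3 * u * a - 2 * v * b) * int z))"
      by (simp only: ab ph sum_distrib_left)
    also have "\<dots> = g s * (if int (p ^ k) dvd 3 * u * a - 2 * v * b then of_nat (p ^ k) else 0)"
      using p_pos' by (subst sum_char_mod) auto
    also have "int (p ^ k) dvd 3 * u * a - 2 * v * b \<longleftrightarrow> s \<in> Crit"
      using s by (auto simp: ab Crit_def q_def cong_iff_dvd_diff)
    finally show "(\<Sum>z\<in>{..<p ^ k}. g (T z s)) = (if s \<in> Crit then of_nat (p ^ k) * g s else 0)"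
      by (simp add: mult.commute)
  qed
  also have "\<dots> = (\<Sum>s\<in>Crit. of_nat (p ^ k) * g s)"
    by (rule sum.mono_neutral_cong_right) (auto simp: Crit_def q_def)
  finally have "of_nat (p ^ k) * (\<Sum>s\<in>sols q l. g s) = of_nat (p ^ k) * (\<Sum>s\<in>Crit. g s)"
    by (simp add: sum_distrib_left)
  then show ?thesis using p_pos' by (simp add: ES_def g_def q_def)
qed

lemma norm_ES_le_Crit: "norm (ES (p ^ e) l u v) \<le> card Crit"
proof -
  have "norm (ES (p ^ e) l u v) \<le> (\<Sum>s\<in>Crit. 1)"
    unfolding ES_eq_Crit by (intro sum_norm_le) auto
  then show ?thesis by simp
qed

text \<open>For odd exponents the twist \<open>(a (1 + 3 x + 3 x\<^sup>2), b (1 - 2 x + 3 x\<^sup>2))\<close> is correct to second order, which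
  leaves a quadratic Gauss sum at each critical point.\<close>

lemma norm_ES_odd:
  assumes e: "e = 2 * k + 1" and p7: "p \<ge> 7"
  shows "real p * norm (ES (p ^ e) l u v) \<le> card Crit * sqrt (real p)"
proof -
  define q where "q = p ^ e"
  \<comment> \<open>With step size \<open>p ^ k\<close> and
    \<open>e = 2 * k + 1 \<le> 3 * k\<close>, cubes vanish modulo \<open>p ^ e\<close>. The
    quadratic term is divisible by \<open>p ^ (2 * k)\<close>, and on \<open>Crit\<close> so is the
    linear one, which leaves a quadratic phase modulo \<open>p\<close>.\<close>
  define x where "x z = int (p ^ k) * int z" for z
  define T where "T z = (\<lambda>(a, b). (a * (1 + 3 * x z + 3 * x z ^ 2) mod int q, b * (1 - 2 * x z + 3 * x z ^ 2) mod int q))" for z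
  define g where "g = (\<lambda>(a, b). char_mod q (u * a + v * b))"
  have q: "q > 0" using p_pos' by (simp add: q_def)
  have lq: "coprime l (int q)" using l_cop by (simp add: q_def)
  have n: "\<not> int p dvd 2" "\<not> int p dvd 3" "\<not> int p dvd 5" using p7 by (auto dest: zdvd_imp_le)
  have pp: "prime (int p)" using p by simp
  have x3: "int q dvd x z ^ 3" for z
  proof -
    have "p ^ e dvd p ^ (k * 3)" using k e by (intro le_imp_power_dvd) auto
    then have "int q dvd int (p ^ k) ^ 3" by (simp add: q_def power_mult flip: of_nat_power)
    then show ?thesis by (simp add: x_def power_mult_distrib)
  qed
  have tw: "[(1 + 3 * x z + 3 * x z ^ 2) ^ 2 * (1 - 2 * x z + 3 * x z ^ 2) ^ 3 = 1] (mod int q)" for z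
  proof -
    have "(1 + 3 * y + 3 * y ^ 2) ^ 2 * (1 - 2 * y + 3 * y ^ 2) ^ 3 - 1
       = y ^ 3 * (10 + 15 * y - 12 * y ^ 2 + 45 * y ^ 3 + 90 * y ^ 4 + 243 * y ^ 7)" for y :: int
      by (simp add: eval_nat_numeral algebra_simps)
    then show ?thesis using x3[of z] by (simp add: cong_iff_dvd_diff)
  qed
  have T_Crit: "T z ` Crit \<subseteq> Crit" for z
  proof (rule image_subsetI)
    fix s assume "s \<in> Crit"
    moreover obtain a b where s: "s = (a, b)" by (cases s)
    ultimately have ab: "(a, b) \<in> Crit" by simp
    have "T z (a, b) \<in> sols q l" using sols_twist(1)[OF q lq tw[of z]] ab by (auto simp: T_def Crit_def q_def)
    moreover have "[3 * u * (a * (1 + 3 * x z + 3 * x z ^ 2) mod int q) = 2 * v * (b * (1 - 2 * x z + 3 * x z ^ 2) mod int q)] (mod int p ^ k)"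
    proof -
      have x0: "[x z = 0] (mod int p ^ k)" by (simp add: x_def cong_0_iff)
      have m: "[y mod int q = y] (mod int p ^ k)" for y
        using pk_dvd unfolding q_def[symmetric] by (rule cong_dvd_modulus[rotated]) simp
      have "[3 * u * (a * (1 + 3 * x z + 3 * x z ^ 2) mod int q) = 3 * u * (a * (1 + 3 * 0 + 3 * 0 ^ 2))] (mod int p ^ k)"
        by (intro cong_trans[OF cong_mult[OF cong_refl m]] cong_mult cong_add cong_pow x0 cong_refl)
      moreover have "[2 * v * (b * (1 - 2 * x z + 3 * x z ^ 2) mod int q) = 2 * v * (b * (1 - 2 * 0 + 3 * 0 ^ 2))] (mod int p ^ k)"
        by (intro cong_trans[OF cong_mult[OF cong_refl m]] cong_mult cong_add cong_diff cong_pow x0 cong_refl)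
      moreover have "[3 * u * a = 2 * v * b] (mod int p ^ k)" using ab by (simp add: Crit_def)
      ultimately show ?thesis by (simp add: cong_def)
    qed
    ultimately show "T z s \<in> Crit" by (simp add: s Crit_def T_def q_def)
  qed
  have T_inj: "inj_on (T z) Crit" for z
    using sols_twist(2)[OF q lq tw[of z]] unfolding T_def by (rule inj_on_subset) (auto simp: Crit_def q_def)
  have inner: "norm (\<Sum>z<p. g (T z s)) = sqrt (real p)" if s: "s \<in> Crit" for s
  proof -
    obtain a b where ab: "s = (a, b)" by (cases s)
    have "int p ^ k dvd 3 * u * a - 2 * v * b" using s by (simp add: ab Crit_def cong_iff_dvd_diff)
    then obtain w where w: "3 * u * a - 2 * v * b = int p ^ k * w" by (elim dvdE)
    define c where "c = 3 * (u * a + v * b)"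
    have qk: "q = p ^ (2 * k) * p" by (simp add: q_def e)
    have "g (T z s) = g s * char_mod p (w * int z + c * int z ^ 2)" for z
    proof -
      have "g (T z s) = char_mod q (u * (a * (1 + 3 * x z + 3 * x z ^ 2)) + v * (b * (1 - 2 * x z + 3 * x z ^ 2)))"
        unfolding g_def T_def ab prod.case by (rule char_mod_cong[OF q]) (intro cong_add cong_mult; simp)
      also have "u * (a * (1 + 3 * x z + 3 * x z ^ 2)) + v * (b * (1 - 2 * x z + 3 * x z ^ 2)) =
        (u * a + v * b) + (x z * (3 * u * a - 2 * v * b) + x z ^ 2 * c)"
        by (simp add: c_def algebra_simps)
      also have "x z * (3 * u * a - 2 * v * b) + x z ^ 2 * c = int (p ^ (2 * k)) * (w * int z + c * int z ^ 2)"
      proof -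
        have "int (p ^ (2 * k)) = int (p ^ k) * int (p ^ k)" by (simp add: mult_2 power_add)
        then show ?thesis unfolding w x_def by (simp only:) (simp add: power2_eq_square algebra_simps)
      qed
      also have "char_mod q ((u * a + v * b) + int (p ^ (2 * k)) * (w * int z + c * int z ^ 2)) =
        g s * char_mod (p ^ (2 * k) * p) (int (p ^ (2 * k)) * (w * int z + c * int z ^ 2))"
        by (simp only: char_mod_add g_def ab prod.case qk[symmetric])
      also have "\<dots> = g s * char_mod p (w * int z + c * int z ^ 2)"
        using p_pos' by (subst char_mod_scale) auto
      finally show ?thesis .
    qed
    then have "(\<Sum>z<p. g (T z s)) = g s * (\<Sum>z<p. char_mod p (w * int z + c * int z ^ 2))"
      by (simp add: sum_distrib_left)
    moreover have "norm (g s) = 1" by (simp add: g_def ab)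
    \<comment> \<open>The forms \<open>u * a + v * b\<close> and
      \<open>3 * u * a - 2 * v * b\<close> combine to \<open>5 * u * a\<close>; if both vanished
      modulo \<open>p\<close>, then \<open>p\<close> would divide \<open>u\<close> and hence
      \<open>v\<close>, because \<open>a\<close> and \<open>b\<close> are units.\<close>
    moreover have "\<not> int p dvd c"
    proof
      assume "int p dvd c"
      then have x: "int p dvd u * a + v * b" using n pp prime_dvd_multD[of "int p" 3 "u * a + v * b"] unfolding c_def by blast
      have d: "int p dvd 3 * u * a - 2 * v * b" unfolding w using k by (simp add: dvd_power)
      have "int p dvd (3 * u * a - 2 * v * b) + 2 * (u * a + v * b)" by (rule dvd_add[OF d dvd_mult[OF x]])
      then have "int p dvd 5 * (u * a)" by (simp add: algebra_simps)
      moreover have s': "[a ^ 2 * b ^ 3 = l] (mod int q)" using s by (simp add: ab Crit_def sols_def q_def)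
      have "\<not> int p dvd a ^ 2 * b ^ 3"
        using l cong_dvd_iff[OF cong_dvd_modulus[OF s', of "int p"]] e by (simp add: q_def)
      then have na: "\<not> int p dvd a" "\<not> int p dvd b" by (auto simp: power2_eq_square power3_eq_cube)
      ultimately have pu: "int p dvd u" using n pp by (simp add: prime_dvd_mult_iff)
      then have "int p dvd 3 * u * a" by simp
      from dvd_diff[OF this d] have "int p dvd 2 * (v * b)" by (simp add: mult.assoc)
      then have "int p dvd v" using na n pp by (simp add: prime_dvd_mult_iff)
      then show False using uv pu by simp
    qed
    ultimately show ?thesis using norm_gauss_sum[OF p, of c w] p7 by (simp add: norm_mult)
  qed
  have avg: "of_nat (card {..<p}) * (\<Sum>s\<in>Crit. g s) = (\<Sum>s\<in>Crit. \<Sum>z\<in>{..<p}. g (T z s))"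
    by (rule sum_average) (use T_Crit T_inj finite_Crit in auto)
  have "norm (\<Sum>s\<in>Crit. \<Sum>z<p. g (T z s)) \<le> (\<Sum>s\<in>Crit. sqrt (real p))"
    by (rule sum_norm_le) (simp add: inner)
  then have "norm (of_nat p * (\<Sum>s\<in>Crit. g s)) \<le> (\<Sum>s\<in>Crit. sqrt (real p))"
    unfolding avg[symmetric] by simp
  moreover have "(\<Sum>s\<in>Crit. g s) = ES (p ^ e) l u v" unfolding ES_eq_Crit by (simp add: g_def q_def)
  ultimately show ?thesis by (simp add: norm_mult)
qed

end

section \<open>Assembling the bound for all moduli\<close>

lemma coprime_prime_power_induct [consumes 1, case_names one mult]:
  fixes P :: "nat \<Rightarrow> bool"
  assumes "q > 0" and one: "P 1"
    and mult: "\<And>p e q. prime p \<Longrightarrow> e \<ge> 1 \<Longrightarrow> \<not> p dvd q \<Longrightarrow> q > 0 \<Longrightarrow> P q \<Longrightarrow> P (p ^ e * q)"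
  shows "P q"
  using \<open>q > 0\<close>
proof (induction q rule: less_induct)
  case (less q)
  show ?case
  proof (cases "q = 1")
    case False
    then obtain p where p: "prime p" "p dvd q" using prime_factor_nat by blast
    define e where "e = multiplicity p q"
    obtain q2 where q2: "q = p ^ e * q2" "\<not> p dvd q2"
      using multiplicity_decompose'[of q p] less.prems not_prime_unit p(1) unfolding e_def by blast
    have e1: "e \<ge> 1" using p less.prems unfolding e_def by (simp add: Suc_le_eq prime_multiplicity_gt_zero_iff)
    have "1 < p ^ e" using prime_gt_1_nat[OF p(1)] e1 by (intro one_less_power) auto
    then have "q2 < q" "q2 > 0" using q2(1) less.prems by auto
    then show ?thesis using mult[OF p(1) e1 q2(2)] less.IH q2(1) by simp
  qed (use one in simp)
qed

lemma card_prime_factors_mult: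
  assumes "prime p" "e \<ge> 1" "\<not> p dvd q" "q > (0::nat)"
  shows "card (prime_factors (p ^ e * q)) = Suc (card (prime_factors q))"
proof -
  have "prime_factors (p ^ e * q) = insert p (prime_factors q)"
    using assms by (simp add: prime_factors_product prime_factors_power prime_prime_factors prime_gt_0_nat)
  moreover have "p \<notin> prime_factors q" using assms(3) by auto
  ultimately show ?thesis by simp
qed

text \<open>An even exponent leaves at most \<open>125 * p ^ k\<close> critical points. An odd one
  leaves a constant times \<open>p ^ (k + 1)\<close>, too many by a factor \<open>sqrt p\<close>:
  for \<open>p \<ge> 7\<close> the Gauss sums recover it, and for \<open>p \<le> 5\<close> it is
  absorbed through \<open>sqrt p \<le> 12 / 5\<close>. The constant 300 is
  \<open>125 * 12 / 5\<close>.\<close>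

lemma norm_ES_prime_power_coprime:
  assumes p: "prime p" and e: "e \<ge> 2" and l: "\<not> int p dvd l" and uv: "\<not> (int p dvd u \<and> int p dvd v)"
  shows "norm (ES (p ^ e) l u v) \<le> 300 * sqrt (real (p ^ e))"
proof -
  define k where "k = e div 2"
  have k: "k \<ge> 1" "2 * k \<le> e" "k < e" using e by (auto simp: k_def)
  have p0: "p > 0" using p by (simp add: prime_gt_0_nat)
  note crit_le = card_Crit_le[OF p k(1,2) l uv]
  have sqrt_even: "sqrt (real (p ^ (2 * k))) = real p ^ k"
    by (simp add: power_mult mult.commute[of 2] real_sqrt_power[symmetric] flip: power_mult)
      (simp add: power_mult mult.commute)
  have sqrt_odd: "sqrt (real (p ^ (2 * k + 1))) = real p ^ k * sqrt (real p)"
    using sqrt_even by (simp add: real_sqrt_mult mult.commute)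
  have sp: "sqrt (real p) * sqrt (real p) = real p" by simp
  have pk: "real p ^ k \<ge> 0" by simp
  consider "e = 2 * k" | "e = 2 * k + 1" unfolding k_def by linarith
  then show ?thesis
  proof cases
    case 1
    have ek: "e - k = k" using 1 by simp
    have "norm (ES (p ^ e) l u v) \<le> real (card (crit p e k u v l))"
      using norm_ES_le_Crit[OF p k(1,2) l uv] crit_le by linarith
    also have "card (crit p e k u v l) \<le> 125 * p ^ k"
    proof (cases "p \<ge> 7")
      case True
      then show ?thesis using card_crit_large[OF p k(1,3) l uv] unfolding ek by linarith
    next
      case False
      have "p \<noteq> 6" using p by auto
      then show ?thesis using False card_crit_small[OF p k(1,3) l uv] unfolding ek by linarith
    qed
    finally have "norm (ES (p ^ e) l u v) \<le> real (125 * p ^ k)" by simp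
    then have "norm (ES (p ^ e) l u v) \<le> 125 * real p ^ k" by simp
    then show ?thesis unfolding 1 sqrt_even using pk by linarith
  next
    case 2
    have ek: "e - k = k + 1" using 2 by simp
    show ?thesis
    proof (cases "p \<ge> 7")
      case True
      have "real (card (crit p e k u v l)) \<le> 5 * (real p ^ k * real p)"
        using card_crit_large[OF p k(1,3) l uv True] unfolding ek
        by (metis (mono_tags, lifting) of_nat_le_iff of_nat_mult of_nat_numeral of_nat_power power_add power_one_right)
      then have "real p * norm (ES (p ^ e) l u v) \<le> 5 * (real p ^ k * real p) * sqrt (real p)"
        using norm_ES_odd[OF p k(1,2) l uv 2 True] crit_le
        by (meson mult_right_mono of_nat_le_iff order.trans real_sqrt_ge_zero of_nat_0_le_iff)
      then have "norm (ES (p ^ e) l u v) \<le> 5 * (real p ^ k * sqrt (real p))" using p0 by simp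
      also have "\<dots> \<le> 300 * (real p ^ k * sqrt (real p))" by (intro mult_right_mono) auto
      finally show ?thesis unfolding 2 sqrt_odd .
    next
      case False
      have "p \<noteq> 6" using p by auto
      then have p5: "p \<le> 5" using False by simp
      have "norm (ES (p ^ e) l u v) \<le> real (card (crit p e k u v l))"
        using norm_ES_le_Crit[OF p k(1,2) l uv] crit_le by linarith
      also have "\<dots> \<le> real (125 * p ^ (k + 1))"
        using card_crit_small[OF p k(1,3) l uv p5] unfolding ek by linarith
      also have "\<dots> = 125 * (real p ^ k * sqrt (real p)) * sqrt (real p)" using sp by (simp add: mult_ac)
      also have "\<dots> \<le> 125 * (real p ^ k * sqrt (real p)) * (12 / 5)"
      proof (rule mult_left_mono)
        have "real p \<le> (12 / 5) ^ 2" using p5 by (simp add: power2_eq_square)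
        then have "sqrt (real p) \<le> sqrt ((12 / 5) ^ 2)" by (rule real_sqrt_le_mono)
        then show "sqrt (real p) \<le> 12 / 5" by simp
      qed simp
      also have "\<dots> = 300 * sqrt (real (p ^ e))" unfolding 2 sqrt_odd by simp
      finally show ?thesis .
    qed
  qed
qed

text \<open>The cubic term is absent here, and \<open>s = a * b ^ 2 / l\<close> is the better
  parameter: \<open>b = l * s ^ 2\<close> turns the sum into a quadratic Gauss sum without its term
  at 0.\<close>

lemma norm_ES_prime_gauss:
  assumes p: "prime p" "p > 3" and l: "\<not> int p dvd l" and u: "int p dvd u" and v: "\<not> int p dvd v"
  shows "norm (ES p l u v) \<le> 2 * sqrt (real p)"
proof -
  have p0: "p > 0" using p by simp
  have pp: "prime (int p)" using p by simp
  have lp: "coprime l (int p)" using l pp prime_imp_coprime[of "int p" l] by (simp add: coprime_commute)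
  obtain l' where l': "[l * l' = 1] (mod int p)" using cong_solve_coprime_int[OF lp] by blast
  define h where "h = (\<lambda>(a, b). (a * b ^ 2 * l') mod int p)"
  have bsq: "[b = l * (h (a, b)) ^ 2] (mod int p)" if "(a, b) \<in> sols p l" for a b
  proof -
    have s: "[a ^ 2 * b ^ 3 = l] (mod int p)" using that by (simp add: sols_def)
    have "[l * (h (a, b)) ^ 2 = l * (a * b ^ 2 * l') ^ 2] (mod int p)"
      unfolding h_def prod.case by (intro cong_mult cong_pow cong_refl) simp
    also have "l * (a * b ^ 2 * l') ^ 2 = (a ^ 2 * b ^ 3) * l' * (l * l') * b"
      by (simp add: eval_nat_numeral)
    also have "[\<dots> = l * l' * (l * l') * b] (mod int p)" by (intro cong_mult s cong_refl)
    also have "[l * l' * (l * l') * b = 1 * 1 * b] (mod int p)" by (intro cong_mult l' cong_refl)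
    finally show ?thesis by (simp add: cong_sym)
  qed
  have inj: "inj_on h (sols p l)"
  proof (rule inj_onI)
    fix x y assume xy: "x \<in> sols p l" "y \<in> sols p l" "h x = h y"
    obtain a b a' b' where ab: "x = (a, b)" "y = (a', b')" by (cases x, cases y)
    have b: "[b = b'] (mod int p)"
      using bsq[of a b] bsq[of a' b'] xy unfolding ab by (metis cong_sym cong_trans)
    then have bb: "b = b'" using xy ab by (auto simp: sols_def intro: cong_less_imp_eq_int)
    have "coprime b (int p)" using xy ab sols_coprime(2)[OF p0 lp, of a b] by (auto simp: sols_def)
    moreover have "coprime l' (int p)"
      using l' cong_imp_coprime[OF cong_sym[OF l']] by simp
    ultimately have "coprime (b ^ 2 * l') (int p)" by simp
    moreover have "[a * (b ^ 2 * l') = a' * (b ^ 2 * l')] (mod int p)"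
      using xy(3) unfolding ab h_def prod.case bb cong_def by (simp add: mult.assoc)
    ultimately have "[a = a'] (mod int p)" by (simp add: cong_mult_rcancel)
    then show "x = y" using bb xy ab by (auto simp: sols_def intro: cong_less_imp_eq_int)
  qed
  have sub: "h ` sols p l \<subseteq> units_mod p"
  proof (rule image_subsetI)
    fix x assume x: "x \<in> sols p l"
    obtain a b where ab: "x = (a, b)" by (cases x)
    have "coprime a (int p)" "coprime b (int p)" using x ab sols_coprime[OF p0 lp, of a b] by (auto simp: sols_def)
    moreover have "coprime l' (int p)"
      using l' cong_imp_coprime[OF cong_sym[OF l']] by simp
    ultimately show "h x \<in> units_mod p" using p0 by (simp add: ab h_def units_mod_def)
  qed
  have "card (h ` sols p l) = card (units_mod p)"
    using inj p0 lp by (simp add: card_image card_sols card_units_mod)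
  then have bij: "bij_betw h (sols p l) (units_mod p)"
    using inj sub card_subset_eq[OF finite_units_mod sub] by (simp add: bij_betw_def)
  have "ES p l u v = (\<Sum>x\<in>sols p l. char_mod p (0 * h x + (v * l) * (h x) ^ 2))"
    unfolding ES_def
  proof (rule sum.cong[OF refl])
    fix x assume x: "x \<in> sols p l"
    obtain a b where ab: "x = (a, b)" by (cases x)
    have "[u * a + v * b = 0 + v * (l * (h x) ^ 2)] (mod int p)"
      using u bsq[of a b] x unfolding ab by (intro cong_add cong_mult cong_refl) (auto simp: cong_0_iff)
    then show "(case x of (a, b) \<Rightarrow> char_mod p (u * a + v * b)) = char_mod p (0 * h x + (v * l) * (h x) ^ 2)"
      unfolding ab prod.case using p0 by (intro char_mod_cong) (simp_all add: mult.assoc)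
  qed
  also have "\<dots> = (\<Sum>s\<in>units_mod p. char_mod p (0 * s + (v * l) * s ^ 2))"
    using bij by (rule sum.reindex_bij_betw)
  also have "units_mod p = int ` ({..<p} - {0})"
  proof -
    have c1: "coprime t (int p)" if "t \<in> {0<..<int p}" for t
    proof -
      have "\<not> int p dvd t" using that by (auto dest: zdvd_imp_le)
      then show ?thesis using prime_imp_coprime[OF pp] coprime_commute by blast
    qed
    have c2: "t \<noteq> 0" if "coprime t (int p)" for t using that p by auto
    have "units_mod p = {0<..<int p}"
    proof (intro equalityI subsetI)
      fix t assume "t \<in> units_mod p"
      then show "t \<in> {0<..<int p}" using c2[of t] by (simp add: units_mod_def)
    next
      fix t assume "t \<in> {0<..<int p}"
      then show "t \<in> units_mod p" using c1[of t] by (simp add: units_mod_def)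
    qed
    also have "\<dots> = int ` ({..<p} - {0})"
    proof (intro equalityI subsetI)
      fix t assume "t \<in> {0<..<int p}"
      then show "t \<in> int ` ({..<p} - {0})" by (intro image_eqI[of _ _ "nat t"]) auto
    qed auto
    finally show ?thesis .
  qed
  also have "(\<Sum>s\<in>int ` ({..<p} - {0}). char_mod p (0 * s + (v * l) * s ^ 2)) =
    (\<Sum>z\<in>{..<p} - {0}. char_mod p (0 * int z + (v * l) * int z ^ 2))"
    by (subst sum.reindex) auto
  also have "\<dots> = (\<Sum>z<p. char_mod p (0 * int z + (v * l) * int z ^ 2)) - 1"
    using p0 by (simp add: sum_diff1)
  finally have e: "ES p l u v = (\<Sum>z<p. char_mod p (0 * int z + (v * l) * int z ^ 2)) - 1" .
  have "\<not> int p dvd v * l" using v l pp by (simp add: prime_dvd_mult_iff)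
  then have "norm (\<Sum>z<p. char_mod p (0 * int z + (v * l) * int z ^ 2)) = sqrt (real p)"
    using p by (intro norm_gauss_sum) auto
  then have "norm (ES p l u v) \<le> sqrt (real p) + 1"
    unfolding e using norm_triangle_ineq4[of "\<Sum>z<p. char_mod p (0 * int z + (v * l) * int z ^ 2)" 1] by simp
  moreover have "1 \<le> sqrt (real p)" using p by simp
  ultimately show ?thesis by linarith
qed

lemma norm_ES_prime:
  assumes p: "prime p" and l: "\<not> int p dvd l" and uv: "\<not> (int p dvd u \<and> int p dvd v)"
  shows "norm (ES p l u v) \<le> 300 * sqrt (real p)"
proof (cases "p > 3")
  case True
  have "0 \<le> sqrt (real p)" by simp
  show ?thesis
  proof (cases "int p dvd u")
    case u: True
    then show ?thesis using norm_ES_prime_gauss[OF p True l u] uv \<open>0 \<le> sqrt (real p)\<close> by (smt (verit))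
  next
    case False
    then have "norm (ES p l u v) \<le> 5 * sqrt (real p)"
      using weil_bound[OF p True] l unfolding weil_at_def by blast
    then show ?thesis using \<open>0 \<le> sqrt (real p)\<close> by linarith
  qed
next
  case False
  have p0: "p > 0" using p by (simp add: prime_gt_0_nat)
  have "coprime l (int p)" using l p prime_imp_coprime[of "int p" l] by (simp add: coprime_commute)
  then have "norm (ES p l u v) \<le> real (totient p)" by (rule norm_ES_le_totient[OF p0])
  also have "\<dots> \<le> 3" using totient_le[of p] False by simp
  also have "1 \<le> sqrt (real p)" using p0 by simp
  then have "3 \<le> 300 * sqrt (real p)" by linarith
  finally show ?thesis by simp
qed

text \<open>The common factor \<open>p ^ g\<close> of the frequencies and the modulus is pulled out
  by \<open>ES_reduce\<close>, and \<open>p ^ g * sqrt (p ^ (e - g)) = sqrt (p ^ e * p ^ g)\<close>.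
  For \<open>g = e\<close> the phase is trivial and the number of solutions is the bound.\<close>

lemma norm_ES_prime_power:
  assumes p: "prime p" and e: "e \<ge> 1" and l: "\<not> int p dvd l"
  shows "norm (ES (p ^ e) l u v) \<le> 300 * sqrt (real (p ^ e) * real_of_int (gcd (gcd u v) (int (p ^ e))))"
proof -
  have p0: "p > 0" using p by (simp add: prime_gt_0_nat)
  have pp: "prime (int p)" using p by simp
  have lp: "coprime l (int p)" using l p prime_imp_coprime[of "int p" l] by (simp add: coprime_commute)
  define d where "d = gcd (gcd u v) (int (p ^ e))"
  have "d dvd int p ^ e" by (simp add: d_def)
  then obtain g where g: "g \<le> e" "normalize d = normalize (int p ^ g)"
    using divides_primepow[OF pp] by auto
  then have d: "d = int p ^ g" by (simp add: d_def)
  have q0: "p ^ j > 0" for j using p0 by simp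
  show ?thesis
  proof (cases "g = e")
    case True
    have "norm (ES (p ^ e) l u v) \<le> real (totient (p ^ e))"
      by (rule norm_ES_le_totient[OF q0]) (use lp in simp)
    also have "\<dots> \<le> real (p ^ e)" using totient_le[of "p ^ e"] by linarith
    also have "\<dots> \<le> 300 * real (p ^ e)" by simp
    also have "real (p ^ e) = sqrt (real (p ^ e) * real_of_int d)"
      using d True by (simp add: real_sqrt_unique)
    finally show ?thesis by (simp add: d_def)
  next
    case False
    then have ge: "g < e" using g by simp
    have "d dvd u" "d dvd v" by (auto simp: d_def intro: dvd_trans[OF gcd_dvd1])
    then obtain u' v' where uv': "u = int (p ^ g) * u'" "v = int (p ^ g) * v'" unfolding d by (auto elim!: dvdE)
    have uv: "\<not> (int p dvd u' \<and> int p dvd v')"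
    proof
      assume "int p dvd u' \<and> int p dvd v'"
      then have "int p ^ Suc g dvd u" "int p ^ Suc g dvd v" by (auto simp: uv' mult.commute intro!: mult_dvd_mono)
      moreover have "int p ^ Suc g dvd int (p ^ e)" using ge by (simp add: le_imp_power_dvd del: power_Suc)
      ultimately have "int p ^ Suc g dvd d" unfolding d_def by (intro gcd_greatest)
      then show False unfolding d using p0 pp dvd_power_iff[of "int p" "Suc g" g] prime_gt_1_int[OF pp] by auto
    qed
    have qe: "p ^ e = p ^ g * p ^ (e - g)" using ge by (simp flip: power_add)
    have red: "ES (p ^ g * p ^ (e - g)) l (int (p ^ g) * u') (int (p ^ g) * v') = of_nat (p ^ g) * ES (p ^ (e - g)) l u' v'"
    proof (rule ES_reduce[OF q0 q0])
      show "coprime x (int (p ^ g * p ^ (e - g)))" if "coprime x (int (p ^ (e - g)))" for x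
        using that ge by (auto simp: coprime_power_right_iff)
      show "coprime l (int (p ^ g * p ^ (e - g)))" using lp by simp
    qed
    have "norm (ES (p ^ (e - g)) l u' v') \<le> 300 * sqrt (real (p ^ (e - g)))"
    proof (cases "e - g = 1")
      case True then show ?thesis using norm_ES_prime[OF p l uv] by simp
    next
      case False then show ?thesis using ge by (intro norm_ES_prime_power_coprime[OF p _ l uv]) simp
    qed
    then have "norm (ES (p ^ e) l u v) \<le> real (p ^ g) * (300 * sqrt (real (p ^ (e - g))))"
      unfolding qe uv' red norm_mult norm_of_nat by (intro mult_left_mono) auto
    also have "\<dots> = 300 * sqrt (real (p ^ g) * real (p ^ g) * real (p ^ (e - g)))"
      by (simp add: real_sqrt_mult)
    also have "real (p ^ g) * real (p ^ g) * real (p ^ (e - g)) = real (p ^ e) * real_of_int d"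
      by (simp add: qe d)
    finally show ?thesis by (simp add: d_def)
  qed
qed

theorem norm_ES_le:
  assumes "q > 0" "coprime l (int q)"
  shows "norm (ES q l u v) \<le> 300 ^ card (prime_factors q) * sqrt (real q * real_of_int (gcd (gcd u v) (int q)))"
  using assms
proof (induction q arbitrary: u v rule: coprime_prime_power_induct)
  case one
  then show ?case using norm_ES_le_totient[of 1 l u v] by simp
next
  case (mult p e q2)
  define q where "q = p ^ e * q2"
  have p1: "p > 1" using prime_gt_1_nat[OF mult(1)] .
  have pos: "p ^ e > 0" "q2 > 0" "q > 0" using p1 mult(4) by (auto simp: q_def)
  have cop: "coprime (p ^ e) q2" using mult(1,3) by (simp add: prime_imp_coprime)
  have l2: "coprime l (int q2)" and lp: "coprime l (int p ^ e)" using mult.prems by auto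
  have lp': "\<not> int p dvd l"
  proof
    assume "int p dvd l"
    moreover have "int p dvd int p ^ e" using mult(2) by (simp add: dvd_power)
    ultimately have "is_unit (int p)" using lp by (rule coprime_common_divisor[rotated])
    then show False using p1 by simp
  qed
  have cop': "coprime (int (p ^ e)) (int q2)" using cop by simp
  obtain r2 where r2: "[int q2 * r2 = 1] (mod int (p ^ e))" using cong_solve_coprime_int cop' coprime_commute by metis
  obtain r1 where r1: "[int (p ^ e) * r1 = 1] (mod int q2)" using cong_solve_coprime_int[OF cop'] by blast
  \<comment> \<open>The inverses that twist the frequencies are units for the respective modulus, so
    they bring no new common divisor.\<close>
  have gcd_le: "gcd (gcd (u * r) (v * r)) m dvd gcd (gcd u v) m" if "coprime r m" for r m :: int
  proof -
    let ?x = "gcd (gcd (u * r) (v * r)) m"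
    have "?x dvd gcd (u * r) (v * r)" "?x dvd m" by (rule gcd_dvd1, rule gcd_dvd2)
    then have x: "?x dvd u * r" "?x dvd v * r" "?x dvd m" by (meson dvd_trans gcd_dvd1 gcd_dvd2)+
    have "coprime ?x r" using that x(3) by (meson coprime_commute coprime_divisors dvd_refl)
    then have "?x dvd u" "?x dvd v" using x(1,2) by (simp_all add: coprime_dvd_mult_left_iff)
    then show ?thesis using x(3) by simp
  qed
  have "coprime (int q2 * r2) (int (p ^ e))" by (rule cong_imp_coprime[OF cong_sym[OF r2]]) simp
  then have cr2: "coprime r2 (int (p ^ e))" by (simp only: coprime_mult_left_iff)
  have "coprime (int (p ^ e) * r1) (int q2)" by (rule cong_imp_coprime[OF cong_sym[OF r1]]) simp
  then have cr1: "coprime r1 (int q2)" by (simp only: coprime_mult_left_iff)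
  define g where "g m = gcd (gcd u v) m" for m
  have gpos: "g (int (p ^ e)) > 0" "g (int q2) > 0" "g (int q) > 0"
    using pos by (auto simp: g_def)
  have le1: "real_of_int (gcd (gcd (u * r2) (v * r2)) (int (p ^ e))) \<le> g (int (p ^ e))"
    using gcd_le[OF cr2] gpos unfolding g_def by (simp add: zdvd_imp_le)
  have le2: "real_of_int (gcd (gcd (u * r1) (v * r1)) (int q2)) \<le> g (int q2)"
    using gcd_le[OF cr1] gpos unfolding g_def by (simp add: zdvd_imp_le)
  have "g (int (p ^ e)) * g (int q2) dvd g (int q)"
  proof (rule divides_mult)
    have "g (int (p ^ e)) dvd int (p ^ e)" "g (int q2) dvd int q2" by (simp_all add: g_def)
    then show "coprime (g (int (p ^ e))) (g (int q2))" using cop' by (metis coprime_divisors)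
    show "g (int (p ^ e)) dvd g (int q)" "g (int q2) dvd g (int q)"
      unfolding g_def q_def by (rule gcd_mono[OF dvd_refl], simp)+
  qed
  then have "g (int (p ^ e)) * g (int q2) \<le> g (int q)" using gpos by (intro zdvd_imp_le)
  then have gle: "real_of_int (g (int (p ^ e))) * real_of_int (g (int q2)) \<le> real_of_int (g (int q))"
    by (simp flip: of_int_mult)
  have "norm (ES q l u v) = norm (ES (p ^ e) l (u * r2) (v * r2)) * norm (ES q2 l (u * r1) (v * r1))"
    unfolding q_def norm_mult[symmetric]
    using ES_mult[OF pos(1,2) cop mult.prems r2 r1, of u v] by simp
  also have "\<dots> \<le> (300 * sqrt (real (p ^ e) * g (int (p ^ e)))) * 
     (300 ^ card (prime_factors q2) * sqrt (real q2 * g (int q2)))"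
  proof (rule mult_mono)
    have "norm (ES (p ^ e) l (u * r2) (v * r2)) \<le> 300 * sqrt (real (p ^ e) * gcd (gcd (u * r2) (v * r2)) (int (p ^ e)))"
      by (rule norm_ES_prime_power[OF mult(1,2) lp'])
    also have "\<dots> \<le> 300 * sqrt (real (p ^ e) * g (int (p ^ e)))"
      using le1 by (intro mult_left_mono real_sqrt_le_mono) auto
    finally show "norm (ES (p ^ e) l (u * r2) (v * r2)) \<le> 300 * sqrt (real (p ^ e) * g (int (p ^ e)))" .
    have "norm (ES q2 l (u * r1) (v * r1)) \<le> 300 ^ card (prime_factors q2) * sqrt (real q2 * gcd (gcd (u * r1) (v * r1)) (int q2))"
      by (rule mult.IH[OF l2])
    also have "\<dots> \<le> 300 ^ card (prime_factors q2) * sqrt (real q2 * g (int q2))"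
      using le2 by (intro mult_left_mono real_sqrt_le_mono) auto
    finally show "norm (ES q2 l (u * r1) (v * r1)) \<le> 300 ^ card (prime_factors q2) * sqrt (real q2 * g (int q2))" .
  qed (use gpos in auto)
  also have "\<dots> = 300 ^ card (prime_factors q) * sqrt (real q * (g (int (p ^ e)) * g (int q2)))"
    unfolding q_def card_prime_factors_mult[OF mult(1-4)] by (simp add: real_sqrt_mult)
  also have "\<dots> \<le> 300 ^ card (prime_factors q) * sqrt (real q * g (int q))"
    using gle by (intro mult_left_mono real_sqrt_le_mono) auto
  finally show ?case by (simp add: g_def q_def)
qed

section \<open>Completion\<close>

lemma sum_divisors_inverse_sqrt_le:
  assumes "q > 0"
  shows "(\<Sum>d | d dvd q. 1 / sqrt (real d)) \<le> 4 ^ card (prime_factors q)"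
  using assms
proof (induction q rule: coprime_prime_power_induct)
  case one
  have "{d :: nat. d dvd 1} = {1}" by auto
  then show ?case by simp
next
  case (mult p e q)
  have p: "p \<ge> 2" "p > 0" using prime_ge_2_nat[OF mult(1)] by auto
  define D where "D = {d. d dvd q}"
  have finD: "finite D" using mult(4) by (simp add: D_def)
  let ?h = "\<lambda>(i, d). p ^ i * d"
  have sub: "{d. d dvd p ^ e * q} \<subseteq> ?h ` ({..e} \<times> D)"
  proof
    fix d assume "d \<in> {d. d dvd p ^ e * q}"
    then obtain b c where bc: "d = b * c" "b dvd p ^ e" "c dvd q" by (auto elim: dvd_productE)
    then obtain i where "i \<le> e" "b = p ^ i" using divides_primepow_nat[OF mult(1)] by blast
    then show "d \<in> ?h ` ({..e} \<times> D)" using bc by (auto simp: D_def)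
  qed
  have "(\<Sum>d | d dvd p ^ e * q. 1 / sqrt (real d)) \<le> (\<Sum>d\<in>?h ` ({..e} \<times> D). 1 / sqrt (real d))"
    using sub finD by (intro sum_mono2) auto
  also have "\<dots> \<le> (\<Sum>x\<in>{..e} \<times> D. 1 / sqrt (real (?h x)))"
    using finD sum_image_le[of "{..e} \<times> D" "\<lambda>d. 1 / sqrt (real d)" ?h] by (simp add: o_def)
  also have "\<dots> = (\<Sum>i\<le>e. \<Sum>d\<in>D. 1 / sqrt (real (p ^ i)) * (1 / sqrt (real d)))"
    unfolding sum.cartesian_product by (intro sum.cong refl) (auto simp: real_sqrt_mult)
  also have "\<dots> = (\<Sum>i\<le>e. 1 / sqrt (real (p ^ i))) * (\<Sum>d\<in>D. 1 / sqrt (real d))"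
    by (simp add: sum_product)
  also have "\<dots> \<le> 4 * 4 ^ card (prime_factors q)"
  proof (rule mult_mono)
    \<comment> \<open>Since \<open>(4 / 3) ^ 2 \<le> 2\<close>, the ratio \<open>1 / sqrt p\<close>
      is at most \<open>3 / 4\<close> for every prime, so the geometric series is at most 4; hence
      the base 4.\<close>
    define x where "x = 1 / sqrt (real p)"
    have "sqrt (real p) \<ge> 4 / 3"
      by (rule real_le_rsqrt) (use p in \<open>simp add: power2_eq_square\<close>)
    moreover have "sqrt (real p) > 0" using p by simp
    ultimately have x: "0 \<le> x" "x \<le> 3 / 4" by (simp_all add: x_def pos_divide_le_eq)
    have "(\<Sum>i\<le>n. x ^ i) \<le> 4 - 3 * x ^ n" for n
    proof (induction n)
      case (Suc n)
      have "x ^ Suc n \<le> 3 / 4 * x ^ n" using mult_right_mono[OF x(2), of "x ^ n"] x(1) by simp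
      then show ?case using Suc by simp
    qed simp
    from this[of e] have "(\<Sum>i\<le>e. x ^ i) \<le> 4" using x zero_le_power[OF x(1), of e] by linarith
    then show "(\<Sum>i\<le>e. 1 / sqrt (real (p ^ i))) \<le> 4" by (simp add: x_def power_divide real_sqrt_power)
    show "(\<Sum>d\<in>D. 1 / sqrt (real d)) \<le> 4 ^ card (prime_factors q)" using mult(5) by (simp add: D_def)
  qed (auto intro: sum_nonneg)
  also have "\<dots> = 4 ^ card (prime_factors (p ^ e * q))"
    using mult by (simp add: card_prime_factors_mult)
  finally show ?case .
qed

text \<open>Primes above \<open>c powr (1 / \<delta>)\<close> satisfy
  \<open>c \<le> p powr \<delta>\<close> and pay for their own factor \<open>c\<close>; the bounded
  number of smaller ones is absorbed in the constant.\<close>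

lemma power_omega_le_powr:
  fixes c \<delta> :: real
  assumes "c \<ge> 1" "\<delta> > 0"
  shows "\<exists>C>0. \<forall>q>0. c ^ card (prime_factors q) \<le> C * real q powr \<delta>"
proof -
  define N where "N = nat \<lceil>c powr (1 / \<delta>)\<rceil>"
  have big: "c \<le> real p powr \<delta>" if "p > N" for p
  proof -
    have "c powr (1 / \<delta>) \<le> real p" using that by (simp add: N_def) linarith
    then have "(c powr (1 / \<delta>)) powr \<delta> \<le> real p powr \<delta>" using assms by (intro powr_mono2) auto
    then show ?thesis using assms by (simp add: powr_powr)
  qed
  have main: "c ^ card (prime_factors q) \<le> c ^ card {p \<in> prime_factors q. p \<le> N} * real q powr \<delta>" if "q > 0" for q
    using that
  proof (induction q rule: coprime_prime_power_induct)
    case (mult p e q)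
    have pf: "prime_factors (p ^ e * q) = insert p (prime_factors q)"
      using mult by (simp add: prime_factors_product prime_factors_power prime_prime_factors prime_gt_0_nat)
    have np: "p \<notin> prime_factors q" using mult(3) by auto
    have p1: "p \<ge> 1" using prime_gt_0_nat[OF mult(1)] by simp
    have "real p \<le> real p ^ e" using p1 mult(2) self_le_power[of "real p" e] by simp
    then have pe: "real p powr \<delta> \<le> real (p ^ e) powr \<delta>" using assms by (intro powr_mono2) auto
    have pe1: "1 \<le> real (p ^ e) powr \<delta>" using p1 assms by (intro ge_one_powr_ge_zero) auto
    have "c ^ card (prime_factors (p ^ e * q)) = c * c ^ card (prime_factors q)"
      using mult by (simp add: card_prime_factors_mult)
    also have "\<dots> \<le> c * (c ^ card {p \<in> prime_factors q. p \<le> N} * real q powr \<delta>)"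
      using mult(5) assms by (intro mult_left_mono) auto
    also have "\<dots> \<le> c ^ card {x \<in> prime_factors (p ^ e * q). x \<le> N} * (real (p ^ e) powr \<delta> * real q powr \<delta>)"
    proof (cases "p \<le> N")
      case True
      have "{x \<in> prime_factors (p ^ e * q). x \<le> N} = insert p {x \<in> prime_factors q. x \<le> N}"
        using True pf by auto
      then have "card {x \<in> prime_factors (p ^ e * q). x \<le> N} = Suc (card {x \<in> prime_factors q. x \<le> N})"
        using np by simp
      moreover have "c * (c ^ card {p \<in> prime_factors q. p \<le> N} * real q powr \<delta>) * 1 \<le>
        c * (c ^ card {p \<in> prime_factors q. p \<le> N} * real q powr \<delta>) * real (p ^ e) powr \<delta>"
        using assms pe1 by (intro mult_left_mono) auto
      ultimately show ?thesis by (simp add: mult_ac)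
    next
      case False
      have "{x \<in> prime_factors (p ^ e * q). x \<le> N} = {x \<in> prime_factors q. x \<le> N}"
        using False pf by auto
      moreover have "c * (c ^ card {p \<in> prime_factors q. p \<le> N} * real q powr \<delta>) \<le>
        real (p ^ e) powr \<delta> * (c ^ card {p \<in> prime_factors q. p \<le> N} * real q powr \<delta>)"
        using big[of p] False pe assms by (intro mult_right_mono) auto
      ultimately show ?thesis by (simp add: mult_ac)
    qed
    finally show ?case by (simp add: powr_mult)
  qed simp
  have "c ^ card (prime_factors q) \<le> c ^ Suc N * real q powr \<delta>" if "q > 0" for q
  proof -
    have "card {p \<in> prime_factors q. p \<le> N} \<le> card {..N}" by (intro card_mono) auto
    then have "c ^ card {p \<in> prime_factors q. p \<le> N} \<le> c ^ Suc N"
      using assms by (intro power_increasing) auto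
    then show ?thesis using main[OF that] by (meson mult_right_mono order.trans powr_ge_zero)
  qed
  then show ?thesis using assms by (intro exI[of _ "c ^ Suc N"]) auto
qed

lemma ln_sq_le_powr:
  fixes \<delta> :: real
  assumes "\<delta> > 0"
  shows "\<exists>C>0. \<forall>q>0. (1 + ln (real q)) ^ 2 \<le> C * real q powr \<delta>"
proof -
  define C where "C = 1 + 2 / \<delta>"
  have "(1 + ln (real q)) ^ 2 \<le> C ^ 2 * real q powr \<delta>" if q: "q > 0" for q
  proof -
    have "ln (real q) \<le> real q powr (\<delta> / 2) / (\<delta> / 2)"
      using q assms by (intro ln_powr_bound) auto
    moreover have "1 \<le> real q powr (\<delta> / 2)" using q assms by (intro ge_one_powr_ge_zero) auto
    ultimately have "1 + ln (real q) \<le> C * real q powr (\<delta> / 2)" by (simp add: C_def algebra_simps)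
    then have "(1 + ln (real q)) ^ 2 \<le> (C * real q powr (\<delta> / 2)) ^ 2"
      using q by (intro power_mono) auto
    also have "\<dots> = C ^ 2 * real q powr \<delta>"
      by (simp add: power_mult_distrib power2_eq_square[of "_ powr _"] flip: powr_add)
    finally show ?thesis .
  qed
  moreover have "C > 0" using assms by (simp add: C_def add_pos_pos)
  ultimately show ?thesis by (intro exI[of _ "C ^ 2"]) auto
qed

lemma harm_le_1_plus_ln: "n > 0 \<Longrightarrow> harm n \<le> 1 + ln (real n)"
proof -
  assume "n > 0"
  then obtain k where k: "n = Suc k" by (cases n) auto
  have "harm (Suc k) - ln (real (Suc k)) \<le> harm (Suc 0) - ln (real (Suc 0))"
    using decseq_harm_diff_ln decseqD[of "\<lambda>n. harm (Suc n) - ln (Suc n)" 0 k] by simp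
  then show ?thesis by (simp add: k harm_expand)
qed

text \<open>\<open>sqrt (gcd h q)\<close> is at most the sum of \<open>sqrt d\<close> over the
  common divisors \<open>d\<close>. For fixed \<open>d\<close> only multiples \<open>d * k\<close>
  occur, which leaves a harmonic sum times \<open>1 / sqrt d\<close>.\<close>

lemma sum_gcd_le:
  assumes q: "q > 0"
  shows "(\<Sum>h\<in>{1..<q}. sqrt (real (gcd h q)) / real h) \<le> (1 + ln (real q)) * 4 ^ card (prime_factors q)"
proof -
  have "(\<Sum>h\<in>{1..<q}. sqrt (real (gcd h q)) / real h) \<le>
    (\<Sum>h\<in>{1..<q}. \<Sum>d | d dvd q. if d dvd h then sqrt (real d) / real h else 0)"
  proof (rule sum_mono)
    fix h assume h: "h \<in> {1..<q}"
    have "sqrt (real (gcd h q)) / real h = (\<Sum>d\<in>{gcd h q}. if d dvd h then sqrt (real d) / real h else 0)" by simp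
    also have "\<dots> \<le> (\<Sum>d | d dvd q. if d dvd h then sqrt (real d) / real h else 0)"
      using q by (intro sum_mono2) auto
    finally show "sqrt (real (gcd h q)) / real h \<le> (\<Sum>d | d dvd q. if d dvd h then sqrt (real d) / real h else 0)" .
  qed
  also have "\<dots> = (\<Sum>d | d dvd q. \<Sum>h\<in>{1..<q}. if d dvd h then sqrt (real d) / real h else 0)"
    by (rule sum.swap)
  also have "\<dots> \<le> (\<Sum>d | d dvd q. 1 / sqrt (real d) * (1 + ln (real q)))"
  proof (rule sum_mono)
    fix d assume "d \<in> {d. d dvd q}"
    then have d: "d > 0" using q by (auto intro: Nat.gr0I)
    have "(\<Sum>h\<in>{1..<q}. if d dvd h then sqrt (real d) / real h else 0) =
      (\<Sum>h\<in>{h \<in> {1..<q}. d dvd h}. sqrt (real d) / real h)"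
      by (intro sum.inter_filter[symmetric]) simp
    also have "\<dots> \<le> (\<Sum>h\<in>(\<lambda>k. d * k) ` {1..q}. sqrt (real d) / real h)"
    proof (rule sum_mono2)
      show "{h \<in> {1..<q}. d dvd h} \<subseteq> (\<lambda>k. d * k) ` {1..q}"
      proof
        fix h assume h: "h \<in> {h \<in> {1..<q}. d dvd h}"
        then obtain k where k: "h = d * k" by (auto elim: dvdE)
        then have "k \<ge> 1" using h by (cases k) auto
        moreover have "k \<le> q"
        proof -
          have "k \<le> h" using d k by simp
          also have "h \<le> q" using h by simp
          finally show ?thesis .
        qed
        ultimately show "h \<in> (\<lambda>k. d * k) ` {1..q}" using h k by (intro image_eqI[of _ _ k]) auto
      qed
    qed auto
    also have "\<dots> = (\<Sum>k\<in>{1..q}. sqrt (real d) / real (d * k))"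
      using d by (subst sum.reindex) (auto simp: inj_on_def)
    also have "\<dots> = (\<Sum>k\<in>{1..q}. 1 / sqrt (real d) * inverse (real k))"
    proof (rule sum.cong[OF refl])
      fix k assume "k \<in> {1..q}"
      have "real d = sqrt (real d) * sqrt (real d)" by simp
      then have "sqrt (real d) / real d = 1 / sqrt (real d)" using d by (simp add: real_div_sqrt field_simps)
      then show "sqrt (real d) / real (d * k) = 1 / sqrt (real d) * inverse (real k)"
        by (metis (no_types, opaque_lifting) divide_divide_eq_left divide_inverse of_nat_mult)
    qed
    also have "\<dots> = 1 / sqrt (real d) * harm q" by (simp add: harm_def sum_distrib_left)
    also have "\<dots> \<le> 1 / sqrt (real d) * (1 + ln (real q))"
      using harm_le_1_plus_ln[OF q] by (intro mult_left_mono) auto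
    finally show "(\<Sum>h\<in>{1..<q}. if d dvd h then sqrt (real d) / real h else 0) \<le> 1 / sqrt (real d) * (1 + ln (real q))" .
  qed
  also have "\<dots> = (1 + ln (real q)) * (\<Sum>d | d dvd q. 1 / sqrt (real d))"
    by (simp add: sum_distrib_left mult.commute)
  also have "\<dots> \<le> (1 + ln (real q)) * 4 ^ card (prime_factors q)"
    using q sum_divisors_inverse_sqrt_le[OF q] by (intro mult_left_mono) auto
  finally show ?thesis .
qed

section \<open>Incomplete geometric sums\<close>

lemma sin_ge_half: "0 \<le> x \<Longrightarrow> x \<le> pi / 2 \<Longrightarrow> sin x \<ge> x / (2 :: real)"
proof -
  assume x: "0 \<le> x" "x \<le> pi / 2"
  define y where "y = x / 2"
  have y: "0 \<le> y" "y \<le> pi / 4" using x by (auto simp: y_def)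
  have c: "cos y > 0" using y pi_gt_zero by (intro cos_gt_zero_pi) linarith+
  have "y \<le> tan y"
  proof -
    have "\<bar>y\<bar> < pi / 2" using y pi_gt_zero by linarith
    moreover have "0 \<le> tan y" using y pi_gt_zero by (intro tan_pos_pi2_le) linarith+
    ultimately show ?thesis using abs_tan_ge[of y] by linarith
  qed
  then have s: "sin y \<ge> y * cos y" using c by (simp add: tan_def field_simps)
  have "cos (pi / 4) \<le> cos y" using y pi_gt_zero by (intro cos_monotone_0_pi_le) linarith+
  then have c2: "sqrt 2 / 2 \<le> cos y" by (simp add: cos_45)
  then have "(sqrt 2 / 2) ^ 2 \<le> cos y ^ 2" by (intro power_mono) auto
  then have "1 / 2 \<le> cos y ^ 2" by (simp add: power_divide)
  then have "x * (1 / 2) \<le> x * cos y ^ 2" using x by (intro mult_left_mono) auto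
  also have "\<dots> = 2 * (y * cos y) * cos y" by (simp add: y_def power2_eq_square)
  also have "\<dots> \<le> 2 * sin y * cos y" using s c by (intro mult_right_mono) auto
  also have "\<dots> = sin x" using sin_double[of y] by (simp add: y_def)
  finally show ?thesis by simp
qed

lemma norm_1_minus_char_mod_ge:
  assumes "0 < h" "2 * h \<le> q"
  shows "norm (1 - char_mod q (int h)) \<ge> 2 * real h / real q"
proof -
  define x where "x = pi * real h / real q"
  have q: "real q > 0" using assms by simp
  have x: "0 \<le> x" "x \<le> pi / 2" using assms q by (auto simp: x_def field_simps)
  have e: "char_mod q (int h) = cis (2 * x)" by (simp add: char_mod_def x_def mult.assoc)
  have "norm (1 - cis (2 * x)) ^ 2 = (1 - cos (2 * x)) ^ 2 + sin (2 * x) ^ 2"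
    by (simp add: cmod_power2)
  also have "\<dots> = 2 - 2 * cos (2 * x)" 
    using sin_cos_squared_add[of "2 * x"] by (simp add: power2_diff)
  also have "\<dots> = (2 * sin x) ^ 2" by (simp add: cos_double_sin power_mult_distrib)
  finally have sq: "norm (1 - cis (2 * x)) ^ 2 = (2 * sin x) ^ 2" .
  have "0 \<le> sin x" using x pi_gt_zero by (intro sin_ge_zero) linarith+
  then have "norm (1 - cis (2 * x)) = 2 * sin x"
    using power2_eq_imp_eq[OF sq] by simp
  moreover have "2 * sin x \<ge> x" using sin_ge_half[OF x] by simp
  moreover have "x \<ge> 2 * real h / real q" 
    unfolding x_def using q pi_ge_two by (intro divide_right_mono mult_right_mono) auto
  ultimately show ?thesis unfolding e by linarith
qed

text \<open>The geometric sum is at most \<open>q\<close> divided by the minimum of \<open>h\<close>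
  and \<open>q - h\<close>. Replacing the minimum by two terms keeps the bound symmetric under
  \<open>h \<mapsto> q - h\<close>, and \<open>sum_gcd_geo\<close> can treat both terms
  alike.\<close>

lemma norm_sum_char_mod_le:
  assumes h: "0 < h" "h < q"
  shows "norm (\<Sum>a\<in>{m<..n :: int}. char_mod q (int h * a)) \<le> real q / real h + real q / real (q - h)"
proof -
  define z where "z = char_mod q (int h)"
  have q: "q > 0" using h by simp
  have z1: "norm (1 - z) \<ge> 2 * real (min h (q - h)) / real q"
  proof (cases "2 * h \<le> q")
    case True
    then show ?thesis using norm_1_minus_char_mod_ge[of h q] h by (simp add: z_def min_def)
  next
    case False
    have "char_mod q (int (q - h)) = char_mod q (- int h)"
      using h by (intro char_mod_cong q) (simp add: cong_iff_dvd_diff of_nat_diff)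
    also have "\<dots> = cnj z" by (simp add: z_def char_mod_def cis_cnj)
    finally have "norm (1 - char_mod q (int (q - h))) = norm (cnj (1 - z))" by simp
    then show ?thesis using norm_1_minus_char_mod_ge[of "q - h" q] h False by (simp add: min_def del: complex_cnj_diff)
  qed
  have "0 < 2 * real (min h (q - h)) / real q" using h by (simp add: min_def)
  then have z_ne: "norm (1 - z) > 0" using z1 by (rule less_le_trans)
  have "(\<Sum>a\<in>{m<..n}. char_mod q (int h * a)) = (\<Sum>j<nat (n - m). char_mod q (int h * (m + 1)) * z ^ j)"
  proof (rule sum.reindex_bij_witness[of _ "\<lambda>j. m + 1 + int j" "\<lambda>a. nat (a - m - 1)"])
    fix a assume a: "a \<in> {m<..n}"
    have "char_mod q (int h * (m + 1)) * z ^ nat (a - m - 1) = char_mod q (int h * (m + 1) + int (nat (a - m - 1)) * int h)"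
      by (simp only: z_def char_mod_power char_mod_add)
    also have "int h * (m + 1) + int (nat (a - m - 1)) * int h = int h * a" using a by (simp add: algebra_simps)
    finally show "char_mod q (int h * (m + 1)) * z ^ nat (a - m - 1) = char_mod q (int h * a)" .
  qed auto
  also have "\<dots> = char_mod q (int h * (m + 1)) * (\<Sum>j<nat (n - m). z ^ j)" by (simp add: sum_distrib_left)
  also have "(\<Sum>j<nat (n - m). z ^ j) = (1 - z ^ nat (n - m)) / (1 - z)"
    using z_ne by (subst sum_gp_strict) auto
  also have "norm (char_mod q (int h * (m + 1)) * ((1 - z ^ nat (n - m)) / (1 - z))) = norm (1 - z ^ nat (n - m)) / norm (1 - z)"
    by (simp add: norm_mult norm_divide)
  also have "\<dots> \<le> 2 / norm (1 - z)"
  proof (rule divide_right_mono)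
    have "norm (1 - z ^ nat (n - m)) \<le> norm (1 :: complex) + norm (z ^ nat (n - m))" by (rule norm_triangle_ineq4)
    then show "norm (1 - z ^ nat (n - m)) \<le> 2" by (simp add: norm_power z_def)
  qed simp
  also have "\<dots> \<le> 2 / (2 * real (min h (q - h)) / real q)"
    using z1 z_ne h by (intro divide_left_mono mult_pos_pos) (auto simp: min_def)
  also have "\<dots> = real q / real (min h (q - h))" by simp
  also have "\<dots> \<le> real q / real h + real q / real (q - h)" by (auto simp: min_def)
  finally show ?thesis .
qed

section \<open>Completing the sum over a box\<close>

lemma interval_eq: "{a :: int. A < of_int a \<and> of_int a \<le> (B :: real)} = {\<lfloor>A\<rfloor><..\<lfloor>B\<rfloor>}"
  by (auto simp: floor_less_iff le_floor_iff)

lemma card_interval: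
  assumes "K > 0"
  shows "\<bar>real (card {\<lfloor>A\<rfloor><..\<lfloor>A + K\<rfloor>}) - K\<bar> \<le> 1"
proof -
  have "\<lfloor>A\<rfloor> \<le> \<lfloor>A + K\<rfloor>" using assms by (intro floor_mono) simp
  then have "real (card {\<lfloor>A\<rfloor><..\<lfloor>A + K\<rfloor>}) = of_int (\<lfloor>A + K\<rfloor> - \<lfloor>A\<rfloor>)" by simp
  then show ?thesis by (simp only: of_int_diff) linarith
qed

context
  fixes q :: nat and l :: int and I J :: "int set"
  assumes q: "q > 0" and l: "coprime l (int q)" and fin: "finite I" "finite J"
begin

definition GI :: "nat \<Rightarrow> complex" where "GI h = (\<Sum>a\<in>I. char_mod q (int h * a))"
definition GJ :: "nat \<Rightarrow> complex" where "GJ k = (\<Sum>b\<in>J. char_mod q (int k * b))"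

lemma detect:
  assumes "c \<in> {0..<int q}"
  shows "(\<Sum>h<q. char_mod q (int h * (a - c))) = (if a mod int q = c then of_nat q else 0)"
proof -
  have "(\<Sum>h<q. char_mod q (int h * (a - c))) = (if int q dvd a - c then of_nat q else 0)"
    using sum_char_mod[OF q, of "a - c"] by (simp add: mult.commute)
  moreover have "int q dvd a - c \<longleftrightarrow> a mod int q = c"
    using assms q by (auto simp: mod_eq_dvd_iff[symmetric])
  ultimately show ?thesis by simp
qed

lemma completion:
  "of_nat (q ^ 2 * card {(a, b). a \<in> I \<and> b \<in> J \<and> [a ^ 2 * b ^ 3 = l] (mod int q)}) =
    (\<Sum>h<q. \<Sum>k<q. GI h * GJ k * ES q l (- int h) (- int k))"
proof -
  have pt: "(\<Sum>h<q. \<Sum>k<q. char_mod q (int h * a) * char_mod q (int k * b) * ES q l (- int h) (- int k)) =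
    (if [a ^ 2 * b ^ 3 = l] (mod int q) then of_nat (q ^ 2) else 0)" for a b
  proof -
    have "(\<Sum>h<q. \<Sum>k<q. char_mod q (int h * a) * char_mod q (int k * b) * ES q l (- int h) (- int k)) =
      (\<Sum>h<q. \<Sum>k<q. \<Sum>s\<in>sols q l. char_mod q (int h * (a - fst s)) * char_mod q (int k * (b - snd s)))"
      unfolding ES_def sum_distrib_left
      by (intro sum.cong refl) (simp add: case_prod_unfold algebra_simps flip: char_mod_add)
    also have "\<dots> = (\<Sum>s\<in>sols q l. \<Sum>h<q. \<Sum>k<q. char_mod q (int h * (a - fst s)) * char_mod q (int k * (b - snd s)))"
      by (simp only: sum.swap[of _ "{..<q}" "sols q l"])
    also have "\<dots> = (\<Sum>s\<in>sols q l. (\<Sum>h<q. char_mod q (int h * (a - fst s))) * (\<Sum>k<q. char_mod q (int k * (b - snd s))))"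
      by (simp add: sum_product)
    also have "\<dots> = (\<Sum>s\<in>sols q l. if s = (a mod int q, b mod int q) then of_nat (q ^ 2) else 0)"
    proof (rule sum.cong[OF refl])
      fix s assume s: "s \<in> sols q l"
      then have "fst s \<in> {0..<int q}" "snd s \<in> {0..<int q}" by (auto simp: sols_def)
      then show "(\<Sum>h<q. char_mod q (int h * (a - fst s))) * (\<Sum>k<q. char_mod q (int k * (b - snd s))) =
        (if s = (a mod int q, b mod int q) then of_nat (q ^ 2) else 0)"
        by (cases s) (auto simp: detect power2_eq_square)
    qed
    also have "\<dots> = (if (a mod int q, b mod int q) \<in> sols q l then of_nat (q ^ 2) else 0)"
      by (simp add: sum.delta)
    also have "(a mod int q, b mod int q) \<in> sols q l \<longleftrightarrow> [a ^ 2 * b ^ 3 = l] (mod int q)"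
    proof -
      have "[(a mod int q) ^ 2 * (b mod int q) ^ 3 = a ^ 2 * b ^ 3] (mod int q)"
        by (intro cong_mult cong_pow) auto
      then have "[(a mod int q) ^ 2 * (b mod int q) ^ 3 = l] (mod int q) \<longleftrightarrow> [a ^ 2 * b ^ 3 = l] (mod int q)"
        by (simp add: cong_def)
      then show ?thesis using q by (simp add: sols_def)
    qed
    finally show ?thesis .
  qed
  have "(\<Sum>h<q. \<Sum>k<q. GI h * GJ k * ES q l (- int h) (- int k)) =
    (\<Sum>h<q. \<Sum>k<q. \<Sum>x\<in>I \<times> J. char_mod q (int h * fst x) * char_mod q (int k * snd x) * ES q l (- int h) (- int k))"
    unfolding GI_def GJ_def sum_product
    by (intro sum.cong refl) (simp add: sum.cartesian_product sum_distrib_right case_prod_unfold)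
  also have "\<dots> = (\<Sum>x\<in>I \<times> J. \<Sum>h<q. \<Sum>k<q. char_mod q (int h * fst x) * char_mod q (int k * snd x) * ES q l (- int h) (- int k))"
    by (simp only: sum.swap[of _ "{..<q}" "I \<times> J"])
  also have "\<dots> = (\<Sum>x\<in>I \<times> J. if [fst x ^ 2 * snd x ^ 3 = l] (mod int q) then of_nat (q ^ 2) else 0)"
    by (simp only: pt)
  also have "\<dots> = of_nat (q ^ 2) * of_nat (card {x \<in> I \<times> J. [fst x ^ 2 * snd x ^ 3 = l] (mod int q)})"
    using fin by (simp add: sum.If_cases Int_def)
  also have "{x \<in> I \<times> J. [fst x ^ 2 * snd x ^ 3 = l] (mod int q)} = {(a, b). a \<in> I \<and> b \<in> J \<and> [a ^ 2 * b ^ 3 = l] (mod int q)}"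
    by auto
  finally show ?thesis by simp
qed

definition sqrt_gcd :: "nat \<Rightarrow> real" where "sqrt_gcd h = sqrt (real (gcd h q))"
definition ES_fac :: real where "ES_fac = 300 ^ card (prime_factors q) * sqrt (real q)"
definition gcd_fac :: real where "gcd_fac = (1 + ln (real q)) * 4 ^ card (prime_factors q)"
definition geo_bd :: "nat \<Rightarrow> real" where "geo_bd h = real q / real h + real q / real (q - h)"

lemma sum_gcd_geo: "(\<Sum>h\<in>{1..<q}. sqrt_gcd h * geo_bd h) \<le> 2 * real q * gcd_fac"
proof -
  have "(\<Sum>h\<in>{1..<q}. sqrt_gcd h / real (q - h)) = (\<Sum>h\<in>{1..<q}. sqrt_gcd h / real h)"
  proof (rule sum.reindex_bij_witness[of _ "\<lambda>h. q - h" "\<lambda>h. q - h"])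
    fix h assume h: "h \<in> {1..<q}"
    have "gcd (q - h) q = gcd h q" using gcd_diff2_nat[of h q] h by simp
    then show "sqrt_gcd (q - h) / real (q - h) = sqrt_gcd h / real (q - h)" by (simp add: sqrt_gcd_def)
  qed auto
  moreover have "(\<Sum>h\<in>{1..<q}. sqrt_gcd h * geo_bd h) = real q * (\<Sum>h\<in>{1..<q}. sqrt_gcd h / real h) + real q * (\<Sum>h\<in>{1..<q}. sqrt_gcd h / real (q - h))"
    by (simp add: geo_bd_def sum_distrib_left distrib_left sum.distrib mult_ac)
  moreover have "(\<Sum>h\<in>{1..<q}. sqrt_gcd h / real h) \<le> gcd_fac" using sum_gcd_le[OF q] by (simp add: sqrt_gcd_def gcd_fac_def)
  then have "real q * (\<Sum>h\<in>{1..<q}. sqrt_gcd h / real h) \<le> real q * gcd_fac" by (intro mult_left_mono) auto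
  ultimately show ?thesis by simp
qed

lemma sqrt_gcd_ge_1: "h > 0 \<Longrightarrow> sqrt_gcd h \<ge> 1"
  by (simp add: sqrt_gcd_def Suc_le_eq)

lemma geo_bd_nonneg: "geo_bd h \<ge> 0" by (simp add: geo_bd_def)

lemma ES_fac_nonneg: "ES_fac \<ge> 0" by (simp add: ES_fac_def)

text \<open>The gcd is estimated through a single nonzero frequency; both orders are recorded
  because the zero frequency may belong to either variable.\<close>

lemma norm_ES_gcd:
  assumes "h = k \<or> h > 0 \<and> k > 0 \<or> h > 0 \<and> k = 0" "h > 0"
  shows "norm (ES q l (- int h) (- int k)) \<le> ES_fac * sqrt_gcd h" "norm (ES q l (- int k) (- int h)) \<le> ES_fac * sqrt_gcd h"
proof -
  have g: "sqrt (real q * real_of_int (gcd (gcd (- int h) (- int k)) (int q))) \<le> sqrt (real q) * sqrt_gcd h"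
    "sqrt (real q * real_of_int (gcd (gcd (- int k) (- int h)) (int q))) \<le> sqrt (real q) * sqrt_gcd h"
  proof -
    have "gcd (gcd (- int h) (- int k)) (int q) = int (gcd (gcd h k) q)" 
      "gcd (gcd (- int k) (- int h)) (int q) = int (gcd (gcd h k) q)" by (simp_all add: gcd.commute)
    moreover have "gcd (gcd h k) q \<le> gcd h q"
      using assms(2) by (intro dvd_imp_le gcd_mono) auto
    ultimately show "sqrt (real q * real_of_int (gcd (gcd (- int h) (- int k)) (int q))) \<le> sqrt (real q) * sqrt_gcd h"
      "sqrt (real q * real_of_int (gcd (gcd (- int k) (- int h)) (int q))) \<le> sqrt (real q) * sqrt_gcd h"
      unfolding sqrt_gcd_def real_sqrt_mult[symmetric] by (auto intro!: mult_left_mono)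
  qed
  have "norm (ES q l x y) \<le> ES_fac * sqrt_gcd h"
    if "sqrt (real q * real_of_int (gcd (gcd x y) (int q))) \<le> sqrt (real q) * sqrt_gcd h" for x y
  proof -
    have "norm (ES q l x y) \<le> 300 ^ card (prime_factors q) * sqrt (real q * real_of_int (gcd (gcd x y) (int q)))"
      by (rule norm_ES_le[OF q l])
    also have "\<dots> \<le> 300 ^ card (prime_factors q) * (sqrt (real q) * sqrt_gcd h)"
      by (intro mult_left_mono that) simp
    finally show ?thesis by (simp add: ES_fac_def)
  qed
  then show "norm (ES q l (- int h) (- int k)) \<le> ES_fac * sqrt_gcd h" "norm (ES q l (- int k) (- int h)) \<le> ES_fac * sqrt_gcd h"
    using g by blast+
qed

lemma completed_bound:
  assumes I: "I = {i0<..i1}" and J: "J = {j0<..j1}"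
  defines "N \<equiv> card {(a, b). a \<in> I \<and> b \<in> J \<and> [a ^ 2 * b ^ 3 = l] (mod int q)}"
  shows "\<bar>real q ^ 2 * real N - real (totient q) * real (card I) * real (card J)\<bar>
    \<le> ES_fac * ((real (card I) + real (card J)) * (2 * real q * gcd_fac) + (2 * real q * gcd_fac) ^ 2)"
proof -
  define W where "W = (\<Sum>h\<in>{1..<q}. sqrt_gcd h * geo_bd h)"
  have W: "0 \<le> W" "W \<le> 2 * real q * gcd_fac"
    using sum_gcd_geo geo_bd_nonneg by (auto simp: W_def sqrt_gcd_def intro!: sum_nonneg)
  define E where "E h k = GI h * GJ k * ES q l (- int h) (- int k)" for h k
  have split: "{..<q} = insert 0 {1..<q}" using q by auto
  have G0: "GI 0 = of_nat (card I)" "GJ 0 = of_nat (card J)" by (simp_all add: GI_def GJ_def)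
  have GIb: "norm (GI h) \<le> geo_bd h" if "h \<in> {1..<q}" for h
    unfolding GI_def unfolding I geo_bd_def using that by (intro norm_sum_char_mod_le) auto
  have GJb: "norm (GJ h) \<le> geo_bd h" if "h \<in> {1..<q}" for h
    unfolding GJ_def unfolding J geo_bd_def using that by (intro norm_sum_char_mod_le) auto
  have "of_nat (q ^ 2 * N) = (\<Sum>h<q. \<Sum>k<q. E h k)" unfolding N_def completion E_def ..
  also have "\<dots> = E 0 0 + (\<Sum>k\<in>{1..<q}. E 0 k) + (\<Sum>h\<in>{1..<q}. E h 0) + (\<Sum>h\<in>{1..<q}. \<Sum>k\<in>{1..<q}. E h k)"
    unfolding split by (simp add: sum.distrib)
  also have "E 0 0 = of_nat (totient q * card I * card J)"
    using ES_0[OF q l, of 0 0] by (simp add: E_def G0)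
  finally have eq: "of_nat (q ^ 2 * N) - of_nat (totient q * card I * card J) =
    (\<Sum>k\<in>{1..<q}. E 0 k) + (\<Sum>h\<in>{1..<q}. E h 0) + (\<Sum>h\<in>{1..<q}. \<Sum>k\<in>{1..<q}. E h k)" by simp
  have t1: "norm (\<Sum>k\<in>{1..<q}. E 0 k) \<le> real (card I) * ES_fac * W"
  proof -
    have "norm (\<Sum>k\<in>{1..<q}. E 0 k) \<le> (\<Sum>k\<in>{1..<q}. real (card I) * (geo_bd k * (ES_fac * sqrt_gcd k)))"
    proof (rule sum_norm_le)
      fix k assume k: "k \<in> {1..<q}"
      have "norm (GJ k) * norm (ES q l (- int 0) (- int k)) \<le> geo_bd k * (ES_fac * sqrt_gcd k)"
        using GJb[OF k] norm_ES_gcd(2)[of k 0] k geo_bd_nonneg by (intro mult_mono) auto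
      then show "norm (E 0 k) \<le> real (card I) * (geo_bd k * (ES_fac * sqrt_gcd k))"
        unfolding E_def G0 norm_mult norm_of_nat mult.assoc by (intro mult_left_mono) auto
    qed
    also have "\<dots> = real (card I) * ES_fac * W" by (simp add: W_def sum_distrib_left mult_ac)
    finally show ?thesis .
  qed
  have t2: "norm (\<Sum>h\<in>{1..<q}. E h 0) \<le> real (card J) * ES_fac * W"
  proof -
    have "norm (\<Sum>h\<in>{1..<q}. E h 0) \<le> (\<Sum>h\<in>{1..<q}. real (card J) * (geo_bd h * (ES_fac * sqrt_gcd h)))"
    proof (rule sum_norm_le)
      fix h assume h: "h \<in> {1..<q}"
      have "norm (GI h) * norm (ES q l (- int h) (- int 0)) \<le> geo_bd h * (ES_fac * sqrt_gcd h)"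
        using GIb[OF h] norm_ES_gcd(1)[of h 0] h geo_bd_nonneg by (intro mult_mono) auto
      then have "real (card J) * (norm (GI h) * norm (ES q l (- int h) (- int 0))) \<le> real (card J) * (geo_bd h * (ES_fac * sqrt_gcd h))"
        by (intro mult_left_mono) auto
      then show "norm (E h 0) \<le> real (card J) * (geo_bd h * (ES_fac * sqrt_gcd h))"
        unfolding E_def G0 norm_mult norm_of_nat by (simp add: mult_ac)
    qed
    also have "\<dots> = real (card J) * ES_fac * W" by (simp add: W_def sum_distrib_left mult_ac)
    finally show ?thesis .
  qed
  have t3: "norm (\<Sum>h\<in>{1..<q}. \<Sum>k\<in>{1..<q}. E h k) \<le> ES_fac * W ^ 2"
  proof -
    have "norm (\<Sum>h\<in>{1..<q}. \<Sum>k\<in>{1..<q}. E h k) \<le> (\<Sum>h\<in>{1..<q}. \<Sum>k\<in>{1..<q}. (sqrt_gcd h * geo_bd h) * (sqrt_gcd k * geo_bd k) * ES_fac)"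
    proof (intro sum_norm_le)
      fix h k assume hk: "h \<in> {1..<q}" "k \<in> {1..<q}"
      have "norm (GI h) * norm (GJ k) * norm (ES q l (- int h) (- int k)) \<le> geo_bd h * geo_bd k * (ES_fac * sqrt_gcd h)"
        using GIb[OF hk(1)] GJb[OF hk(2)] norm_ES_gcd(1)[of h k] hk geo_bd_nonneg by (intro mult_mono) auto
      \<comment> \<open>The factor \<open>sqrt_gcd k \<ge> 1\<close> is inserted to make the summand
        a product of one function at \<open>h\<close> and at \<open>k\<close>, so that the double
        sum becomes a multiple of \<open>W ^ 2\<close>.\<close>
      also have "\<dots> = geo_bd h * geo_bd k * (ES_fac * sqrt_gcd h) * 1" by simp
      also have "\<dots> \<le> geo_bd h * geo_bd k * (ES_fac * sqrt_gcd h) * sqrt_gcd k"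
        using sqrt_gcd_ge_1[of k] hk geo_bd_nonneg ES_fac_nonneg by (intro mult_left_mono) (auto simp: sqrt_gcd_def)
      finally show "norm (E h k) \<le> (sqrt_gcd h * geo_bd h) * (sqrt_gcd k * geo_bd k) * ES_fac"
        unfolding E_def norm_mult by (simp add: mult_ac)
    qed
    also have "\<dots> = ES_fac * W ^ 2" by (simp add: W_def power2_eq_square sum_product sum_distrib_left mult_ac)
    finally show ?thesis .
  qed
  have "\<bar>real q ^ 2 * real N - real (totient q) * real (card I) * real (card J)\<bar> =
    norm (complex_of_real (real q ^ 2 * real N - real (totient q) * real (card I) * real (card J)))"
    by (simp only: norm_of_real)
  also have "complex_of_real (real q ^ 2 * real N - real (totient q) * real (card I) * real (card J)) =
    of_nat (q ^ 2 * N) - of_nat (totient q * card I * card J)" by simp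
  also have "norm \<dots> \<le> real (card I) * ES_fac * W + real (card J) * ES_fac * W + ES_fac * W ^ 2"
    unfolding eq by (intro order.trans[OF norm_triangle_ineq] add_mono t1 t2 t3)
  also have "\<dots> = ES_fac * ((real (card I) + real (card J)) * W + W ^ 2)" by (simp add: algebra_simps)
  also have "\<dots> \<le> ES_fac * ((real (card I) + real (card J)) * (2 * real q * gcd_fac) + (2 * real q * gcd_fac) ^ 2)"
    using W ES_fac_nonneg by (intro mult_left_mono add_mono power_mono) auto
  finally show ?thesis .
qed

end

text \<open>The intervals enter through integer counts within 1 of \<open>K\<close> and
  \<open>L\<close>, which holds also for lengths below 1; passing to \<open>K * L\<close> costs at
  most \<open>(K + L + 1) / q\<close>, absorbed by \<open>D' \<ge> 1\<close>. The base 16 is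
  \<open>4 ^ 2\<close>, because the gcd sum enters squared.\<close>

lemma N_count_bound:
  fixes q :: nat and A B K L :: real
  assumes q: "q > 0" and l: "coprime l (int q)" and K: "K > 0" and L: "L > 0"
  defines "D' \<equiv> 300 ^ card (prime_factors q) * (16 ^ card (prime_factors q) * (1 + ln (real q)) ^ 2)"
  shows "\<bar>real (N_count q l A B K L) - real (totient q) * K * L / (real q)\<^sup>2\<bar>
    \<le> 13 * D' * ((K + L) / sqrt (real q) + sqrt (real q))"
proof -
  define I where "I = {\<lfloor>A\<rfloor><..\<lfloor>A + K\<rfloor>}"
  define J where "J = {\<lfloor>B\<rfloor><..\<lfloor>B + L\<rfloor>}"
  define c where "c = real (card I)"
  define d where "d = real (card J)"
  define N where "N = N_count q l A B K L"
  define M' where "M' = (300 :: real) ^ card (prime_factors q)"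
  define E where "E = (1 + ln (real q)) * 4 ^ card (prime_factors q)"
  define s where "s = sqrt (real q)"
  have s1: "s \<ge> 1" using q by (simp add: s_def)
  have ss: "real q = s ^ 2" by (simp add: s_def)
  have E1: "E \<ge> 1"
  proof -
    have "1 * 1 \<le> (1 + ln (real q)) * 4 ^ card (prime_factors q)" using q by (intro mult_mono) auto
    then show ?thesis by (simp add: E_def)
  qed
  have M1: "M' \<ge> 1" by (simp add: M'_def)
  have D': "D' = M' * E ^ 2"
    by (simp add: D'_def M'_def E_def power_mult_distrib power2_eq_square flip: power_mult_distrib)
  have c: "\<bar>c - K\<bar> \<le> 1" and d: "\<bar>d - L\<bar> \<le> 1"
    using card_interval[OF K, of A] card_interval[OF L, of B] by (simp_all add: c_def d_def I_def J_def)
  have cd0: "c \<ge> 0" "d \<ge> 0" by (simp_all add: c_def d_def)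
  have N: "N = card {(a, b). a \<in> I \<and> b \<in> J \<and> [a ^ 2 * b ^ 3 = l] (mod int q)}"
    unfolding N_def N_count_def I_def J_def interval_eq[symmetric] by (rule arg_cong[of _ _ card]) auto
  have "\<bar>real q ^ 2 * real N - real (totient q) * c * d\<bar>
    \<le> (M' * s) * ((c + d) * (2 * real q * E) + (2 * real q * E) ^ 2)"
  proof -
    have fin: "finite I" "finite J" by (simp_all add: I_def J_def)
    have "ES_fac q = M' * s" "gcd_fac q = E"
      using ES_fac_def[OF q l fin] gcd_fac_def[OF q l fin] by (simp_all add: M'_def s_def E_def)
    then show ?thesis
      using completed_bound[OF q l fin I_def J_def] unfolding N c_def d_def by simp
  qed
  also have "\<dots> \<le> (M' * s) * ((K + L + 2) * (2 * real q * E) + (2 * real q * E) ^ 2)"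
  proof -
    have "c + d \<le> K + L + 2" using c d by linarith
    then have "(c + d) * (2 * real q * E) \<le> (K + L + 2) * (2 * real q * E)"
      using E1 by (intro mult_right_mono) auto
    then show ?thesis using M1 s1 by (intro mult_left_mono) auto
  qed
  also have "\<dots> \<le> (M' * s) * ((K + L + 2) * (2 * real q * E ^ 2) + 4 * real q ^ 2 * E ^ 2)"
  proof -
    have "E \<le> E ^ 2" using E1 by (simp add: power2_eq_square)
    then show ?thesis using M1 s1 K L
      by (intro mult_left_mono add_mono) (auto simp: power_mult_distrib)
  qed
  also have "\<dots> = real q ^ 2 * (D' * (2 * (K + L + 2) / s + 4 * s))"
    using s1 unfolding D' ss by (simp add: field_simps eval_nat_numeral)
  finally have 1: "\<bar>real q ^ 2 * real N - real (totient q) * c * d\<bar> \<le> real q ^ 2 * (D' * (2 * (K + L + 2) / s + 4 * s))" .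
  have q2: "real q ^ 2 > 0" using q by simp
  have "real N - real (totient q) * c * d / real q ^ 2 = (real q ^ 2 * real N - real (totient q) * c * d) / real q ^ 2"
    using q by (simp add: field_simps)
  then have "\<bar>real N - real (totient q) * c * d / real q ^ 2\<bar> = \<bar>real q ^ 2 * real N - real (totient q) * c * d\<bar> / real q ^ 2"
    using q2 by simp
  also have "\<dots> \<le> D' * (2 * (K + L + 2) / s + 4 * s)"
    using 1 q2 by (simp add: pos_divide_le_eq mult.commute)
  finally have main: "\<bar>real N - real (totient q) * c * d / real q ^ 2\<bar> \<le> D' * (2 * (K + L + 2) / s + 4 * s)" .
  have "\<bar>c * d - K * L\<bar> \<le> K + L + 1"
  proof -
    have "c * d - K * L = (c - K) * (d - L) + (c - K) * L + K * (d - L)" by (simp add: algebra_simps)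
    also have "\<bar>\<dots>\<bar> \<le> \<bar>(c - K) * (d - L)\<bar> + \<bar>(c - K) * L\<bar> + \<bar>K * (d - L)\<bar>" by linarith
    also have "\<dots> \<le> 1 * 1 + 1 * L + K * 1"
      unfolding abs_mult using c d K L by (intro add_mono mult_mono) auto
    finally show ?thesis by simp
  qed
  then have "real (totient q) * \<bar>c * d - K * L\<bar> \<le> real q * (K + L + 1)"
    using totient_le[of q] K L by (intro mult_mono) auto
  then have "real (totient q) * \<bar>c * d - K * L\<bar> / real q ^ 2 \<le> (real q * (K + L + 1)) / real q ^ 2"
    by (rule divide_right_mono) simp
  also have "\<dots> = (K + L + 1) / (s * s)" using q by (simp add: power2_eq_square s_def)
  also have "\<dots> \<le> (K + L + 1) / (s * 1)"
    using s1 K L by (intro divide_left_mono mult_left_mono mult_pos_pos) auto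
  finally have "real (totient q) * \<bar>c * d - K * L\<bar> / real q ^ 2 \<le> (K + L + 1) / s" by simp
  moreover have "\<bar>real (totient q) * c * d / real q ^ 2 - real (totient q) * K * L / real q ^ 2\<bar> =
    real (totient q) * \<bar>c * d - K * L\<bar> / real q ^ 2"
  proof -
    have "real (totient q) * c * d / real q ^ 2 - real (totient q) * K * L / real q ^ 2 = real (totient q) * (c * d - K * L) / real q ^ 2"
      by (simp add: diff_divide_distrib algebra_simps)
    then show ?thesis by (simp only: abs_divide abs_mult) simp
  qed
  ultimately have sec: "\<bar>real (totient q) * c * d / real q ^ 2 - real (totient q) * K * L / real q ^ 2\<bar> \<le> (K + L + 1) / s"
    by linarith
  have D1: "D' \<ge> 1"
  proof -
    have "1 * 1 \<le> M' * E ^ 2" using M1 E1 by (intro mult_mono one_le_power) auto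
    then show ?thesis by (simp add: D')
  qed
  have inv: "1 / s \<le> s" using s1 by (simp add: divide_le_eq) (metis mult_mono mult_1 order.trans zero_le_one le_numeral_extra(1))
  have "\<bar>real N - real (totient q) * K * L / real q ^ 2\<bar> \<le> D' * (2 * (K + L + 2) / s + 4 * s) + 1 * ((K + L + 1) / s)"
  proof -
    have "\<bar>x - y\<bar> \<le> a \<Longrightarrow> \<bar>y - z\<bar> \<le> b \<Longrightarrow> \<bar>x - z\<bar> \<le> a + 1 * b" for x y z a b :: real
      by linarith
    from this[OF main sec] show ?thesis .
  qed
  also have "\<dots> \<le> D' * (2 * (K + L + 2) / s + 4 * s) + D' * ((K + L + 1) / s)"
    using D1 K L s1 by (intro add_mono mult_right_mono) auto
  also have "\<dots> = D' * (3 * ((K + L) / s) + 5 * (1 / s) + 4 * s)"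
    by (simp add: add_divide_distrib algebra_simps)
  also have "\<dots> \<le> D' * (13 * ((K + L) / s + s))"
  proof (rule mult_left_mono)
    have "(K + L) / s \<ge> 0" using K L s1 by simp
    moreover have "0 \<le> a \<Longrightarrow> b \<le> s \<Longrightarrow> 3 * a + 5 * b + 4 * s \<le> 13 * (a + s)" for a b :: real
      using s1 by simp
    ultimately show "3 * ((K + L) / s) + 5 * (1 / s) + 4 * s \<le> 13 * ((K + L) / s + s)" using inv by blast
  qed (use D1 in simp)
  finally show ?thesis by (simp add: N_def s_def mult_ac)
qed

theorem theorem4:
  fixes \<epsilon> :: real
  assumes "\<epsilon> > 0"
  shows "\<exists>C > 0. \<forall>(q :: nat) (l :: int) (A :: real) (B :: real) (K :: real) (L :: real).
    q \<ge> 1 \<longrightarrow> coprime l (int q) \<longrightarrow> K > 0 \<longrightarrow> L > 0 \<longrightarrow>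
      \<bar>real (N_count q l A B K L) - real (totient q) * K * L / (real q)\<^sup>2\<bar>
        \<le> C * ((K + L) / real q powr (1 / 2 - \<epsilon>) + real q powr (1 / 2 + \<epsilon>))"
proof -
  \<comment> \<open>\<open>4800 = 300 * 16\<close> merges the two powers in the number of primes;
    this power and the squared logarithm each take half of \<open>\<epsilon>\<close>.\<close>
  obtain C1 where C1: "C1 > 0" "\<And>q. q > 0 \<Longrightarrow> (4800 :: real) ^ card (prime_factors q) \<le> C1 * real q powr (\<epsilon> / 2)"
    using power_omega_le_powr[of 4800 "\<epsilon> / 2"] assms by auto
  obtain C2 where C2: "C2 > 0" "\<And>q. q > 0 \<Longrightarrow> (1 + ln (real q)) ^ 2 \<le> C2 * real q powr (\<epsilon> / 2)"
    using ln_sq_le_powr[of "\<epsilon> / 2"] assms by auto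
  have "\<bar>real (N_count q l A B K L) - real (totient q) * K * L / (real q)\<^sup>2\<bar>
        \<le> 13 * C1 * C2 * ((K + L) / real q powr (1 / 2 - \<epsilon>) + real q powr (1 / 2 + \<epsilon>))"
    if q: "q \<ge> 1" and l: "coprime l (int q)" and K: "K > 0" and L: "L > 0" for q l A B K L
  proof -
    have q0: "q > 0" using q by simp
    define Y where "Y = (K + L) / sqrt (real q) + sqrt (real q)"
    have Y: "Y \<ge> 0" using K L by (simp add: Y_def)
    have "300 ^ card (prime_factors q) * (16 ^ card (prime_factors q) * (1 + ln (real q)) ^ 2) =
      4800 ^ card (prime_factors q) * (1 + ln (real q)) ^ 2"
      by (simp add: power_mult_distrib[symmetric] mult.assoc[symmetric])
    also have "\<dots> \<le> (C1 * real q powr (\<epsilon> / 2)) * (C2 * real q powr (\<epsilon> / 2))"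
      using C1 C2 q0 by (intro mult_mono) auto
    also have "\<dots> = C1 * C2 * real q powr \<epsilon>" by (simp add: mult_ac flip: powr_add)
    finally have le: "300 ^ card (prime_factors q) * (16 ^ card (prime_factors q) * (1 + ln (real q)) ^ 2) \<le> C1 * C2 * real q powr \<epsilon>" .
    have "\<bar>real (N_count q l A B K L) - real (totient q) * K * L / (real q)\<^sup>2\<bar> \<le>
      13 * (300 ^ card (prime_factors q) * (16 ^ card (prime_factors q) * (1 + ln (real q)) ^ 2)) * Y"
      unfolding Y_def by (rule N_count_bound[OF q0 l K L])
    also have "\<dots> \<le> 13 * (C1 * C2 * real q powr \<epsilon>) * Y"
      using le Y by (intro mult_right_mono mult_left_mono) auto
    also have "\<dots> = 13 * C1 * C2 * (real q powr \<epsilon>* Y)" by simp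
    also have "real q powr \<epsilon> * Y = (K + L) / real q powr (1 / 2 - \<epsilon>) + real q powr (1 / 2 + \<epsilon>)"
      using q0 by (simp add: Y_def powr_diff powr_add powr_half_sqrt distrib_left mult.commute)
    finally show ?thesis .
  qed
  then show ?thesis using C1(1) C2(1) by (intro exI[of _ "13 * C1 * C2"]) auto
qed

end
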